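(* Let $X$ be an affine variety over $\mathbf{k}$ and let $\mathfrak{g}$ be a Lie algebra with a Lie algebra homomorphism $\alpha:\mathfrak{g}\to\operatorname{Vect}(X)$. Suppose $X$ is a union of finitely many $\mathfrak{g}$-leaves. Then the coinvariant space $\mathcal{O}(X)_{\mathfrak{g}}:=\mathcal{O}(X)/\alpha(\mathfrak{g})\cdot\mathcal{O}(X)$ is finite-dimensional, where $\alpha(\mathfrak{g})\cdot\mathcal{O}(X)$ is the linear span of all $\alpha(\xi)(h)$, $\xi\in\mathfrak{g}$, $h\in\mathcal{O}(X)$.
   Context: $\mathbf{k}$ is an algebraically closed field of characteristic zero. A variety is a reduced separated scheme of finite type over $\mathbf{k}$. $\operatorname{Vect}(X)=\operatorname{Der}_{\mathbf{k}}(\mathcal{O}(X))$ is the Lie algebra of vector fields on the affine variety $X$. For $x\in X$, $\alpha_x:\mathfrak{g}\to T_xX$ denotes the composition of $\alpha$ with evaluation at $x$. A $\mathfrak{g}$-leaf is a maximal locally closed connected subvariety $Z\subseteq X$ such that for all $z\in Z$ the image of $\alpha_z$ equals $T_zZ$. *)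

theory Defs
  imports "HOL-Computational_Algebra.Polynomial" "HOL-Library.Function_Algebras"
begin

text \<open>Ambient affine space: points of k^n are functions 'n => 'k with 'n a finite index type.
Regular (polynomial) functions on k^n: generated by constants and coordinates under + and *.\<close>

inductive_set poly_fun :: "(('n::finite \<Rightarrow> 'k::comm_ring_1) \<Rightarrow> 'k) set" where
  pf_const: "(\<lambda>x. c) \<in> poly_fun"
| pf_coord: "(\<lambda>x. x i) \<in> poly_fun"
| pf_add: "f \<in> poly_fun \<Longrightarrow> g \<in> poly_fun \<Longrightarrow> (\<lambda>x. f x + g x) \<in> poly_fun"
| pf_mult: "f \<in> poly_fun \<Longrightarrow> g \<in> poly_fun \<Longrightarrow> (\<lambda>x. f x * g x) \<in> poly_fun"

definition zclosed :: "('n::finite \<Rightarrow> 'k::comm_ring_1) set \<Rightarrow> bool" where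
  "zclosed C \<longleftrightarrow> (\<exists>F \<subseteq> poly_fun. C = {x. \<forall>f\<in>F. f x = 0})"

definition zopen :: "('n::finite \<Rightarrow> 'k::comm_ring_1) set \<Rightarrow> bool" where
  "zopen U \<longleftrightarrow> zclosed (- U)"

definition locally_closed :: "('n::finite \<Rightarrow> 'k::comm_ring_1) set \<Rightarrow> bool" where
  "locally_closed Z \<longleftrightarrow> (\<exists>U C. zopen U \<and> zclosed C \<and> Z = U \<inter> C)"

definition zconnected :: "('n::finite \<Rightarrow> 'k::comm_ring_1) set \<Rightarrow> bool" where
  "zconnected Z \<longleftrightarrow> \<not> (\<exists>A B. zclosed A \<and> zclosed B \<and> Z \<subseteq> A \<union> B \<and>
      A \<inter> Z \<noteq> {} \<and> B \<inter> Z \<noteq> {} \<and> A \<inter> B \<inter> Z = {})"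

definition dderiv :: "(('n::finite \<Rightarrow> 'k::comm_ring_1) \<Rightarrow> 'k) \<Rightarrow> ('n \<Rightarrow> 'k) \<Rightarrow> ('n \<Rightarrow> 'k) \<Rightarrow> 'k" where
  "dderiv f z v = (THE c. \<exists>p. (\<forall>t. poly p t = f (\<lambda>i. z i + t * v i)) \<and> coeff p 1 = c)"

definition tangent_space :: "('n::finite \<Rightarrow> 'k::comm_ring_1) set \<Rightarrow> ('n \<Rightarrow> 'k) \<Rightarrow> ('n \<Rightarrow> 'k) set" where
  "tangent_space Z z = {v. \<forall>f\<in>poly_fun. (\<forall>y\<in>Z. f y = 0) \<longrightarrow> dderiv f z v = 0}"

text \<open>Coordinate ring O(X) of a closed X: restrictions of polynomial functions to X
  (represented as functions vanishing outside X).\<close>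
definition restr :: "('n \<Rightarrow> 'k) set \<Rightarrow> (('n \<Rightarrow> 'k) \<Rightarrow> 'k::zero) \<Rightarrow> ('n \<Rightarrow> 'k) \<Rightarrow> 'k" where
  "restr X f = (\<lambda>x. if x \<in> X then f x else 0)"

definition coord_ring :: "('n::finite \<Rightarrow> 'k::comm_ring_1) set \<Rightarrow> (('n \<Rightarrow> 'k) \<Rightarrow> 'k) set" where
  "coord_ring X = {restr X p | p. p \<in> poly_fun}"

definition is_derivation :: "('n::finite \<Rightarrow> 'k::comm_ring_1) set \<Rightarrow>
    ((('n \<Rightarrow> 'k) \<Rightarrow> 'k) \<Rightarrow> (('n \<Rightarrow> 'k) \<Rightarrow> 'k)) \<Rightarrow> bool" where
  "is_derivation X D \<longleftrightarrow>
     (\<forall>f\<in>coord_ring X. D f \<in> coord_ring X) \<and>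
     (\<forall>f\<in>coord_ring X. \<forall>g\<in>coord_ring X. D (\<lambda>x. f x + g x) = (\<lambda>x. D f x + D g x)) \<and>
     (\<forall>c. \<forall>f\<in>coord_ring X. D (\<lambda>x. c * f x) = (\<lambda>x. c * D f x)) \<and>
     (\<forall>f\<in>coord_ring X. \<forall>g\<in>coord_ring X. D (\<lambda>x. f x * g x) = (\<lambda>x. f x * D g x + g x * D f x))"

definition lie_algebra :: "('k::field \<Rightarrow> 'g::ab_group_add \<Rightarrow> 'g) \<Rightarrow> ('g \<Rightarrow> 'g \<Rightarrow> 'g) \<Rightarrow> bool" where
  "lie_algebra sc br \<longleftrightarrow> vector_space sc \<and>
     (\<forall>a b c. br (a + b) c = br a c + br b c) \<and>
     (\<forall>a b c. br a (b + c) = br a b + br a c) \<and>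
     (\<forall>r a b. br (sc r a) b = sc r (br a b) \<and> br a (sc r b) = sc r (br a b)) \<and>
     (\<forall>a. br a a = 0) \<and>
     (\<forall>a b c. br a (br b c) + br b (br c a) + br c (br a b) = 0)"

definition lie_hom_vect :: "('n::finite \<Rightarrow> 'k::field) set \<Rightarrow> ('k \<Rightarrow> 'g::ab_group_add \<Rightarrow> 'g) \<Rightarrow> ('g \<Rightarrow> 'g \<Rightarrow> 'g) \<Rightarrow>
    ('g \<Rightarrow> (('n \<Rightarrow> 'k) \<Rightarrow> 'k) \<Rightarrow> (('n \<Rightarrow> 'k) \<Rightarrow> 'k)) \<Rightarrow> bool" where
  "lie_hom_vect X sc br \<alpha> \<longleftrightarrow>
     (\<forall>a. is_derivation X (\<alpha> a)) \<and>
     (\<forall>a b. \<forall>f\<in>coord_ring X. \<alpha> (a + b) f = (\<lambda>x. \<alpha> a f x + \<alpha> b f x)) \<and>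
     (\<forall>r a. \<forall>f\<in>coord_ring X. \<alpha> (sc r a) f = (\<lambda>x. r * \<alpha> a f x)) \<and>
     (\<forall>a b. \<forall>f\<in>coord_ring X. \<alpha> (br a b) f = (\<lambda>x. \<alpha> a (\<alpha> b f) x - \<alpha> b (\<alpha> a f) x))"

text \<open>alpha_x : g -> T_x X, xi |-> (alpha(xi)(x_i))(x) for the coordinate functions x_i.\<close>
definition alpha_at :: "('n::finite \<Rightarrow> 'k::comm_ring_1) set \<Rightarrow>
    ('g \<Rightarrow> (('n \<Rightarrow> 'k) \<Rightarrow> 'k) \<Rightarrow> (('n \<Rightarrow> 'k) \<Rightarrow> 'k)) \<Rightarrow> ('n \<Rightarrow> 'k) \<Rightarrow> 'g \<Rightarrow> ('n \<Rightarrow> 'k)" where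
  "alpha_at X \<alpha> x \<xi> = (\<lambda>i. \<alpha> \<xi> (restr X (\<lambda>y. y i)) x)"

definition leaf_cond :: "('n::finite \<Rightarrow> 'k::comm_ring_1) set \<Rightarrow>
    ('g \<Rightarrow> (('n \<Rightarrow> 'k) \<Rightarrow> 'k) \<Rightarrow> (('n \<Rightarrow> 'k) \<Rightarrow> 'k)) \<Rightarrow> ('n \<Rightarrow> 'k) set \<Rightarrow> bool" where
  "leaf_cond X \<alpha> Z \<longleftrightarrow> Z \<subseteq> X \<and> locally_closed Z \<and> zconnected Z \<and>
     (\<forall>z\<in>Z. range (alpha_at X \<alpha> z) = tangent_space Z z)"

definition is_leaf :: "('n::finite \<Rightarrow> 'k::comm_ring_1) set \<Rightarrow>
    ('g \<Rightarrow> (('n \<Rightarrow> 'k) \<Rightarrow> 'k) \<Rightarrow> (('n \<Rightarrow> 'k) \<Rightarrow> 'k)) \<Rightarrow> ('n \<Rightarrow> 'k) set \<Rightarrow> bool" where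
  "is_leaf X \<alpha> Z \<longleftrightarrow> leaf_cond X \<alpha> Z \<and> (\<forall>Z'. leaf_cond X \<alpha> Z' \<and> Z \<subseteq> Z' \<longrightarrow> Z' = Z)"

definition fspan :: "(('n \<Rightarrow> 'k) \<Rightarrow> 'k::comm_ring_1) set \<Rightarrow> (('n \<Rightarrow> 'k) \<Rightarrow> 'k) set" where
  "fspan S = {(\<lambda>x. \<Sum>a\<in>T. r a * a x) | T r. finite T \<and> T \<subseteq> S}"

definition coinv_fin_dim :: "('n::finite \<Rightarrow> 'k::comm_ring_1) set \<Rightarrow>
    ('g \<Rightarrow> (('n \<Rightarrow> 'k) \<Rightarrow> 'k) \<Rightarrow> (('n \<Rightarrow> 'k) \<Rightarrow> 'k)) \<Rightarrow> bool" where
  "coinv_fin_dim X \<alpha> \<longleftrightarrow> (\<exists>B. finite B \<and> B \<subseteq> coord_ring X \<and>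
     coord_ring X \<subseteq> fspan (B \<union> {\<alpha> \<xi> h | \<xi> h. h \<in> coord_ring X}))"

end

theory Submission
  imports Defs "HOL-Library.FuncSet"
begin

text \<open>
The coinvariants are a quotient of \<open>k[x\<^sub>1,\<dots>,x\<^sub>n]\<close> whose dual is the space of functionals
annihilated by a right ideal \<open>J\<close> of the Weyl algebra: the one generated by the ideal of \<open>X\<close> and
the lifted vector fields. The symbols of \<open>J\<close> vanish on the conormals of the leaves, a set of
dimension \<open>n\<close>, so any \<open>n + 1\<close> of the \<open>2n\<close> coordinates \<open>x\<^sub>i, \<xi>\<^sub>i\<close> satisfy a relation that is the
principal symbol of an element of \<open>J\<close>. Dividing by these finitely many elements, for a weight in which
the \<open>\<xi>\<^sub>i\<close> are sufficiently heavy, shows that the operators of weight at most \<open>k\<close> span a space of dimension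
\<open>O(k\<^sup>n)\<close> modulo \<open>J\<close>. If the coinvariants were infinite-dimensional, there would be infinitely many
degrees \<open>d\<close> carrying a nonzero functional on forms of degree \<open>d\<close> that kills the leading forms of the
relations. On the family of these functionals the Weyl algebra and multiplication by \<open>d\<close> act; by the
previous bound this module grows like \<open>k\<^sup>n\<close>, whereas Bernstein's inequality for the Weyl algebra with one
additional central variable, on which no polynomial in that variable acts as zero, forbids this.
\<close>

text \<open>The leaves control symbols for the filtration by order, whose pieces are
  infinite-dimensional, while counting needs finite-dimensional ones. Corrections of lower order may
  be heavier in x, but only by a bounded amount, so one large extra weight \<open>N\<close> on every
  \<open>\<xi>\<^sub>i\<close> reconciles the two.

  A functional that sees only leading forms is not annihilated by \<open>J\<close>, but by the top
  parts of its elements for the grading with \<open>x\<^sub>i\<close> in degree 1 and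
  \<open>\<partial>\<^sub>i\<close> in degree -1. The bound survives this degeneration: a dependence
  of operators modulo \<open>J\<close> has a nonzero top part, hence gives a dependence of the
  functionals.

  Multiplication by \<open>d\<close> costs nothing: on a functional concentrated in degree
  \<open>d\<close> it is the Euler operator. The contradiction is then a count. The
  \<open>(k+1)^(2n+1)\<close> operators with exponents at most \<open>k\<close> in x, \<partial> and
  the central variable act independently from one piece of the filtration to another, but linear
  maps between those pieces form a space of dimension only \<open>O(k^(2n))\<close>. This takes the
  place of the theorem that direct images preserve holonomicity.\<close>

definition fscale :: "'k::field \<Rightarrow> ('a \<Rightarrow> 'k) \<Rightarrow> 'a \<Rightarrow> 'k" where
  "fscale c f = (\<lambda>x. c * f x)"

lemma fscale_apply [simp]: "fscale c f x = c * f x"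
  by (simp add: fscale_def)

interpretation fs: vector_space "fscale :: 'k::field \<Rightarrow> ('a \<Rightarrow> 'k) \<Rightarrow> 'a \<Rightarrow> 'k"
  by unfold_locales (auto simp: fun_eq_iff algebra_simps)

interpretation fp: vector_space_pair
  "fscale :: 'k::field \<Rightarrow> ('a \<Rightarrow> 'k) \<Rightarrow> 'a \<Rightarrow> 'k"
  "fscale :: 'k::field \<Rightarrow> ('b \<Rightarrow> 'k) \<Rightarrow> 'b \<Rightarrow> 'k"
  by unfold_locales

abbreviation flinear :: "(('a \<Rightarrow> 'k::field) \<Rightarrow> 'b \<Rightarrow> 'k) \<Rightarrow> bool" where
  "flinear \<equiv> Vector_Spaces.linear fscale fscale"

lemma sum_fun_apply: "(\<Sum>i\<in>A. f i) x = (\<Sum>i\<in>A. f i x)"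
  by (induction A rule: infinite_finite_induct) auto

lemma flinear_add: "flinear L \<Longrightarrow> L (f + g) = L f + L g"
  by (simp add: Vector_Spaces.linear_iff)

lemma flinear_scale: "flinear L \<Longrightarrow> L (fscale c f) = fscale c (L f)"
  by (simp add: Vector_Spaces.linear_iff)

lemma flinear_0: "flinear L \<Longrightarrow> L 0 = 0"
  using flinear_add[of L 0 0] by simp

lemma flinear_sum:
  assumes "flinear L"
  shows "L (\<Sum>i\<in>A. f i) = (\<Sum>i\<in>A. L (f i))"
proof (induction A rule: infinite_finite_induct)
  case (insert x F)
  show ?case unfolding sum.insert[OF insert.hyps] flinear_add[OF assms] insert.IH ..
qed (simp_all only: flinear_0[OF assms] sum.infinite sum.empty not_False_eq_True)

lemma flinear_span_image:
  assumes "flinear L" "\<And>f. f \<in> A \<Longrightarrow> L f \<in> fs.span B" "f \<in> fs.span A"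
  shows "L f \<in> fs.span B"
  using assms(3)
proof (induction rule: fs.span_induct_alt)
  case base
  show ?case using flinear_0[OF assms(1)] fs.span_zero by metis
next
  case (step c x y)
  then show ?case
    using flinear_add[OF assms(1)] flinear_scale[OF assms(1)] assms(2) fs.span_add fs.span_scale by metis
qed

text \<open>Stated for indexed families, where a repeated vector counts as a dependence: the
  counting arguments below need coefficients indexed by exponents, not by the vectors
  themselves.\<close>

lemma dependent_family:
  fixes g :: "'b \<Rightarrow> 'a \<Rightarrow> 'k::field"
  assumes "finite A" "finite B" "card B < card A" "\<And>a. a \<in> A \<Longrightarrow> g a \<in> fs.span B"
  shows "\<exists>c. (\<exists>a\<in>A. c a \<noteq> 0) \<and> (\<Sum>a\<in>A. fscale (c a) (g a)) = 0"
proof (cases "inj_on g A")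
  case True
  have "fs.dependent (g ` A)"
  proof (rule ccontr)
    assume "fs.independent (g ` A)"
    then have "card (g ` A) \<le> card B"
      using fs.independent_span_bound[of B "g ` A"] assms(2,4) by blast
    then show False using assms(3) card_image[OF True] by simp
  qed
  then obtain t u where t: "finite t" "t \<subseteq> g ` A" "(\<Sum>v\<in>t. fscale (u v) v) = 0" "\<exists>v\<in>t. u v \<noteq> 0"
    unfolding fs.dependent_explicit by blast
  define c where "c a = (if g a \<in> t then u (g a) else 0)" for a
  have "(\<Sum>a\<in>A. fscale (c a) (g a)) = (\<Sum>v\<in>g ` A. fscale (if v \<in> t then u v else 0) v)"
    by (simp add: sum.reindex[OF True] c_def)
  also have "\<dots> = (\<Sum>v\<in>t. fscale (u v) v)"
    using t(2) assms(1) by (intro sum.mono_neutral_cong_right) auto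
  finally have "(\<Sum>a\<in>A. fscale (c a) (g a)) = 0" using t(3) by simp
  moreover obtain a where "a \<in> A" "g a \<in> t" "u (g a) \<noteq> 0" using t by blast
  ultimately show ?thesis by (intro exI[of _ c]) (auto simp: c_def)
next
  case False
  then obtain a b where ab: "a \<in> A" "b \<in> A" "a \<noteq> b" "g a = g b"
    by (auto simp: inj_on_def)
  define c :: "'b \<Rightarrow> 'k" where "c = (\<lambda>x. if x = a then 1 else if x = b then -1 else 0)"
  have "(\<Sum>x\<in>A. fscale (c x) (g x)) = (\<Sum>x\<in>{a,b}. fscale (c x) (g x))"
    using ab assms(1) by (intro sum.mono_neutral_right) (auto simp: c_def)
  also have "\<dots> = 0" using ab by (auto simp: c_def fun_eq_iff)
  finally show ?thesis using ab by (intro exI[of _ c]) (auto simp: c_def)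
qed

subsection \<open>Monomials\<close>

definition wt :: "('i::finite \<Rightarrow> nat) \<Rightarrow> ('i \<Rightarrow> nat) \<Rightarrow> nat" where
  "wt w m = (\<Sum>i\<in>UNIV. w i * m i)"

definition up :: "'i \<Rightarrow> ('i \<Rightarrow> nat) \<Rightarrow> 'i \<Rightarrow> nat" where
  "up i m = m(i := Suc (m i))"

definition dn :: "'i \<Rightarrow> ('i \<Rightarrow> nat) \<Rightarrow> 'i \<Rightarrow> nat" where
  "dn i m = m(i := m i - 1)"

definition mon :: "('i::finite \<Rightarrow> nat) \<Rightarrow> ('i \<Rightarrow> 'k::field) \<Rightarrow> 'k" where
  "mon m u = (\<Prod>i\<in>UNIV. u i ^ m i)"

lemma up_dn: "0 < m i \<Longrightarrow> up i (dn i m) = m"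
  by (auto simp: up_def dn_def fun_eq_iff)

lemma dn_up [simp]: "dn i (up i m) = m"
  by (auto simp: up_def dn_def fun_eq_iff)

lemma wt_add: "wt w (m + p) = wt w m + wt w p"
  by (simp add: wt_def sum.distrib algebra_simps)

lemma wt_zero [simp]: "wt w 0 = 0"
  by (simp add: wt_def)

lemma wt_up: "wt w (up i m) = w i + wt w m"
proof -
  have "wt w (up i m) = w i * up i m i + (\<Sum>j\<in>UNIV - {i}. w j * up i m j)"
    unfolding wt_def by (rule sum.remove) auto
  moreover have "wt w m = w i * m i + (\<Sum>j\<in>UNIV - {i}. w j * m j)"
    unfolding wt_def by (rule sum.remove) auto
  moreover have "(\<Sum>j\<in>UNIV - {i}. w j * up i m j) = (\<Sum>j\<in>UNIV - {i}. w j * m j)"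
    by (rule sum.cong) (auto simp: up_def)
  ultimately show ?thesis by (simp add: up_def)
qed

lemma wt_dn_le: "wt w (dn i m) \<le> wt w m"
  unfolding wt_def by (intro sum_mono mult_left_mono) (auto simp: dn_def)

lemma le_wt: "1 \<le> w i \<Longrightarrow> m i \<le> wt w m"
proof -
  assume "1 \<le> w i"
  then have "m i \<le> w i * m i" by simp
  also have "\<dots> \<le> wt w m" unfolding wt_def
    by (rule member_le_sum) auto
  finally show ?thesis .
qed

lemma mon_add: "mon (m + p) = mon m * mon p"
  by (rule ext) (simp add: mon_def power_add prod.distrib)

lemma mon_zero: "mon 0 = 1"
  by (rule ext) (simp add: mon_def)

lemma mon_up: "mon (up i m) u = u i * mon m u"
proof -
  have "mon (up i m) u = u i ^ up i m i * (\<Prod>j\<in>UNIV - {i}. u j ^ up i m j)"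
    unfolding mon_def by (rule prod.remove) auto
  moreover have "mon m u = u i ^ m i * (\<Prod>j\<in>UNIV - {i}. u j ^ m j)"
    unfolding mon_def by (rule prod.remove) auto
  moreover have "(\<Prod>j\<in>UNIV - {i}. u j ^ up i m j) = (\<Prod>j\<in>UNIV - {i}. u j ^ m j)"
    by (rule prod.cong) (auto simp: up_def)
  ultimately show ?thesis by (simp add: up_def)
qed

text \<open>Weights are chosen one coordinate at a time. The new weight \<open>V\<close> exceeds
  every partial weight that occurs on \<open>F\<close>, so division by \<open>V\<close> with
  remainder recovers the new exponent and the old partial weight.\<close>

lemma separating_weight:
  fixes F :: "('i::finite \<Rightarrow> nat) set"
  assumes "finite F"
  shows "\<exists>w. (\<forall>i. 1 \<le> w i) \<and> inj_on (wt w) F"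
proof -
  have "\<exists>w::'i \<Rightarrow> nat. (\<forall>i. 1 \<le> w i) \<and> (\<forall>a\<in>F. \<forall>b\<in>F. (\<Sum>i\<in>W. w i * a i) = (\<Sum>i\<in>W. w i * b i) \<longrightarrow> (\<forall>i\<in>W. a i = b i))" for W
  proof (induction W rule: finite_induct[OF finite])
    case 1
    show ?case by (intro exI[of _ "\<lambda>_. 1"]) auto
  next
    case (2 j W)
    then obtain w where w: "\<forall>i. 1 \<le> w i" "\<forall>a\<in>F. \<forall>b\<in>F. (\<Sum>i\<in>W. w i * a i) = (\<Sum>i\<in>W. w i * b i) \<longrightarrow> (\<forall>i\<in>W. a i = b i)"
      by blast
    define V where "V = Suc (\<Sum>a\<in>F. \<Sum>i\<in>W. w i * a i)"
    have V: "(\<Sum>i\<in>W. w i * a i) < V" if "a \<in> F" for a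
      using member_le_sum[of a F "\<lambda>a. \<Sum>i\<in>W. w i * a i"] assms that by (auto simp: V_def less_Suc_eq_le)
    define w' where "w' = w(j := V)"
    have eq: "(\<Sum>i\<in>insert j W. w' i * a i) = (\<Sum>i\<in>W. w i * a i) + V * a j" for a
    proof -
      have "(\<Sum>i\<in>W. w' i * a i) = (\<Sum>i\<in>W. w i * a i)"
        by (rule sum.cong) (use 2 in \<open>auto simp: w'_def\<close>)
      then show ?thesis using 2 by (simp add: w'_def)
    qed
    show ?case
    proof (intro exI[of _ w'] conjI allI ballI impI)
      show "1 \<le> w' i" for i using w by (auto simp: w'_def V_def)
      fix a b i assume ab: "a \<in> F" "b \<in> F" and e: "(\<Sum>i\<in>insert j W. w' i * a i) = (\<Sum>i\<in>insert j W. w' i * b i)"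
        and i: "i \<in> insert j W"
      have e': "(\<Sum>i\<in>W. w i * a i) + V * a j = (\<Sum>i\<in>W. w i * b i) + V * b j"
        using e unfolding eq .
      have "a j = b j"
        using arg_cong[OF e', of "\<lambda>x. x div V"] V[OF ab(1)] V[OF ab(2)] by simp
      moreover from this have "(\<Sum>i\<in>W. w i * a i) = (\<Sum>i\<in>W. w i * b i)" using e' by simp
      ultimately show "a i = b i" using w(2) ab i by auto
    qed
  qed
  from this[of UNIV] obtain w :: "'i \<Rightarrow> nat" where w: "\<forall>i. 1 \<le> w i"
    "\<forall>a\<in>F. \<forall>b\<in>F. wt w a = wt w b \<longrightarrow> (\<forall>i. a i = b i)"
    unfolding wt_def by auto
  then show ?thesis by (intro exI[of _ w]) (auto simp: inj_on_def fun_eq_iff)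
qed

text \<open>Kronecker substitution: putting T^(w i) for the i-th variable, with a separating weight,
  turns distinct monomials into distinct powers of T.\<close>

lemma mon_coeffs_zero:
  fixes c :: "('i::finite \<Rightarrow> nat) \<Rightarrow> 'k::field_char_0"
  assumes "finite M" "(\<Sum>m\<in>M. fscale (c m) (mon m)) = 0" "m \<in> M"
  shows "c m = 0"
proof -
  obtain w where w: "inj_on (wt w) M" using separating_weight[OF assms(1)] by blast
  define p where "p = (\<Sum>m\<in>M. monom (c m) (wt w m))"
  have "poly p T = 0" for T
  proof -
    have "poly p T = (\<Sum>m\<in>M. c m * mon m (\<lambda>i. T ^ w i))"
      by (simp add: p_def poly_sum poly_monom mon_def wt_def power_sum power_mult)
    also have "\<dots> = (\<Sum>m\<in>M. fscale (c m) (mon m)) (\<lambda>i. T ^ w i)"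
      by (simp add: sum_fun_apply)
    finally show ?thesis by (simp add: assms)
  qed
  then have "p = 0" using poly_all_0_iff_0 by blast
  then have "0 = coeff p (wt w m)" by simp
  also have "\<dots> = (\<Sum>m'\<in>M. if m' = m then c m' else 0)"
    unfolding p_def coeff_sum using w assms(3) by (intro sum.cong) (auto simp: inj_on_def)
  also have "\<dots> = c m" using assms by simp
  finally show ?thesis by simp
qed

lemma inj_mon: "inj (mon :: ('i::finite \<Rightarrow> nat) \<Rightarrow> ('i \<Rightarrow> 'k::field_char_0) \<Rightarrow> 'k)"
proof (rule injI, rule ccontr)
  fix a b :: "'i \<Rightarrow> nat" assume e: "(mon a :: ('i \<Rightarrow> 'k) \<Rightarrow> 'k) = mon b" and ne: "a \<noteq> b"
  define c :: "('i \<Rightarrow> nat) \<Rightarrow> 'k" where "c m = (if m = a then 1 else -1)" for m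
  have "(\<Sum>m\<in>{a,b}. fscale (c m) (mon m)) = 0"
    using ne e by (auto simp: c_def fun_eq_iff[of "_ + _"])
  from mon_coeffs_zero[OF _ this, of a] show False by (simp add: c_def)
qed

lemma independent_mon: "fs.independent (range (mon :: ('i::finite \<Rightarrow> nat) \<Rightarrow> ('i \<Rightarrow> 'k::field_char_0) \<Rightarrow> 'k))"
proof
  assume "fs.dependent (range (mon :: ('i \<Rightarrow> nat) \<Rightarrow> ('i \<Rightarrow> 'k) \<Rightarrow> 'k))"
  then obtain t u where t: "finite t" "t \<subseteq> range (mon :: ('i \<Rightarrow> nat) \<Rightarrow> ('i \<Rightarrow> 'k) \<Rightarrow> 'k)"
    "(\<Sum>v\<in>t. fscale (u v) v) = 0" "\<exists>v\<in>t. u v \<noteq> 0"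
    unfolding fs.dependent_explicit by blast
  then obtain M where M: "finite M" "t = mon ` M" by (meson finite_subset_image)
  have "(\<Sum>v\<in>t. fscale (u v) v) = (\<Sum>m\<in>M. fscale (u (mon m)) (mon m))"
    unfolding M(2) by (subst sum.reindex) (auto intro: inj_on_subset[OF inj_mon])
  with mon_coeffs_zero[of M "\<lambda>m. u (mon m)"] t M show False by auto
qed

text \<open>Linear extension from the basis of monomials. Its domain is the space of all functions;
  only the values on polynomials matter.\<close>

definition monlin :: "(('i::finite \<Rightarrow> nat) \<Rightarrow> 'b \<Rightarrow> 'k::field_char_0) \<Rightarrow> (('i \<Rightarrow> 'k) \<Rightarrow> 'k) \<Rightarrow> 'b \<Rightarrow> 'k" where
  "monlin g = fp.construct (range mon) (\<lambda>v. g (inv mon v))"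

lemma flinear_monlin: "flinear (monlin g)"
  unfolding monlin_def by (rule fp.linear_construct[OF independent_mon])

lemma monlin_mon [simp]: "monlin g (mon m) = g m"
  unfolding monlin_def by (subst fp.construct_basis[OF independent_mon]) (auto simp: inv_f_f[OF inj_mon])

text \<open>As simp rules, these would expand \<open>f + g\<close> wherever unification has left it in
  \<open>\<eta>\<close>-long form, so that lemmas about \<open>f + g\<close> no longer match.\<close>

lemmas fun_apply = plus_fun_apply times_fun_apply zero_fun_apply one_fun_apply of_nat_fun_apply
  minus_apply uminus_apply fscale_apply

declare fun_apply [simp del]

subsection \<open>Directional derivatives of polynomial functions\<close>

inductive_set pfun_on :: "'i set \<Rightarrow> (('i::finite \<Rightarrow> 'k::comm_ring_1) \<Rightarrow> 'k) set" for W where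
  pfo_const: "(\<lambda>x. c) \<in> pfun_on W"
| pfo_coord: "i \<in> W \<Longrightarrow> (\<lambda>x. x i) \<in> pfun_on W"
| pfo_add: "f \<in> pfun_on W \<Longrightarrow> g \<in> pfun_on W \<Longrightarrow> f + g \<in> pfun_on W"
| pfo_mult: "f \<in> pfun_on W \<Longrightarrow> g \<in> pfun_on W \<Longrightarrow> f * g \<in> pfun_on W"

lemma pfun_on_UNIV: "pfun_on UNIV = poly_fun"
proof (intro equalityI subsetI)
  fix f :: "('i::finite \<Rightarrow> 'k::comm_ring_1) \<Rightarrow> 'k"
  show "f \<in> poly_fun" if "f \<in> pfun_on UNIV"
    using that by induction (auto simp: plus_fun_def times_fun_def intro: poly_fun.intros)
  show "f \<in> pfun_on UNIV" if "f \<in> poly_fun"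
    using that
  proof induction
    case (pf_add f g)
    then show ?case using pfo_add[of f UNIV g] by (simp only: plus_fun_def)
  next
    case (pf_mult f g)
    then show ?case using pfo_mult[of f UNIV g] by (simp only: times_fun_def)
  qed (auto intro: pfun_on.intros)
qed

lemma pfun_on_mono: "(W :: 'i::finite set) \<subseteq> W' \<Longrightarrow> pfun_on W \<subseteq> pfun_on W'"
proof
  fix f :: "('i::finite \<Rightarrow> 'k::comm_ring_1) \<Rightarrow> 'k"
  assume "W \<subseteq> W'" "f \<in> pfun_on W"
  from this(2,1) show "f \<in> pfun_on W'"
    by induction (auto intro: pfun_on.intros)
qed

lemma pfun_on_poly_fun: "f \<in> pfun_on W \<Longrightarrow> f \<in> poly_fun"
  using pfun_on_mono[of W UNIV] pfun_on_UNIV by blast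

lemma pfo_0: "0 \<in> pfun_on W" and pfo_1: "1 \<in> pfun_on W"
  using pfo_const[of 0] pfo_const[of 1] by (simp_all add: zero_fun_def one_fun_def)

lemma pfo_of_nat: "of_nat n \<in> pfun_on W"
  unfolding of_nat_fun by (rule pfo_const)

lemma pfo_uminus: "f \<in> pfun_on W \<Longrightarrow> - f \<in> pfun_on W"
  using pfo_mult[OF pfo_const[of "-1" W], of f] by (simp add: times_fun_def fun_Compl_def)

lemma pfo_diff: "f \<in> pfun_on W \<Longrightarrow> g \<in> pfun_on W \<Longrightarrow> f - g \<in> pfun_on W"
  using pfo_add[OF _ pfo_uminus, of f W g] by simp

lemma pfo_sum: "(\<And>i. i \<in> A \<Longrightarrow> f i \<in> pfun_on W) \<Longrightarrow> sum f A \<in> pfun_on W"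
  by (induction A rule: infinite_finite_induct) (auto intro: pfo_0 pfo_add)

lemma pfo_power: "f \<in> pfun_on W \<Longrightarrow> f ^ n \<in> pfun_on W"
  by (induction n) (auto intro: pfo_1 pfo_mult)

lemmas poly_fun_intros = pfo_0[of UNIV, unfolded pfun_on_UNIV] pfo_1[of UNIV, unfolded pfun_on_UNIV]
  pfo_add[of _ UNIV, unfolded pfun_on_UNIV] pfo_mult[of _ UNIV, unfolded pfun_on_UNIV]
  pfo_uminus[of _ UNIV, unfolded pfun_on_UNIV] pfo_diff[of _ UNIV, unfolded pfun_on_UNIV]
  pfo_sum[of _ _ UNIV, unfolded pfun_on_UNIV] pfo_power[of _ UNIV, unfolded pfun_on_UNIV]
  pfo_of_nat[of _ UNIV, unfolded pfun_on_UNIV]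

lemma pfun_on_cong:
  assumes "f \<in> pfun_on W" "\<And>i. i \<in> W \<Longrightarrow> u i = u' i"
  shows "f u = f u'"
  using assms by induction (auto simp: fun_apply)

lemma dderiv_cong:
  assumes "f \<in> pfun_on W" "\<And>i. i \<in> W \<Longrightarrow> u i = u' i" "\<And>i. i \<in> W \<Longrightarrow> v i = v' i"
  shows "dderiv f u v = dderiv f u' v'"
proof -
  have "f (\<lambda>i. u i + t * v i) = f (\<lambda>i. u' i + t * v' i)" for t
    by (rule pfun_on_cong[OF assms(1)]) (simp add: assms)
  then show ?thesis by (simp add: dderiv_def)
qed

lemma line_poly:
  assumes "f \<in> poly_fun"
  shows "\<exists>p. \<forall>t. poly p t = f (\<lambda>i. z i + t * v i)"
  using assms
proof induction
  case (pf_const c)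
  show ?case by (intro exI[of _ "[:c:]"]) simp
next
  case (pf_coord i)
  show ?case by (intro exI[of _ "[:z i, v i:]"]) simp
next
  case (pf_add f g)
  then obtain p q where "\<forall>t. poly p t = f (\<lambda>i. z i + t * v i)" "\<forall>t. poly q t = g (\<lambda>i. z i + t * v i)" by blast
  then show ?case by (intro exI[of _ "p + q"]) simp
next
  case (pf_mult f g)
  then obtain p q where "\<forall>t. poly p t = f (\<lambda>i. z i + t * v i)" "\<forall>t. poly q t = g (\<lambda>i. z i + t * v i)" by blast
  then show ?case by (intro exI[of _ "p * q"]) simp
qed

text \<open>The definite description in \<open>dderiv\<close> is unique because a polynomial over an
  infinite field is determined by its values.\<close>

lemma dderiv_eq:
  fixes p :: "'k::field_char_0 poly"
  assumes "\<And>t. poly p t = f (\<lambda>i. z i + t * v i)"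
  shows "dderiv f z v = coeff p 1"
  unfolding dderiv_def
proof (rule the_equality)
  show "\<exists>p'. (\<forall>t. poly p' t = f (\<lambda>i. z i + t * v i)) \<and> coeff p' 1 = coeff p 1"
    using assms by blast
next
  fix c assume "\<exists>p'. (\<forall>t. poly p' t = f (\<lambda>i. z i + t * v i)) \<and> coeff p' 1 = c"
  then obtain p' where p': "\<forall>t. poly p' t = f (\<lambda>i. z i + t * v i)" "coeff p' 1 = c" by blast
  then have "poly p' = poly p" using assms by auto
  then have "p' = p" by (simp only: poly_eq_poly_eq_iff)
  then show "c = coeff p 1" using p'(2) by simp
qed

lemma dderiv_const [simp]: "dderiv (\<lambda>x. c) z v = (0::'k::field_char_0)"
  using dderiv_eq[of "[:c:]" "\<lambda>x. c"] by simp

lemma dderiv_0 [simp]: "dderiv 0 z v = (0::'k::field_char_0)"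
  by (simp add: zero_fun_def)

lemma dderiv_coord [simp]: "dderiv (\<lambda>x. x i) z v = (v i ::'k::field_char_0)"
  using dderiv_eq[of "[:z i, v i:]" "\<lambda>x. x i" z v] by simp

context
  fixes f g :: "('i::finite \<Rightarrow> 'k::field_char_0) \<Rightarrow> 'k"
  assumes f: "f \<in> poly_fun" and g: "g \<in> poly_fun"
begin

lemma dderiv_add: "dderiv (f + g) z v = dderiv f z v + dderiv g z v"
proof -
  obtain p where p: "\<And>t. poly p t = f (\<lambda>i. z i + t * v i)" using line_poly[OF f] by metis
  obtain q where q: "\<And>t. poly q t = g (\<lambda>i. z i + t * v i)" using line_poly[OF g] by metis
  have "dderiv (f + g) z v = coeff (p + q) 1" by (rule dderiv_eq) (simp add: p q fun_apply)
  then show ?thesis using dderiv_eq[OF p] dderiv_eq[OF q] by (simp add: mult.commute)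
qed

lemma dderiv_mult: "dderiv (f * g) z v = f z * dderiv g z v + g z * dderiv f z v"
proof -
  obtain p where p: "\<And>t. poly p t = f (\<lambda>i. z i + t * v i)" using line_poly[OF f] by metis
  obtain q where q: "\<And>t. poly q t = g (\<lambda>i. z i + t * v i)" using line_poly[OF g] by metis
  have "dderiv (f * g) z v = coeff (p * q) 1" by (rule dderiv_eq) (simp add: p q fun_apply)
  also have "\<dots> = coeff p 0 * coeff q 1 + coeff p 1 * coeff q 0" by (simp add: coeff_mult)
  also have "coeff p 0 = f z" using p[of 0] by (simp add: poly_0_coeff_0)
  also have "coeff q 0 = g z" using q[of 0] by (simp add: poly_0_coeff_0)
  finally show ?thesis using dderiv_eq[OF p] dderiv_eq[OF q] by simp
qed

end

lemma dderiv_linear: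
  fixes f :: "('i::finite \<Rightarrow> 'k::field_char_0) \<Rightarrow> 'k"
  assumes "f \<in> poly_fun"
  shows "dderiv f z (\<lambda>i. a * v i + b * w i) = a * dderiv f z v + b * dderiv f z w"
proof -
  have "f \<in> pfun_on UNIV" using assms pfun_on_UNIV by auto
  then show ?thesis
  proof induction
    case (pfo_add f g)
    then show ?case by (simp add: dderiv_add pfun_on_UNIV algebra_simps)
  next
    case (pfo_mult f g)
    then show ?case by (simp add: dderiv_mult pfun_on_UNIV algebra_simps)
  qed auto
qed

subsection \<open>Generic points of prime ideals\<close>

text \<open>Models k[W][x_j] for a variable j outside W: \<open>val j\<close> substitutes x_j, and
  \<open>ev u\<close> specialises the coefficients at a point. The coefficients live in a ring of
  functions with zero divisors, so division is done up to powers of leading coefficients.\<close>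

definition CP :: "'i set \<Rightarrow> (('i::finite \<Rightarrow> 'k::comm_ring_1) \<Rightarrow> 'k) poly set" where
  "CP W = {p. \<forall>n. coeff p n \<in> pfun_on W}"

definition val :: "'i \<Rightarrow> (('i \<Rightarrow> 'k::comm_ring_1) \<Rightarrow> 'k) poly \<Rightarrow> ('i \<Rightarrow> 'k) \<Rightarrow> 'k" where
  "val j p = poly p (\<lambda>u. u j)"

definition ev :: "('i \<Rightarrow> 'k::comm_ring_1) \<Rightarrow> (('i \<Rightarrow> 'k) \<Rightarrow> 'k) poly \<Rightarrow> 'k poly" where
  "ev u p = map_poly (\<lambda>c. c u) p"

lemma val_simps [simp]: "val j 0 = 0" "val j (p + q) = val j p + val j q"
  "val j (p * q) = val j p * val j q" "val j (smult c p) = c * val j p" "val j (p - q) = val j p - val j q"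
  "val j [:c:] = c"
  by (auto simp: val_def)

lemma coeff_ev [simp]: "coeff (ev u p) n = coeff p n u"
  by (simp add: ev_def coeff_map_poly fun_apply)

lemma val_apply: "val j p u = poly (ev u p) (u j)"
  by (induction p) (auto simp: val_def ev_def map_poly_pCons fun_apply)

lemma CP_pCons: "pCons a p \<in> CP W \<longleftrightarrow> a \<in> pfun_on W \<and> p \<in> CP W"
  unfolding CP_def mem_Collect_eq coeff_pCons
  by (auto split: nat.splits)

lemma CP_0 [simp]: "0 \<in> CP W" by (simp add: CP_def pfo_0)

lemma CP_add: "p \<in> CP W \<Longrightarrow> q \<in> CP W \<Longrightarrow> p + q \<in> CP W"
  by (simp add: CP_def pfo_add)

lemma CP_diff: "p \<in> CP W \<Longrightarrow> q \<in> CP W \<Longrightarrow> p - q \<in> CP W"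
  by (simp add: CP_def pfo_diff)

lemma CP_smult: "c \<in> pfun_on W \<Longrightarrow> p \<in> CP W \<Longrightarrow> smult c p \<in> CP W"
  by (simp add: CP_def pfo_mult)

lemma CP_mult: "p \<in> CP W \<Longrightarrow> q \<in> CP W \<Longrightarrow> p * q \<in> CP W"
  by (simp add: CP_def coeff_mult pfo_mult pfo_sum)

lemma CP_monom: "c \<in> pfun_on W \<Longrightarrow> monom c n \<in> CP W"
  by (simp add: CP_def pfo_0)

definition fder :: "'a::comm_ring_1 poly \<Rightarrow> 'a poly" where
  "fder p = (\<Sum>n<degree p. monom (of_nat (Suc n) * coeff p (Suc n)) n)"

lemma coeff_fder: "coeff (fder p) n = of_nat (Suc n) * coeff p (Suc n)"
proof -
  have "coeff (fder p) n = (\<Sum>m<degree p. if m = n then of_nat (Suc m) * coeff p (Suc m) else 0)"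
    unfolding fder_def coeff_sum by (intro sum.cong) auto
  also have "\<dots> = of_nat (Suc n) * coeff p (Suc n)"
    using coeff_eq_0[of p "Suc n"] by (auto simp: not_less)
  finally show ?thesis .
qed

lemma degree_fder_less: "0 < degree p \<Longrightarrow> degree (fder p) < degree p"
  using degree_le[of "degree p - 1" "fder p"] by (auto simp: coeff_fder coeff_eq_0)

lemma fder_pCons: "fder (pCons a p) = p + pCons 0 (fder p)"
  by (rule poly_eqI) (auto simp: coeff_fder coeff_pCons algebra_simps split: nat.splits)

lemma CP_fder: "p \<in> CP W \<Longrightarrow> fder p \<in> CP W"
  unfolding CP_def mem_Collect_eq coeff_fder by (blast intro: pfo_mult pfo_of_nat)

lemma CP_coeff: "p \<in> CP W \<Longrightarrow> coeff p n \<in> pfun_on W"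
  by (simp add: CP_def)

lemma val_CP: "p \<in> CP W \<Longrightarrow> val j p \<in> pfun_on (insert j W)"
proof (induction p)
  case (pCons a p)
  then show ?case using pfun_on_mono[of W "insert j W"]
    by (auto simp: val_def CP_pCons intro!: pfo_add pfo_mult pfo_coord)
qed (simp add: pfo_0)

lemma CP_exists:
  assumes "f \<in> pfun_on (insert j W)"
  shows "\<exists>p\<in>CP W. f = val j p"
  using assms
proof induction
  case (pfo_const c)
  show ?case by (intro bexI[of _ "[:\<lambda>x. c:]"]) (auto simp: CP_pCons intro: pfun_on.intros)
next
  case (pfo_coord i)
  show ?case
  proof (cases "i = j")
    case True
    then show ?thesis by (intro bexI[of _ "[:0,1:]"]) (auto simp: CP_pCons val_def intro: pfo_0 pfo_1)
  next
    case False
    then show ?thesis using pfo_coord by (intro bexI[of _ "[:\<lambda>x. x i:]"]) (auto simp: CP_pCons intro: pfun_on.intros)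
  qed
next
  case (pfo_add f g)
  then obtain p q where "p \<in> CP W" "f = val j p" "q \<in> CP W" "g = val j q" by blast
  then show ?case by (intro bexI[of _ "p + q"]) (auto intro: CP_add)
next
  case (pfo_mult f g)
  then obtain p q where "p \<in> CP W" "f = val j p" "q \<in> CP W" "g = val j q" by blast
  then show ?case by (intro bexI[of _ "p * q"]) (auto intro: CP_mult)
qed

text \<open>Every cancellation step multiplies by the leading coefficient of \<open>g\<close>
  instead of dividing by it. The bound on \<open>degree q\<close> is what later forces a cofactor of
  \<open>P\<close> to have smaller degree than \<open>P\<close>.\<close>

lemma CP_pseudo_division:
  assumes "g \<in> CP W" "f \<in> CP W"
  shows "\<exists>e q r. q \<in> CP W \<and> r \<in> CP W \<and> smult (lead_coeff g ^ e) f = g * q + r \<and>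
     (r = 0 \<or> degree r < degree g) \<and> degree q \<le> degree f - degree g"
  using assms(2)
proof (induction "degree f" arbitrary: f rule: less_induct)
  case less
  let ?l = "lead_coeff g"
  show ?case
  proof (cases "f = 0 \<or> degree f < degree g")
    case True
    then show ?thesis using less.prems by (intro exI[of _ 0] exI[of _ f]) auto
  next
    case False
    define m where "m = monom (lead_coeff f) (degree f - degree g)"
    define f1 where "f1 = smult ?l f - m * g"
    have m: "m \<in> CP W" unfolding m_def by (intro CP_monom CP_coeff less.prems)
    have f1: "f1 \<in> CP W" unfolding f1_def
      by (intro CP_diff CP_mult CP_smult CP_coeff m assms less.prems)
    have dm: "degree m \<le> degree f - degree g" unfolding m_def by (rule degree_monom_le)
    have "degree (m * g) \<le> degree f"
      using degree_mult_le[of m g] dm False by linarith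
    then have deg: "degree f1 \<le> degree f" unfolding f1_def
      by (intro degree_diff_le degree_smult_le) auto
    have "coeff (m * g) (degree f) = lead_coeff f * ?l"
      using False by (simp add: m_def coeff_monom_mult)
    then have c0: "coeff f1 (degree f) = 0" by (simp add: f1_def mult.commute)
    show ?thesis
    proof (cases "f1 = 0")
      case True
      then have "smult (?l ^ 1) f = g * m + 0" by (simp add: f1_def mult.commute)
      then show ?thesis using m dm CP_0 by blast
    next
      case f10: False
      then have lt: "degree f1 < degree f"
        using c0 deg leading_coeff_neq_0 le_neq_implies_less by metis
      from less.hyps[OF lt f1] obtain e q r where h: "q \<in> CP W" "r \<in> CP W"
        "smult (?l ^ e) f1 = g * q + r" "r = 0 \<or> degree r < degree g" "degree q \<le> degree f1 - degree g" by blast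
      have "smult (?l ^ Suc e) f = smult (?l ^ e) f1 + smult (?l ^ e) (m * g)"
        by (simp add: f1_def smult_diff_right mult.commute)
      also have "\<dots> = g * (q + smult (?l ^ e) m) + r"
        unfolding h(3) by (simp add: algebra_simps)
      finally have "smult (?l ^ Suc e) f = g * (q + smult (?l ^ e) m) + r" .
      moreover have "q + smult (?l ^ e) m \<in> CP W"
        by (intro CP_add CP_smult pfo_power CP_coeff h m assms)
      moreover have "degree (q + smult (?l ^ e) m) \<le> degree f - degree g"
        using h(5) dm lt by (intro degree_add_le) (auto intro: order_trans[OF degree_smult_le])
      ultimately show ?thesis using h by blast
    qed
  qed
qed

lemma ev_cong: "p \<in> CP W \<Longrightarrow> (\<And>i. i \<in> W \<Longrightarrow> u i = u' i) \<Longrightarrow> ev u p = ev u' p"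
  by (rule poly_eqI) (auto intro: pfun_on_cong CP_coeff)

lemma dderiv_val_pCons:
  fixes p :: "(('i::finite \<Rightarrow> 'k::field_char_0) \<Rightarrow> 'k) poly"
  assumes "pCons a p \<in> CP W"
  shows "dderiv (val j (pCons a p)) z v = dderiv a z v + (z j * dderiv (val j p) z v + val j p z * v j)"
proof -
  have mem: "a \<in> poly_fun" "val j p \<in> poly_fun" "(\<lambda>u. u j) \<in> (poly_fun :: (('i \<Rightarrow> 'k) \<Rightarrow> 'k) set)"
    using assms by (auto simp: CP_pCons intro: pfun_on_poly_fun val_CP pf_coord)
  have e: "val j (pCons a p) = a + (\<lambda>u. u j) * val j p" by (simp add: val_def)
  show ?thesis unfolding e dderiv_add[OF mem(1) poly_fun_intros(4)[OF mem(3,2)]] dderiv_mult[OF mem(3,2)] by simp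
qed

lemma val_vanish:
  fixes p :: "(('i::finite \<Rightarrow> 'k::field_char_0) \<Rightarrow> 'k) poly"
  assumes "p \<in> CP W" "\<And>n. coeff p n z = 0" "\<And>n. dderiv (coeff p n) z v = 0"
  shows "val j p z = 0 \<and> dderiv (val j p) z v = 0"
  using assms
proof (induction p)
  case (pCons a p)
  have pz: "coeff p n z = 0" "dderiv (coeff p n) z v = 0" for n
    using pCons.prems(2)[of "Suc n"] pCons.prems(3)[of "Suc n"] by simp_all
  have a: "a z = 0" "dderiv a z v = 0"
    using pCons.prems(2)[of 0] pCons.prems(3)[of 0] by simp_all
  have "p \<in> CP W" using pCons.prems(1) by (simp add: CP_pCons)
  then have IH: "val j p z = 0 \<and> dderiv (val j p) z v = 0" using pCons.IH pz by blast
  have "val j (pCons a p) z = a z + z j * val j p z" by (simp add: val_def fun_apply)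
  then show ?case using IH a by (simp add: dderiv_val_pCons[OF pCons.prems(1)])
qed (simp add: fun_apply)

lemma dderiv_val_unit:
  fixes p :: "(('i::finite \<Rightarrow> 'k::field_char_0) \<Rightarrow> 'k) poly"
  assumes "p \<in> CP W" "j \<notin> W"
  shows "dderiv (val j p) z (\<lambda>i. if i = j then 1 else 0) = val j (fder p) z"
  using assms(1)
proof (induction p)
  case (pCons a p)
  let ?e = "\<lambda>i. if i = j then 1 else 0 :: 'k"
  have mem: "a \<in> poly_fun" "val j p \<in> poly_fun" "p \<in> CP W" "(\<lambda>u. u j) \<in> (poly_fun :: (('i \<Rightarrow> 'k) \<Rightarrow> 'k) set)" "a \<in> pfun_on W"
    using pCons.prems(1) by (auto simp: CP_pCons intro: pfun_on_poly_fun val_CP pf_coord)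
  have "dderiv a z ?e = dderiv a z (\<lambda>i. 0 * z i + 0 * z i)"
    by (rule dderiv_cong[OF mem(5)]) (use assms in auto)
  also have "\<dots> = 0" by (subst dderiv_linear[OF mem(1)]) simp
  finally have a: "dderiv a z ?e = 0" .
  have e: "val j (fder (pCons a p)) z = val j p z + z j * val j (fder p) z"
    by (simp add: val_def fder_pCons fun_apply)
  show ?case unfolding e dderiv_val_pCons[OF pCons.prems] a pCons.IH[OF mem(3)] by simp
qed (simp add: fun_apply fder_def)

locale prime_pideal =
  fixes Q :: "(('i::finite \<Rightarrow> 'k::{alg_closed_field, field_char_0}) \<Rightarrow> 'k) set"
  assumes sub: "Q \<subseteq> poly_fun"
    and zero: "0 \<in> Q"
    and add: "f \<in> Q \<Longrightarrow> g \<in> Q \<Longrightarrow> f + g \<in> Q"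
    and mult: "f \<in> Q \<Longrightarrow> g \<in> poly_fun \<Longrightarrow> g * f \<in> Q"
    and one: "1 \<notin> Q"
    and prime: "f \<in> poly_fun \<Longrightarrow> g \<in> poly_fun \<Longrightarrow> f * g \<in> Q \<Longrightarrow> f \<in> Q \<or> g \<in> Q"
begin

lemma uminus: "f \<in> Q \<Longrightarrow> - f \<in> Q"
  using mult[of f "-1"] by (auto intro: poly_fun_intros)

lemma diff: "f \<in> Q \<Longrightarrow> g \<in> Q \<Longrightarrow> f - g \<in> Q"
  using add[of f "-g"] uminus by simp

lemma sum: "(\<And>i. i \<in> A \<Longrightarrow> f i \<in> Q) \<Longrightarrow> sum f A \<in> Q"
  by (induction A rule: infinite_finite_induct) (auto intro: zero add)

lemma power: "f \<in> poly_fun \<Longrightarrow> f ^ n \<in> Q \<Longrightarrow> f \<in> Q"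
proof (induction n)
  case (Suc n)
  then show ?case using prime[of f "f ^ n"] poly_fun_intros(8)[of f n] by auto
qed (use one in simp)

lemma prod: "finite A \<Longrightarrow> (\<And>i. i \<in> A \<Longrightarrow> f i \<in> poly_fun) \<Longrightarrow> prod f A \<in> Q \<Longrightarrow> \<exists>i\<in>A. f i \<in> Q"
proof (induction A rule: finite_induct)
  case (insert x A)
  have "prod f A \<in> poly_fun" using insert.hyps(1) insert.prems(1)
    by (induction A rule: finite_induct) (auto intro: poly_fun_intros)
  then show ?case using insert prime[of "f x" "prod f A"] by auto
qed (use one in simp)

text \<open>Means that \<open>p\<close> is zero in (k[W]/Q)[x_j], whereas
  \<open>val j p \<in> Q\<close> means only that the class of x_j is a root of
  \<open>p\<close>.\<close>

definition allQ where "allQ p \<longleftrightarrow> (\<forall>n. coeff p n \<in> Q)"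

lemma allQ_val:
  assumes "p \<in> CP W" "allQ p"
  shows "val j p \<in> Q"
proof -
  have "val j p = (\<Sum>n\<le>degree p. coeff p n * (\<lambda>u. u j) ^ n)"
    by (simp add: val_def poly_altdef)
  also have "\<dots> = (\<Sum>n\<le>degree p. (\<lambda>u. u j) ^ n * coeff p n)"
    by (simp add: mult.commute)
  also have "\<dots> \<in> Q" using assms(2) unfolding allQ_def
    by (intro sum mult poly_fun_intros pf_coord) auto
  finally show ?thesis .
qed

lemma drop_lead:
  assumes "p \<in> CP W" "lead_coeff p \<in> Q" "0 < degree p"
  shows "\<exists>p'\<in>CP W. degree p' < degree p \<and> val j p - val j p' \<in> Q \<and> (allQ p' \<longrightarrow> allQ p)"
proof -
  define m where "m = monom (lead_coeff p) (degree p)"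
  define p' where "p' = p - m"
  have m: "m \<in> CP W" unfolding m_def by (intro CP_monom CP_coeff assms)
  have am: "allQ m" unfolding m_def allQ_def using assms zero by simp
  have "degree p' \<le> degree p" unfolding p'_def m_def
    by (intro degree_diff_le degree_monom_le) auto
  moreover have "coeff p' (degree p) = 0" by (simp add: p'_def m_def)
  ultimately have "degree p' < degree p"
    using assms(3) by (metis degree_0 leading_coeff_neq_0 le_neq_implies_less)
  moreover have "p' \<in> CP W" unfolding p'_def by (intro CP_diff m assms)
  moreover have "val j p - val j p' \<in> Q" using allQ_val[OF m am] by (simp add: p'_def)
  moreover have "allQ p" if "allQ p'"
    unfolding allQ_def
  proof
    fix n
    have "coeff p n = coeff p' n + coeff m n" by (simp add: p'_def)
    then show "coeff p n \<in> Q" using that am add by (simp add: allQ_def)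
  qed
  ultimately show ?thesis by blast
qed

lemma not_mult: "f \<in> poly_fun \<Longrightarrow> g \<in> poly_fun \<Longrightarrow> f \<notin> Q \<Longrightarrow> g \<notin> Q \<Longrightarrow> f * g \<notin> Q"
  using prime by blast

lemma diff_cancel: "f - g \<in> Q \<Longrightarrow> g \<in> Q \<Longrightarrow> f \<in> Q"
  using add[of "f - g" g] by simp

lemma CP_poly_fun: "p \<in> CP W \<Longrightarrow> coeff p n \<in> poly_fun" "p \<in> CP W \<Longrightarrow> val j p \<in> poly_fun"
  by (auto intro: pfun_on_poly_fun CP_coeff val_CP)

text \<open>The hypotheses on \<open>p0\<close> say that x_j is algebraic over the fraction field of
  k[W] modulo Q; \<open>P\<close> plays the role of its minimal polynomial, with denominators
  cleared.\<close>

lemma minimal_poly: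
  assumes "p0 \<in> CP W" "val j p0 \<in> Q" "\<not> allQ p0"
  obtains P where "P \<in> CP W" "val j P \<in> Q" "lead_coeff P \<notin> Q" "0 < degree P"
    "\<And>r. r \<in> CP W \<Longrightarrow> val j r \<in> Q \<Longrightarrow> degree r < degree P \<Longrightarrow> allQ r"
proof -
  define A where "A p \<longleftrightarrow> p \<in> CP W \<and> val j p \<in> Q \<and> \<not> allQ p" for p
  have "A p0" using assms by (simp add: A_def)
  from ex_has_least_nat[of A, OF this, of degree]
  obtain P where P: "A P" "\<And>p. A p \<Longrightarrow> degree P \<le> degree p" by blast
  have deg: "0 < degree P"
  proof (rule ccontr)
    assume "\<not> 0 < degree P"
    then obtain a where "P = [:a:]" by (metis degree_eq_zeroE gr0I)
    then show False using P(1) zero by (auto simp: A_def allQ_def coeff_pCons gr0_conv_Suc split: nat.splits)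
  qed
  have "lead_coeff P \<notin> Q"
  proof
    assume "lead_coeff P \<in> Q"
    from drop_lead[OF _ this deg, of W j] P(1) obtain p' where
      p': "p' \<in> CP W" "degree p' < degree P" "val j P - val j p' \<in> Q" "allQ p' \<longrightarrow> allQ P"
      by (auto simp: A_def)
    then have "A p'" using P(1) diff[of "val j P" "val j P - val j p'"] by (auto simp: A_def)
    then show False using P(2) p'(2) by fastforce
  qed
  then show thesis using that[of P] P deg unfolding A_def by (metis not_le)
qed

text \<open>Up to a denominator \<open>c\<close> from k[W], an \<open>h\<close> outside Q is
  invertible modulo Q when x_j is algebraic. A multiple \<open>w\<close> of \<open>h\<close> of
  least degree must be constant in x_j: otherwise dividing \<open>P\<close> by it would exhibit a
  proper factor of the minimal polynomial.\<close>

lemma euclid: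
  assumes P: "P \<in> CP W" "val j P \<in> Q" "lead_coeff P \<notin> Q" "0 < degree P"
    and min: "\<And>r. r \<in> CP W \<Longrightarrow> val j r \<in> Q \<Longrightarrow> degree r < degree P \<Longrightarrow> allQ r"
    and h: "h \<in> CP W" "val j h \<notin> Q"
  shows "\<exists>c\<in>pfun_on W. c \<notin> Q \<and> (\<exists>u\<in>pfun_on (insert j W). c - u * val j h \<in> Q)"
proof -
  define A where "A w \<longleftrightarrow> w \<in> CP W \<and> val j w \<notin> Q \<and> (\<exists>u\<in>pfun_on (insert j W). val j w - u * val j h \<in> Q)" for w
  have "A h" using h zero pfo_1 by (auto simp: A_def intro!: bexI[of _ 1])
  from ex_has_least_nat[of A, OF this, of degree]
  obtain w where w: "A w" "\<And>p. A p \<Longrightarrow> degree w \<le> degree p" by blast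
  from w(1) obtain u where wu: "w \<in> CP W" "val j w \<notin> Q" "u \<in> pfun_on (insert j W)" "val j w - u * val j h \<in> Q"
    by (auto simp: A_def)
  have pf: "lead_coeff w \<in> poly_fun" "lead_coeff P \<in> poly_fun" "val j w \<in> poly_fun" "val j P \<in> poly_fun"
    "val j h \<in> poly_fun" "u \<in> poly_fun"
    using P h wu by (auto intro: CP_poly_fun pfun_on_poly_fun)
  have up: "c \<in> pfun_on (insert j W)" if "c \<in> pfun_on W" for c
    using that pfun_on_mono[of W "insert j W"] by auto
  have "degree w = 0"
  proof (rule ccontr)
    assume dw: "degree w \<noteq> 0"
    have lw: "lead_coeff w \<notin> Q"
    proof
      assume "lead_coeff w \<in> Q"
      from drop_lead[OF wu(1) this, of j] dw obtain w' where
        w': "w' \<in> CP W" "degree w' < degree w" "val j w - val j w' \<in> Q" by auto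
      have "val j w' - u * val j h \<in> Q"
        using diff[OF wu(4) w'(3)] by (simp add: algebra_simps)
      moreover have "val j w' \<notin> Q" using diff_cancel[OF w'(3)] wu(2) by blast
      ultimately have "A w'" using w' wu by (auto simp: A_def)
      then show False using w(2) w'(2) by fastforce
    qed
    \<comment> \<open>Otherwise the pseudo-remainder of \<open>w\<close> by \<open>P\<close> is
      again a multiple of \<open>h\<close> modulo Q, of smaller degree.\<close>
    have dwP: "degree w < degree P"
    proof (rule ccontr)
      assume ge: "\<not> degree w < degree P"
      from CP_pseudo_division[OF P(1) wu(1)] obtain e q r where d: "q \<in> CP W" "r \<in> CP W"
        "smult (lead_coeff P ^ e) w = P * q + r" "r = 0 \<or> degree r < degree P" by blast
      let ?l = "lead_coeff P ^ e"
      have l: "?l \<in> poly_fun" "?l \<notin> Q" using pf power P(3) poly_fun_intros(8) by blast+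
      have "?l * val j w = val j P * val j q + val j r" using arg_cong[OF d(3), of "val j"] by simp
      then have r: "val j r = ?l * val j w - val j q * val j P" by (simp add: algebra_simps)
      have qP: "val j q * val j P \<in> Q" using mult[OF P(2)] CP_poly_fun(2)[OF d(1)] by blast
      have rQ: "val j r \<notin> Q"
      proof
        assume "val j r \<in> Q"
        then have "?l * val j w \<in> Q" using diff_cancel[OF _ qP] r by simp
        then show False using not_mult[OF l(1) pf(3) l(2) wu(2)] by blast
      qed
      have "val j r - (?l * u) * val j h = ?l * (val j w - u * val j h) - val j q * val j P"
        unfolding r by (simp add: algebra_simps)
      also have "\<dots> \<in> Q" by (intro diff mult wu l qP)
      finally have "A r" using rQ d wu by (auto simp: A_def intro!: bexI[of _ "?l * u"] pfo_mult[OF up[OF pfo_power[OF CP_coeff[OF P(1)]]]])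
      then have "degree w \<le> degree r" by (rule w(2))
      moreover have "r \<noteq> 0" using rQ zero by auto
      ultimately show False using d(4) ge by auto
    qed
    from CP_pseudo_division[OF wu(1) P(1)] obtain e q r where d: "q \<in> CP W" "r \<in> CP W"
      "smult (lead_coeff w ^ e) P = w * q + r" "r = 0 \<or> degree r < degree w" "degree q \<le> degree P - degree w" by blast
    let ?l = "lead_coeff w ^ e"
    have l: "?l \<in> poly_fun" "?l \<notin> Q" using pf power lw poly_fun_intros(8) by blast+
    have vq: "val j q \<in> poly_fun" using CP_poly_fun(2)[OF d(1)] .
    have eq: "?l * val j P = val j w * val j q + val j r" using arg_cong[OF d(3), of "val j"] by simp
    have lP: "?l * val j P \<in> Q" by (intro mult P l)
    have rQ: "val j r \<in> Q"
    proof (rule ccontr)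
      assume rQ: "val j r \<notin> Q"
      have "val j r - (- u * val j q) * val j h = ?l * val j P - val j q * (val j w - u * val j h)"
        unfolding eq by (simp add: algebra_simps)
      also have "\<dots> \<in> Q" by (intro diff mult lP wu vq)
      finally have "A r" using rQ d wu
        by (auto simp: A_def intro!: bexI[of _ "- u * val j q"] pfo_mult pfo_uminus val_CP)
      then have "degree w \<le> degree r" by (rule w(2))
      moreover have "r \<noteq> 0" using rQ zero by auto
      ultimately show False using d(4) by auto
    qed
    have "val j w * val j q = ?l * val j P - val j r" using eq by simp
    then have "val j w * val j q \<in> Q" using diff[OF lP rQ] by simp
    \<comment> \<open>Primality puts the cofactor \<open>q\<close> into Q; as its degree is below
      that of \<open>P\<close>, all its coefficients lie in Q, and comparing coefficients in degree
      \<open>degree P\<close> contradicts the choice of \<open>P\<close>.\<close>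
    then have "val j q \<in> Q" using prime[OF pf(3) vq] wu(2) by blast
    moreover have "degree q < degree P" using d(5) dw dwP by linarith
    ultimately have aq: "allQ q" using min d(1) by blast
    have "allQ r" using min[OF d(2) rQ] d(4) dwP P(4) by fastforce
    then have "coeff (w * q + r) (degree P) \<in> Q" using aq CP_poly_fun(1)[OF wu(1)]
      by (auto simp: coeff_mult allQ_def intro!: add sum mult)
    then have "?l * lead_coeff P \<in> Q" using arg_cong[OF d(3), of "\<lambda>p. coeff p (degree P)"] by simp
    then show False using not_mult[OF l(1) pf(2) l(2) P(3)] by blast
  qed
  then obtain c where c: "w = [:c:]" by (metis degree_eq_zeroE)
  then have "c \<in> pfun_on W" "val j w = c" using wu(1) by (auto simp: CP_pCons)
  then show ?thesis using wu by auto
qed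

text \<open>Separability in characteristic zero. By minimality a derivative in Q would have all its
  coefficients in Q, but its top one is \<open>degree P\<close> times the leading coefficient of
  \<open>P\<close>.\<close>

lemma fder_notin:
  assumes P: "P \<in> CP W" "lead_coeff P \<notin> Q" "0 < degree P"
    and min: "\<And>r. r \<in> CP W \<Longrightarrow> val j r \<in> Q \<Longrightarrow> degree r < degree P \<Longrightarrow> allQ r"
  shows "val j (fder P) \<notin> Q"
proof
  assume "val j (fder P) \<in> Q"
  moreover have "degree (fder P) < degree P"
    using degree_fder_less P(3) by blast
  ultimately have "allQ (fder P)" using min CP_fder[OF P(1)] by blast
  then have "coeff (fder P) (degree P - 1) \<in> Q" by (simp add: allQ_def)
  then have "of_nat (degree P) * lead_coeff P \<in> Q" using P(3) by (simp add: coeff_fder)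
  then have "(\<lambda>x. 1 / of_nat (degree P)) * (of_nat (degree P) * lead_coeff P) \<in> Q"
    by (rule mult) (rule pf_const)
  moreover have "(\<lambda>x. 1 / of_nat (degree P)) * (of_nat (degree P) * lead_coeff P) = lead_coeff P"
    using P(3) by (auto simp: fun_eq_iff fun_apply)
  ultimately show False using P(2) by simp
qed

text \<open>Nullstellensatz and generic smoothness together, adjoining one variable x_j at a time to
  those in Y. If x_j is transcendental, its value is chosen off the roots of one polynomial and the
  tangent vector is kept. If it is algebraic, its value is a root of the minimal polynomial
  \<open>P\<close>, and the j-th component of the tangent vector solves a linear equation whose
  coefficient is the derivative of \<open>P\<close>.\<close>

lemma generic_point_aux:
  assumes Y: "Q \<inter> pfun_on Y = {0}" and W: "Y \<subseteq> W"
  shows "\<forall>h\<in>pfun_on W. h \<notin> Q \<longrightarrow> (\<exists>z. h z \<noteq> 0 \<and> (\<forall>q\<in>Q \<inter> pfun_on W. q z = 0) \<and>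
    (\<forall>v0. \<exists>v. (\<forall>i\<in>Y. v i = v0 i) \<and> (\<forall>q\<in>Q \<inter> pfun_on W. dderiv q z v = 0)))"
  using finite[of "W - Y"] W
proof (induction "W - Y" arbitrary: W rule: finite_induct)
  case empty
  then have "W = Y" by blast
  show ?case
  proof (intro ballI impI)
    fix h assume "h \<in> pfun_on W" "h \<notin> Q"
    then obtain z where "h z \<noteq> 0" using zero by (metis ext zero_fun_apply)
    then show "\<exists>z. h z \<noteq> 0 \<and> (\<forall>q\<in>Q \<inter> pfun_on W. q z = 0) \<and>
      (\<forall>v0. \<exists>v. (\<forall>i\<in>Y. v i = v0 i) \<and> (\<forall>q\<in>Q \<inter> pfun_on W. dderiv q z v = 0))"
      unfolding \<open>W = Y\<close> Y by (intro exI[of _ z]) (auto simp: fun_apply)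
  qed
next
  case (insert j F)
  define W' where "W' = W - {j}"
  have W': "F = W' - Y" "Y \<subseteq> W'" "W = insert j W'" "j \<notin> W'"
    using insert.hyps(2,4) insert.prems unfolding W'_def by blast+
  note IH = insert.hyps(3)[OF W'(1,2), rule_format]
  show ?case unfolding W'(3)
  proof (intro ballI impI)
    fix h assume h: "h \<in> pfun_on (insert j W')" "h \<notin> Q"
    from CP_exists[OF h(1)] obtain p where p: "p \<in> CP W'" "h = val j p" by blast
    show "\<exists>z. h z \<noteq> 0 \<and> (\<forall>q\<in>Q \<inter> pfun_on (insert j W'). q z = 0) \<and>
       (\<forall>v0. \<exists>v. (\<forall>i\<in>Y. v i = v0 i) \<and> (\<forall>q\<in>Q \<inter> pfun_on (insert j W'). dderiv q z v = 0))"
    proof (cases "\<forall>r\<in>CP W'. val j r \<in> Q \<longrightarrow> allQ r")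
      case True
      have "\<not> allQ p" using allQ_val[OF p(1)] h p by auto
      then obtain n where n: "coeff p n \<notin> Q" by (auto simp: allQ_def)
      from IH[OF CP_coeff[OF p(1)] n] obtain z where z: "coeff p n z \<noteq> 0"
        "\<And>q. q \<in> Q \<Longrightarrow> q \<in> pfun_on W' \<Longrightarrow> q z = 0"
        "\<And>v0. \<exists>v. (\<forall>i\<in>Y. v i = v0 i) \<and> (\<forall>q\<in>Q \<inter> pfun_on W'. dderiv q z v = 0)" by blast
      have "ev z p \<noteq> 0" using z(1) by (metis coeff_0 coeff_ev)
      then obtain T where T: "poly (ev z p) T \<noteq> 0" using poly_all_0_iff_0 by blast
      define z' where "z' = z(j := T)"
      have zz: "z' i = z i" if "i \<in> W'" for i using that W'(4) by (auto simp: z'_def)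
      have "ev z' p = ev z p" by (rule ev_cong[OF p(1) zz])
      then have "h z' \<noteq> 0" using T by (simp add: p(2) val_apply z'_def)
      moreover have vv: "q z' = 0 \<and> dderiv q z' v = 0"
        if q: "q \<in> Q" "q \<in> pfun_on (insert j W')" and v: "\<forall>q\<in>Q \<inter> pfun_on W'. dderiv q z v = 0" for q v
      proof -
        from CP_exists[OF q(2)] obtain r where r: "r \<in> CP W'" "q = val j r" by blast
        then have a: "allQ r" using True q by blast
        have "coeff r n z' = 0 \<and> dderiv (coeff r n) z' v = 0" for n
        proof -
          have "coeff r n z' = coeff r n z" by (rule pfun_on_cong[OF CP_coeff[OF r(1)] zz])
          moreover have "dderiv (coeff r n) z' v = dderiv (coeff r n) z v"
            by (rule dderiv_cong[OF CP_coeff[OF r(1)] zz]) auto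
          ultimately show ?thesis using z(2) v a CP_coeff[OF r(1)] by (auto simp: allQ_def)
        qed
        then show ?thesis unfolding r(2) by (intro val_vanish[OF r(1)]) auto
      qed
      ultimately show ?thesis using z(3) by (metis IntE)
    next
      case False
      then obtain p0 where p0: "p0 \<in> CP W'" "val j p0 \<in> Q" "\<not> allQ p0" by blast
      from minimal_poly[OF p0] obtain P where P: "P \<in> CP W'" "val j P \<in> Q" "lead_coeff P \<notin> Q" "0 < degree P"
        and min: "\<And>r. r \<in> CP W' \<Longrightarrow> val j r \<in> Q \<Longrightarrow> degree r < degree P \<Longrightarrow> allQ r" by blast
      let ?s = "val j (fder P)"
      let ?l = "lead_coeff P"
      have s: "?s \<notin> Q" by (rule fder_notin[OF P(1,3,4) min])
      have sP: "fder P \<in> CP W'" by (rule CP_fder[OF P(1)])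
      \<comment> \<open>Inverting the product of \<open>h\<close> and the derivative yields a single
        \<open>c\<close>: wherever \<open>c\<close> does not vanish on the zeros of Q, neither
        factor vanishes.\<close>
      have "val j (p * fder P) \<notin> Q" using not_mult[of h ?s] s h p CP_poly_fun[OF sP] CP_poly_fun[OF p(1)] by auto
      from euclid[OF P min CP_mult[OF p(1) sP] this]
      obtain c u where c: "c \<in> pfun_on W'" "c \<notin> Q" "u \<in> pfun_on (insert j W')"
        "c - u * (h * ?s) \<in> Q" by (auto simp: p(2))
      have l: "?l \<in> pfun_on W'" by (rule CP_coeff[OF P(1)])
      have "?l * c \<notin> Q" using not_mult l c P(3) pfun_on_poly_fun by blast
      from IH[OF pfo_mult[OF l c(1)] this] obtain z where z: "?l z \<noteq> 0" "c z \<noteq> 0"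
        "\<And>q. q \<in> Q \<Longrightarrow> q \<in> pfun_on W' \<Longrightarrow> q z = 0"
        "\<And>v0. \<exists>v. (\<forall>i\<in>Y. v i = v0 i) \<and> (\<forall>q\<in>Q \<inter> pfun_on W'. dderiv q z v = 0)" by (auto simp: fun_apply)
      have "coeff (ev z P) (degree P) \<noteq> 0" using z(1) by simp
      then have "0 < degree (ev z P)" using P(4) le_degree by fastforce
      then obtain T where T: "poly (ev z P) T = 0" using alg_closed_imp_poly_has_root by blast
      define z' where "z' = z(j := T)"
      have zz: "z' i = z i" if "i \<in> W'" for i using that W'(4) by (auto simp: z'_def)
      have lz: "?l z' \<noteq> 0" using z(1) pfun_on_cong[OF l zz] by simp
      have "ev z' P = ev z P" by (rule ev_cong[OF P(1) zz])
      then have Pz: "val j P z' = 0" using T by (simp add: val_apply z'_def)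
      \<comment> \<open>Up to a power of the leading coefficient, an element of Q is a multiple of
        \<open>P\<close> plus a polynomial with coefficients in Q. So zeros and tangent vectors need
        testing only on \<open>P\<close> and on Q \<inter> k[W'].\<close>
      have red: "\<exists>e q1 r. q1 \<in> CP W' \<and> r \<in> CP W' \<and> allQ r \<and> ?l ^ e * q = val j P * val j q1 + val j r"
        if q: "q \<in> Q" "q \<in> pfun_on (insert j W')" for q
      proof -
        from CP_exists[OF q(2)] obtain r0 where r0: "r0 \<in> CP W'" "q = val j r0" by blast
        from CP_pseudo_division[OF P(1) r0(1)] obtain e q1 r where d: "q1 \<in> CP W'" "r \<in> CP W'"
          "smult (?l ^ e) r0 = P * q1 + r" "r = 0 \<or> degree r < degree P" by blast
        have eq: "?l ^ e * q = val j P * val j q1 + val j r" using arg_cong[OF d(3), of "val j"] r0 by simp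
        then have "val j r = ?l ^ e * q - val j q1 * val j P" by (simp add: algebra_simps)
        also have "\<dots> \<in> Q"
          by (intro diff mult q P poly_fun_intros CP_poly_fun(2)[OF d(1)] pfun_on_poly_fun[OF l])
        finally have "allQ r" using min d P(4) by fastforce
        then show ?thesis using d eq by blast
      qed
      have rz: "coeff r n z' = 0 \<and> dderiv (coeff r n) z' v = 0"
        if "allQ r" "r \<in> CP W'" "\<forall>q\<in>Q \<inter> pfun_on W'. dderiv q z v = 0" for r n v
      proof -
        have "coeff r n z' = coeff r n z" by (rule pfun_on_cong[OF CP_coeff[OF that(2)] zz])
        moreover have "dderiv (coeff r n) z' v = dderiv (coeff r n) z v"
          by (rule dderiv_cong[OF CP_coeff[OF that(2)] zz]) auto
        ultimately show ?thesis using z(3) that CP_coeff[OF that(2)] by (auto simp: allQ_def)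
      qed
      have qz: "q z' = 0" if q: "q \<in> Q" "q \<in> pfun_on (insert j W')" for q
      proof -
        from red[OF q] obtain e q1 r where d: "q1 \<in> CP W'" "r \<in> CP W'" "allQ r"
          "?l ^ e * q = val j P * val j q1 + val j r" by blast
        obtain v where v: "\<forall>q\<in>Q \<inter> pfun_on W'. dderiv q z v = 0" using z(4) by blast
        have "val j r z' = 0"
          using val_vanish[OF d(2), of z' v j] rz[OF d(3,2) v] by blast
        then have "(?l ^ e * q) z' = 0" unfolding d(4) using Pz by (simp add: fun_apply)
        moreover have "(?l ^ e) z' \<noteq> 0" using lz by (induction e) (auto simp: fun_apply)
        ultimately show "q z' = 0" by (simp add: fun_apply)
      qed
      have "(c - u * (h * ?s)) z' = 0"
      proof (rule qz[OF c(4)])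
        show "c - u * (h * ?s) \<in> pfun_on (insert j W')"
          using c(1,3) h(1) val_CP[OF sP] pfun_on_mono[of W' "insert j W'"]
          by (auto intro!: pfo_diff pfo_mult)
      qed
      moreover have "c z' \<noteq> 0" using z(2) pfun_on_cong[OF c(1) zz] by simp
      ultimately have hz: "h z' \<noteq> 0" "?s z' \<noteq> 0" by (auto simp: fun_apply)
      have "\<exists>v. (\<forall>i\<in>Y. v i = v0 i) \<and> (\<forall>q\<in>Q \<inter> pfun_on (insert j W'). dderiv q z' v = 0)" for v0
      proof -
        obtain v where v: "\<forall>i\<in>Y. v i = v0 i" "\<forall>q\<in>Q \<inter> pfun_on W'. dderiv q z v = 0" using z(4) by blast
        \<comment> \<open>Only \<open>P\<close> constrains the j-th component; this value makes the
          derivative of \<open>P\<close> along \<open>v'\<close> vanish.\<close>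
        define y where "y = - dderiv (val j P) z' v / ?s z'"
        define v' where "v' = (\<lambda>i. 1 * v i + y * (if i = j then 1 else 0))"
        have vv: "v' i = v i" if "i \<in> W'" for i using that W'(4) by (auto simp: v'_def)
        have "dderiv (val j P) z' v' = 1 * dderiv (val j P) z' v + y * ?s z'"
          unfolding v'_def by (subst dderiv_linear[OF CP_poly_fun(2)[OF P(1)]])
            (simp add: dderiv_val_unit[OF P(1) W'(4)])
        then have P0: "dderiv (val j P) z' v' = 0" using hz(2) by (simp add: y_def)
        have v'Q: "\<forall>q\<in>Q \<inter> pfun_on W'. dderiv q z v' = 0"
        proof
          fix q assume q: "q \<in> Q \<inter> pfun_on W'"
          have "dderiv q z v' = dderiv q z v" by (rule dderiv_cong[of _ W']) (use q vv in auto)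
          then show "dderiv q z v' = 0" using v q by simp
        qed
        have "dderiv q z' v' = 0" if q: "q \<in> Q" "q \<in> pfun_on (insert j W')" for q
        proof -
          from red[OF q] obtain e q1 r where d: "q1 \<in> CP W'" "r \<in> CP W'" "allQ r"
            "?l ^ e * q = val j P * val j q1 + val j r" by blast
          have r0: "val j r z' = 0 \<and> dderiv (val j r) z' v' = 0"
            using val_vanish[OF d(2), of z' v' j] rz[OF d(3,2) v'Q] by blast
          have pf: "?l ^ e \<in> poly_fun" "q \<in> poly_fun" "val j P \<in> poly_fun" "val j q1 \<in> poly_fun" "val j r \<in> poly_fun"
            using q(1) sub d P l by (auto intro: CP_poly_fun pfun_on_poly_fun pfo_power)
          have "dderiv (?l ^ e * q) z' v' = 0"
            unfolding d(4) dderiv_add[OF poly_fun_intros(4)[OF pf(3,4)] pf(5)] dderiv_mult[OF pf(3,4)]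
            using r0 Pz P0 by simp
          then have "(?l ^ e) z' * dderiv q z' v' = 0"
            using dderiv_mult[OF pf(1,2), of z' v'] qz[OF q] by simp
          moreover have "(?l ^ e) z' \<noteq> 0" using lz by (induction e) (auto simp: fun_apply)
          ultimately show ?thesis by simp
        qed
        moreover have "\<forall>i\<in>Y. v' i = v0 i" using vv v(1) W'(2) by auto
        ultimately show ?thesis by blast
      qed
      then show ?thesis using hz(1) qz by blast
    qed
  qed
qed

lemma generic_point:
  assumes "Q \<inter> pfun_on Y = {0}" "h \<in> poly_fun" "h \<notin> Q"
  obtains z where "h z \<noteq> 0" "\<And>q. q \<in> Q \<Longrightarrow> q z = 0"
    "\<And>v0. \<exists>v. (\<forall>i\<in>Y. v i = v0 i) \<and> (\<forall>q\<in>Q. dderiv q z v = 0)"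
proof -
  have "Q \<inter> pfun_on UNIV = Q" using sub by (auto simp: pfun_on_UNIV)
  then have Q: "Q \<inter> poly_fun = Q" by (simp only: pfun_on_UNIV)
  from generic_point_aux[OF assms(1) subset_UNIV, unfolded pfun_on_UNIV Q, rule_format, OF assms(2,3)]
  obtain z where "h z \<noteq> 0" "\<forall>q\<in>Q. q z = 0"
    "\<forall>v0. \<exists>v. (\<forall>i\<in>Y. v i = v0 i) \<and> (\<forall>q\<in>Q. dderiv q z v = 0)" by blast
  then show thesis by (intro that[of z]) auto
qed

end

subsection \<open>Prime ideals avoiding a polynomial subring\<close>

text \<open>On the line joining a point where \<open>f\<close> is nonzero to one where
  \<open>g\<close> is, both restrict to nonzero polynomials in one variable.\<close>

lemma poly_fun_mult_nonzero:
  fixes f g :: "('i::finite \<Rightarrow> 'k::field_char_0) \<Rightarrow> 'k"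
  assumes "f \<in> poly_fun" "g \<in> poly_fun" "f \<noteq> 0" "g \<noteq> 0"
  shows "f * g \<noteq> 0"
proof -
  obtain a where a: "f a \<noteq> 0" using assms(3) by (auto simp: fun_eq_iff fun_apply)
  obtain b where b: "g b \<noteq> 0" using assms(4) by (auto simp: fun_eq_iff fun_apply)
  obtain p where p: "\<And>t. poly p t = f (\<lambda>i. a i + t * (b i - a i))"
    using line_poly[OF assms(1), of a "\<lambda>i. b i - a i"] by auto
  obtain q where q: "\<And>t. poly q t = g (\<lambda>i. a i + t * (b i - a i))"
    using line_poly[OF assms(2), of a "\<lambda>i. b i - a i"] by auto
  have "p \<noteq> 0" using p[of 0] a by auto
  moreover have "q \<noteq> 0" using q[of 1] b by auto
  ultimately have "p * q \<noteq> 0" by simp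
  then obtain t where "poly (p * q) t \<noteq> 0" using poly_all_0_iff_0 by blast
  then have "(f * g) (\<lambda>i. a i + t * (b i - a i)) \<noteq> 0" by (simp add: p q fun_apply)
  then show ?thesis by (metis zero_fun_apply)
qed

definition pideal :: "(('i::finite \<Rightarrow> 'k::comm_ring_1) \<Rightarrow> 'k) set \<Rightarrow> bool" where
  "pideal Q \<longleftrightarrow> Q \<subseteq> poly_fun \<and> 0 \<in> Q \<and> (\<forall>f\<in>Q. \<forall>g\<in>Q. f + g \<in> Q) \<and> (\<forall>f\<in>Q. \<forall>g\<in>poly_fun. g * f \<in> Q)"

text \<open>An ideal maximal among those meeting k[Y] only in 0 is prime: adjoining an outside
  element makes the ideal meet k[Y] nontrivially, and the product of two nonzero elements of k[Y] is
  nonzero.\<close>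

lemma exists_prime_pideal:
  fixes S :: "(('i::finite \<Rightarrow> 'k::{alg_closed_field, field_char_0}) \<Rightarrow> 'k) set"
  assumes S: "pideal S" "S \<inter> pfun_on Y = {0}"
  shows "\<exists>Q. prime_pideal Q \<and> S \<subseteq> Q \<and> Q \<inter> pfun_on Y = {0}"
proof -
  define A where "A = {Q. pideal Q \<and> S \<subseteq> Q \<and> Q \<inter> pfun_on Y = {0}}"
  have "S \<in> A" using S by (auto simp: A_def)
  moreover have "\<Union>C \<in> A" if C: "C \<noteq> {}" "subset.chain A C" for C
  proof -
    have CA: "Q \<in> A" if "Q \<in> C" for Q using C(2) that by (auto simp: subset.chain_def)
    have CI: "pideal Q" if "Q \<in> C" for Q using CA[OF that] by (simp add: A_def)
    have add: "f + g \<in> \<Union>C" if fg: "f \<in> \<Union>C" "g \<in> \<Union>C" for f g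
    proof -
      obtain Q1 Q2 where q: "Q1 \<in> C" "f \<in> Q1" "Q2 \<in> C" "g \<in> Q2" using fg by blast
      then have "Q1 \<subseteq> Q2 \<or> Q2 \<subseteq> Q1" using C(2) unfolding subset.chain_def by blast
      then have "\<exists>Q\<in>C. f \<in> Q \<and> g \<in> Q" using q by blast
      then show ?thesis using CI unfolding pideal_def by blast
    qed
    have "pideal (\<Union>C)"
      unfolding pideal_def
    proof (intro conjI ballI add)
      show "\<Union>C \<subseteq> poly_fun" using CI unfolding pideal_def by blast
      show "0 \<in> \<Union>C" using CI C(1) unfolding pideal_def by blast
      show "g * f \<in> \<Union>C" if "f \<in> \<Union>C" "g \<in> poly_fun" for f g
        using that CI unfolding pideal_def by blast
    qed
    moreover have "S \<subseteq> \<Union>C" "\<Union>C \<inter> pfun_on Y = {0}" using CA C(1) unfolding A_def by blast+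
    ultimately show ?thesis by (simp add: A_def)
  qed
  ultimately obtain Q where Q: "Q \<in> A" and max: "\<And>Q'. Q' \<in> A \<Longrightarrow> Q \<subseteq> Q' \<Longrightarrow> Q' = Q"
    using subset_Zorn_nonempty[of A] by blast
  have QI: "Q \<subseteq> poly_fun" "0 \<in> Q" "\<And>f g. f \<in> Q \<Longrightarrow> g \<in> Q \<Longrightarrow> f + g \<in> Q"
    "\<And>f g. f \<in> Q \<Longrightarrow> g \<in> poly_fun \<Longrightarrow> g * f \<in> Q" "S \<subseteq> Q" "Q \<inter> pfun_on Y = {0}"
    using Q unfolding A_def pideal_def by auto
  have meet: "\<exists>q\<in>Q. \<exists>r\<in>poly_fun. q + r * f \<in> pfun_on Y \<and> q + r * f \<noteq> 0"
    if f: "f \<in> poly_fun" "f \<notin> Q" for f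
  proof -
    define Q' where "Q' = {q + r * f | q r. q \<in> Q \<and> r \<in> poly_fun}"
    have QQ': "Q \<subseteq> Q'" unfolding Q'_def using poly_fun_intros(1) by force
    have "0 + 1 * f \<in> Q'" unfolding Q'_def using QI(2) poly_fun_intros(2) by blast
    then have "Q' \<noteq> Q" using f by auto
    then have "Q' \<notin> A" using max QQ' by blast
    moreover have "pideal Q'"
      unfolding pideal_def
    proof (intro conjI ballI)
      show "Q' \<subseteq> poly_fun" using f(1) QI(1) by (auto simp: Q'_def intro!: poly_fun_intros)
      show "0 \<in> Q'" using QI(2) QQ' by blast
      fix x assume "x \<in> Q'"
      then obtain q r where x: "x = q + r * f" "q \<in> Q" "r \<in> poly_fun" by (auto simp: Q'_def)
      show "x + y \<in> Q'" if "y \<in> Q'" for y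
      proof -
        obtain q' r' where y: "y = q' + r' * f" "q' \<in> Q" "r' \<in> poly_fun" using \<open>y \<in> Q'\<close> by (auto simp: Q'_def)
        have "x + y = (q + q') + (r + r') * f" by (simp add: x y algebra_simps)
        then show ?thesis unfolding Q'_def using QI(3) x y poly_fun_intros(3) by blast
      qed
      show "g * x \<in> Q'" if "g \<in> poly_fun" for g
      proof -
        have "g * x = g * q + (g * r) * f" by (simp add: x algebra_simps)
        then show ?thesis unfolding Q'_def using QI(4) x that poly_fun_intros(4) by blast
      qed
    qed
    ultimately have "Q' \<inter> pfun_on Y \<noteq> {0}" using QI(5) QQ' by (auto simp: A_def)
    then obtain x where "x \<in> Q'" "x \<in> pfun_on Y" "x \<noteq> 0" using QI(2) QQ' pfo_0 by blast
    then show ?thesis unfolding Q'_def by blast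
  qed
  have "prime_pideal Q"
  proof
    show "Q \<subseteq> poly_fun" "0 \<in> Q" "\<And>f g. f \<in> Q \<Longrightarrow> g \<in> Q \<Longrightarrow> f + g \<in> Q"
      "\<And>f g. f \<in> Q \<Longrightarrow> g \<in> poly_fun \<Longrightarrow> g * f \<in> Q" by (fact QI)+
    show "1 \<notin> Q" using QI(6) pfo_1[of Y] one_neq_zero by blast
    fix f g assume f: "f \<in> poly_fun" and g: "g \<in> poly_fun" and fg: "f * g \<in> Q"
    show "f \<in> Q \<or> g \<in> Q"
    proof (rule ccontr)
      assume "\<not> (f \<in> Q \<or> g \<in> Q)"
      then obtain q r q' r' where 1: "q \<in> Q" "r \<in> poly_fun" "q + r * f \<in> pfun_on Y" "q + r * f \<noteq> 0"
        and 2: "q' \<in> Q" "r' \<in> poly_fun" "q' + r' * g \<in> pfun_on Y" "q' + r' * g \<noteq> 0"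
        using meet f g by meson
      let ?x = "(q + r * f) * (q' + r' * g)"
      have "?x = (q' + r' * g) * q + ((r * f) * q' + (r * r') * (f * g))" by (simp add: algebra_simps)
      also have "\<dots> \<in> Q" 
        using QI(4)[OF 1(1) pfun_on_poly_fun[OF 2(3)]] QI(4)[OF 2(1) poly_fun_intros(4)[OF 1(2) f]]
          QI(4)[OF fg poly_fun_intros(4)[OF 1(2) 2(2)]] by (intro QI(3))
      finally have "?x \<in> Q" .
      moreover have "?x \<in> pfun_on Y" using 1 2 by (intro pfo_mult)
      ultimately have "?x = 0" using QI(6) by blast
      then show False using poly_fun_mult_nonzero 1 2 pfun_on_poly_fun by blast
    qed
  qed
  then show ?thesis using QI by blast
qed

subsection \<open>Dimension of spaces of conormal type\<close>

lemma fs_span_units: "(f :: 'n::finite \<Rightarrow> 'k::field) \<in> fs.span (range (\<lambda>i j. if j = i then 1 else 0))"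
proof -
  have "f = (\<Sum>i\<in>UNIV. fscale (f i) (\<lambda>j. if j = i then 1 else 0))"
    by (rule ext) (simp add: sum_fun_apply fun_apply if_distrib cong: if_cong)
  also have "\<dots> \<in> fs.span (range (\<lambda>i j. if j = i then 1 else 0))"
    by (intro fs.span_sum fs.span_scale fs.span_base) auto
  finally show ?thesis .
qed

text \<open>The projection of T to the first block lies in L, and its kernel lies in the annihilator
  of L, so dim T is at most dim L + (n - dim L) = n.\<close>

lemma conormal_dimension:
  fixes T :: "(('n::finite) + 'n \<Rightarrow> 'k::field) set"
  assumes L: "fs.subspace L" and T: "fs.subspace T"
    and TL: "\<And>u. u \<in> T \<Longrightarrow> u \<circ> Inl \<in> L"
    and perp: "\<And>u l. u \<in> T \<Longrightarrow> u \<circ> Inl = 0 \<Longrightarrow> l \<in> L \<Longrightarrow> (\<Sum>i\<in>UNIV. u (Inr i) * l i) = 0"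
    and surj: "\<And>v0. \<exists>v\<in>T. \<forall>y\<in>Y. v y = v0 y"
  shows "card Y \<le> card (UNIV :: 'n set)"
proof (rule ccontr)
  assume big: "\<not> card Y \<le> card (UNIV :: 'n set)"
  \<comment> \<open>A maximal \<open>B\<close> such that L maps onto k^B; by maximality this map is
    also injective, so \<open>B\<close> has dim L elements.\<close>
  define \<B> where "\<B> = {B. \<forall>b0. \<exists>l\<in>L. \<forall>i\<in>B. l i = b0 i}"
  have "{} \<in> \<B>" using fs.subspace_0[OF L] by (auto simp: \<B>_def)
  then obtain B where B: "B \<in> \<B>" and max: "\<And>B'. B' \<in> \<B> \<Longrightarrow> B \<subseteq> B' \<Longrightarrow> B = B'"
    using finite_has_maximal2[OF finite] by metis
  have inj: "l = 0" if l: "l \<in> L" "\<And>i. i \<in> B \<Longrightarrow> l i = 0" for l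
  proof (rule ccontr)
    assume "l \<noteq> 0"
    then obtain j where j: "l j \<noteq> 0" by (auto simp: fun_eq_iff fun_apply)
    have "insert j B \<in> \<B>"
      unfolding \<B>_def mem_Collect_eq
    proof
      fix b0
      obtain l0 where l0: "l0 \<in> L" "\<forall>i\<in>B. l0 i = b0 i" using B unfolding \<B>_def by blast
      show "\<exists>l\<in>L. \<forall>i\<in>insert j B. l i = b0 i"
      proof (intro bexI ballI)
        show "l0 + fscale ((b0 j - l0 j) / l j) l \<in> L"
          by (intro fs.subspace_add[OF L] fs.subspace_scale[OF L] l l0)
        show "(l0 + fscale ((b0 j - l0 j) / l j) l) i = b0 i" if "i \<in> insert j B" for i
          using that j l l0 by (auto simp: fun_apply)
      qed
    qed
    then have "j \<in> B" using max[of "insert j B"] by blast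
    then show False using l j by blast
  qed
  have "\<exists>v. v \<in> T \<and> (\<forall>y'\<in>Y. v y' = (if y' = y then 1 else 0))" for y
    using surj[of "\<lambda>y'. if y' = y then 1 else 0"] by blast
  then obtain v where v: "\<And>y. v y \<in> T" "\<And>y y'. y' \<in> Y \<Longrightarrow> v y y' = (if y' = y then 1 else 0)" by metis
  \<comment> \<open>n coordinates that determine an element of T: the first block on
    \<open>B\<close> detects the projection to L, the second block off \<open>B\<close> detects what
    lies in the annihilator.\<close>
  define \<iota> :: "('n + 'n \<Rightarrow> 'k) \<Rightarrow> 'n \<Rightarrow> 'k" where "\<iota> u = (\<lambda>i. if i \<in> B then u (Inl i) else u (Inr i))" for u
  let ?U = "range (\<lambda>(i::'n) j. if j = i then 1 else 0 :: 'k)"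
  have cU: "card ?U < card Y" using card_image_le[of "UNIV :: 'n set" "\<lambda>(i::'n) j. if j = i then 1 else 0 :: 'k"] big by simp
  obtain c where c: "\<exists>y\<in>Y. c y \<noteq> 0" "(\<Sum>y\<in>Y. fscale (c y) (\<iota> (v y))) = 0"
    using dependent_family[of Y ?U "\<lambda>y. \<iota> (v y)"] cU fs_span_units by auto
  define u where "u = (\<Sum>y\<in>Y. fscale (c y) (v y))"
  have uT: "u \<in> T" unfolding u_def by (intro fs.subspace_sum[OF T] fs.subspace_scale[OF T] v)
  have iu: "\<iota> u i = 0" for i
    using fun_cong[OF c(2), of i] by (auto simp: u_def \<iota>_def sum_fun_apply fun_apply)
  have "(u \<circ> Inl) i = 0" if "i \<in> B" for i using iu[of i] that by (simp add: \<iota>_def)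
  then have u0: "u \<circ> Inl = 0" using inj TL[OF uT] by blast
  have u1: "u (Inr b) = 0" for b
  proof (cases "b \<in> B")
    case True
    \<comment> \<open>Pairing with the element of L dual to \<open>b\<close> isolates
      \<open>u (Inr b)\<close>, since \<open>u (Inr i)\<close> already vanishes for \<open>i\<close>
      outside \<open>B\<close>.\<close>
    have "\<exists>l\<in>L. \<forall>i\<in>B. l i = (\<lambda>i. if i = b then 1 else 0) i"
      using B[unfolded \<B>_def mem_Collect_eq] by (rule spec)
    then obtain l where l: "l \<in> L" "\<forall>i\<in>B. l i = (if i = b then 1 else 0)" by blast
    have "u (Inr i) * l i = (if i = b then u (Inr b) else 0)" for i
      using l(2) iu[of i] True by (cases "i \<in> B") (auto simp: \<iota>_def)
    then have "(\<Sum>i\<in>UNIV. u (Inr i) * l i) = u (Inr b)" by simp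
    then show ?thesis using perp[OF uT u0 l(1)] by simp
  next
    case False
    then show ?thesis using iu[of b] by (simp add: \<iota>_def)
  qed
  obtain y where y: "y \<in> Y" "c y \<noteq> 0" using c(1) by blast
  have "u y = 0" using u1 fun_cong[OF u0] by (cases y) (auto simp: fun_apply)
  moreover have "u y = (\<Sum>y'\<in>Y. if y' = y then c y' else 0)"
    unfolding u_def sum_fun_apply by (intro sum.cong) (auto simp: fun_apply v(2)[OF y(1)])
  moreover have "\<dots> = c y" using y by (simp add: sum.delta'[of Y y] finite)
  ultimately show False using y by simp
qed

subsection \<open>The symbol ideal\<close>

definition lift :: "(('n \<Rightarrow> 'k) \<Rightarrow> 'k) \<Rightarrow> ('n + 'n \<Rightarrow> 'k) \<Rightarrow> 'k" where
  "lift f u = f (\<lambda>i. u (Inl i))"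

lemma lift_add: "lift (f + g) = lift f + lift g"
  and lift_0: "lift 0 = 0"
  by (auto simp: lift_def fun_eq_iff fun_apply)

lemma lift_fscale: "lift (fscale c f) = fscale c (lift f)"
  by (auto simp: lift_def fun_eq_iff fun_apply)

lemma lift_poly_fun: "f \<in> poly_fun \<Longrightarrow> lift f \<in> poly_fun"
  unfolding lift_def by (induction rule: poly_fun.induct) (auto intro: poly_fun.intros)

lemma dderiv_lift: "dderiv (lift f) z v = dderiv f (\<lambda>i. z (Inl i)) (\<lambda>i. v (Inl i))"
  by (simp add: dderiv_def lift_def)

lemma dderiv_lin:
  fixes f :: "('i::finite \<Rightarrow> 'k::field_char_0) \<Rightarrow> 'k"
  assumes "f \<in> poly_fun"
  shows "dderiv f z (u + v) = dderiv f z u + dderiv f z v"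
    "dderiv f z (fscale c u) = c * dderiv f z u"
    "dderiv f z 0 = 0"
  using dderiv_linear[OF assms, of z 1 u 1 v] dderiv_linear[OF assms, of z c u 0 u] dderiv_linear[OF assms, of z 0 u 0 u]
  by (simp_all add: plus_fun_def fscale_def zero_fun_def)

definition zideal :: "('n::finite \<Rightarrow> 'k::comm_ring_1) set \<Rightarrow> (('n \<Rightarrow> 'k) \<Rightarrow> 'k) set" where
  "zideal Z = {f \<in> poly_fun. \<forall>x\<in>Z. f x = 0}"

lemma poly_fun_prod: "(\<And>i. i \<in> A \<Longrightarrow> f i \<in> poly_fun) \<Longrightarrow> prod f A \<in> poly_fun"
  by (induction A rule: infinite_finite_induct) (simp_all add: poly_fun_intros(2,4))

lemma mon_poly_fun: "mon m \<in> poly_fun"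
proof -
  have p: "(\<lambda>u. u i ^ n) \<in> poly_fun" for i :: 'a and n
    by (induction n) (auto intro: poly_fun.intros)
  have "(\<lambda>u. \<Prod>i\<in>A. u i ^ m i) \<in> poly_fun" for A
    by (induction A rule: infinite_finite_induct) (auto intro: poly_fun.intros p)
  then show ?thesis by (simp add: mon_def[abs_def])
qed

lemma fscale_poly_fun: "f \<in> poly_fun \<Longrightarrow> fscale c f \<in> poly_fun"
  unfolding fscale_def by (intro pf_mult pf_const)

lemma subspace_poly_fun: "fs.subspace poly_fun"
  unfolding fs.subspace_def by (intro conjI ballI allI poly_fun_intros(1) poly_fun_intros(3) fscale_poly_fun)

lemma pfun_on_span_mon:
  assumes "f \<in> pfun_on Y"
  shows "f \<in> fs.span (mon ` {m. \<forall>i. i \<notin> Y \<longrightarrow> m i = 0})"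
  using assms
proof induction
  case (pfo_const c)
  have eq: "(\<lambda>x. c) = fscale c (mon 0)" by (simp add: mon_zero fun_eq_iff fun_apply)
  show ?case unfolding eq by (intro fs.span_scale fs.span_base) (auto simp: fun_apply)
next
  case (pfo_coord i)
  have eq: "(\<lambda>x. x i) = mon (up i 0)" by (rule ext) (simp add: mon_up mon_zero fun_apply)
  show ?case unfolding eq using pfo_coord by (intro fs.span_base) (auto simp: up_def fun_apply)
next
  case (pfo_add f g)
  then show ?case by (auto intro: fs.span_add)
next
  case (pfo_mult f g)
  from pfo_mult.IH(1) show ?case
  proof (induction rule: fs.span_induct_alt)
    case base
    show ?case by (simp add: fs.span_zero)
  next
    case (step c x y)
    from pfo_mult.IH(2) have "x * g \<in> fs.span (mon ` {m. \<forall>i. i \<notin> Y \<longrightarrow> m i = 0})"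
    proof (induction rule: fs.span_induct_alt)
      case base
      show ?case by (simp add: fs.span_zero)
    next
      case (step c' x' y')
      have "x * (fscale c' x' + y') = fscale c' (x * x') + x * y'"
        by (simp add: fun_eq_iff fun_apply algebra_simps)
      moreover have "x * x' \<in> fs.span (mon ` {m. \<forall>i. i \<notin> Y \<longrightarrow> m i = 0})"
        using \<open>x \<in> _\<close> step(1) by (auto simp: mon_add[symmetric] fun_apply intro!: fs.span_base)
      ultimately show ?case using step by (auto intro!: fs.span_add fs.span_scale)
    qed
    moreover have "(fscale c x + y) * g = fscale c (x * g) + y * g"
      by (simp add: fun_eq_iff fun_apply algebra_simps)
    ultimately show ?case using step by (auto intro!: fs.span_add fs.span_scale)
  qed
qed

lemma poly_fun_span_mon: "poly_fun = fs.span (range mon)"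
proof
  show "poly_fun \<subseteq> fs.span (range mon)"
    using pfun_on_span_mon[of _ UNIV] by (auto simp: pfun_on_UNIV)
  show "fs.span (range mon) \<subseteq> poly_fun"
    using mon_poly_fun by (intro fs.span_minimal subspace_poly_fun) auto
qed

locale leafy =
  fixes X :: "('n::finite \<Rightarrow> 'k::{alg_closed_field, field_char_0}) set"
    and a :: "'g \<Rightarrow> 'n \<Rightarrow> ('n \<Rightarrow> 'k) \<Rightarrow> 'k"
    and \<L> :: "('n \<Rightarrow> 'k) set set"
  assumes X: "zclosed X" and a: "a \<xi> i \<in> poly_fun"
    and fin: "finite \<L>" and cover: "X = \<Union>\<L>"
    and leaf: "Z \<in> \<L> \<Longrightarrow> z \<in> Z \<Longrightarrow> range (\<lambda>\<xi> i. a \<xi> i z) = tangent_space Z z"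
begin

text \<open>The principal symbol of the vector field of \<xi>, as a function on the cotangent bundle
  of affine space: \<open>Inl i\<close> indexes positions, \<open>Inr i\<close> momenta.\<close>

definition sigma :: "'g \<Rightarrow> ('n + 'n \<Rightarrow> 'k) \<Rightarrow> 'k" where
  "sigma \<xi> = (\<Sum>i\<in>UNIV. lift (a \<xi> i) * (\<lambda>u. u (Inr i)))"

text \<open>All monomial multiples are included, so that the linear span is already the symbol
  ideal.\<close>

definition Sgen :: "(('n + 'n \<Rightarrow> 'k) \<Rightarrow> 'k) set" where
  "Sgen = {lift f * mon q | f q. f \<in> zideal X} \<union> {sigma \<xi> * mon q | \<xi> q. True}"

lemma sigma_poly_fun: "sigma \<xi> \<in> poly_fun"
  unfolding sigma_def by (intro poly_fun_intros lift_poly_fun a pf_coord)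

lemma Sgen_mon: "s \<in> Sgen \<Longrightarrow> mon p * s \<in> Sgen"
proof -
  assume "s \<in> Sgen"
  then consider f q where "f \<in> zideal X" "s = lift f * mon q" | \<xi> q where "s = sigma \<xi> * mon q"
    unfolding Sgen_def by blast
  then show ?thesis
  proof cases
    case 1
    then have "mon p * s = lift f * mon (p + q)" by (simp add: mon_add ac_simps)
    then show ?thesis using 1 unfolding Sgen_def by blast
  next
    case 2
    then have "mon p * s = sigma \<xi> * mon (p + q)" by (simp add: mon_add ac_simps)
    then show ?thesis unfolding Sgen_def by blast
  qed
qed

lemma pideal_span_Sgen: "pideal (fs.span Sgen)"
  unfolding pideal_def
proof (intro conjI ballI)
  show "fs.span Sgen \<subseteq> poly_fun"
    by (intro fs.span_minimal subspace_poly_fun)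
       (auto simp: Sgen_def zideal_def intro!: poly_fun_intros lift_poly_fun mon_poly_fun sigma_poly_fun)
  show "0 \<in> fs.span Sgen" by (rule fs.span_zero)
  show "f + g \<in> fs.span Sgen" if "f \<in> fs.span Sgen" "g \<in> fs.span Sgen" for f g
    using that by (rule fs.span_add)
  fix f g :: "('n + 'n \<Rightarrow> 'k) \<Rightarrow> 'k"
  assume f: "f \<in> fs.span Sgen" and "g \<in> poly_fun"
  then have "g \<in> fs.span (range mon)" by (simp add: poly_fun_span_mon)
  then show "g * f \<in> fs.span Sgen"
  proof (induction rule: fs.span_induct_alt)
    case base
    show ?case by (simp add: fs.span_zero)
  next
    case (step c x y)
    then obtain p where p: "x = mon p" by auto
    from f have "mon p * f \<in> fs.span Sgen"
    proof (induction rule: fs.span_induct_alt)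
      case base
      show ?case by (simp add: fs.span_zero)
    next
      case (step c' x' y')
      have "mon p * (fscale c' x' + y') = fscale c' (mon p * x') + mon p * y'"
        by (simp add: fun_eq_iff fun_apply algebra_simps)
      then show ?case using step Sgen_mon by (auto intro!: fs.span_add fs.span_scale intro: fs.span_base)
    qed
    moreover have "(fscale c x + y) * f = fscale c (x * f) + y * f"
      by (simp add: fun_eq_iff fun_apply algebra_simps)
    ultimately show ?case using step p by (auto intro!: fs.span_add fs.span_scale)
  qed
qed

lemma dderiv_sigma:
  "dderiv (sigma \<xi>) z v = (\<Sum>i\<in>UNIV. a \<xi> i (\<lambda>i. z (Inl i)) * v (Inr i) +
     z (Inr i) * dderiv (a \<xi> i) (\<lambda>i. z (Inl i)) (\<lambda>i. v (Inl i)))"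
proof -
  have "dderiv (\<Sum>i\<in>A. lift (a \<xi> i) * (\<lambda>u. u (Inr i))) z v =
    (\<Sum>i\<in>A. a \<xi> i (\<lambda>i. z (Inl i)) * v (Inr i) +
     z (Inr i) * dderiv (a \<xi> i) (\<lambda>i. z (Inl i)) (\<lambda>i. v (Inl i)))" for A
  proof (induction A rule: infinite_finite_induct)
    case (insert i A)
    have m: "lift (a \<xi> i) \<in> poly_fun" "(\<lambda>u. u (Inr i)) \<in> (poly_fun :: (('n + 'n \<Rightarrow> 'k) \<Rightarrow> 'k) set)"
      "(\<Sum>i\<in>A. lift (a \<xi> i) * (\<lambda>u. u (Inr i))) \<in> poly_fun"
      by (intro poly_fun_intros lift_poly_fun a pf_coord)+
    show ?case unfolding sum.insert[OF insert.hyps] dderiv_add[OF poly_fun_intros(4)[OF m(1,2)] m(3)]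
        dderiv_mult[OF m(1,2)] insert.IH by (simp add: dderiv_lift lift_def)
  qed auto
  then show ?thesis by (simp add: sigma_def)
qed

text \<open>Otherwise a prime \<open>Q\<close> containing the symbol ideal would have a zero
  \<open>(x, p)\<close>, with \<open>x\<close> in some leaf \<open>Z\<close> whose ideal lies in \<open>Q\<close>, at which the tangent
  space of \<open>Q\<close> surjects onto \<open>k\<^sup>Y\<close>. But that tangent space projects into \<open>T\<^sub>xZ\<close> with fibres in the
  annihilator of \<open>T\<^sub>xZ\<close>, so its dimension is at most \<open>n\<close>.\<close>

lemma symbol_ideal_meets:
  assumes "card (UNIV :: 'n set) < card Y"
  shows "\<exists>s\<in>fs.span Sgen. s \<in> pfun_on Y \<and> s \<noteq> 0"
proof (rule ccontr)
  assume "\<not> ?thesis"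
  moreover have "0 \<in> fs.span Sgen" by (rule fs.span_zero)
  moreover have "0 \<in> pfun_on Y" by (rule pfo_0)
  ultimately have "fs.span Sgen \<inter> pfun_on Y = {0}" by blast
  from exists_prime_pideal[OF pideal_span_Sgen this] obtain Q
    where Q: "prime_pideal Q" "fs.span Sgen \<subseteq> Q" "Q \<inter> pfun_on Y = {0}" by blast
  interpret prime_pideal Q by (fact Q(1))
  \<comment> \<open>\<open>h\<close> is a product of equations, none in Q, one for each leaf whose
    ideal is not contained in Q. A zero of Q off \<open>h\<close> therefore lies over a leaf whose
    ideal is contained in Q.\<close>
  define Bad where "Bad = {Z \<in> \<L>. \<not> lift ` zideal Z \<subseteq> Q}"
  have "\<forall>Z\<in>Bad. \<exists>f. f \<in> zideal Z \<and> lift f \<notin> Q" by (auto simp: Bad_def)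
  then obtain f where f: "\<And>Z. Z \<in> Bad \<Longrightarrow> f Z \<in> zideal Z \<and> lift (f Z) \<notin> Q" by metis
  define h where "h = (\<Prod>Z\<in>Bad. lift (f Z))"
  have fB: "finite Bad" using fin by (simp add: Bad_def)
  have fp: "Z \<in> Bad \<Longrightarrow> lift (f Z) \<in> poly_fun" for Z using f by (auto simp: zideal_def intro: lift_poly_fun)
  have hp: "h \<in> poly_fun" unfolding h_def by (rule poly_fun_prod[OF fp])
  have hQ: "h \<notin> Q"
  proof
    assume "h \<in> Q"
    then have "\<exists>Z\<in>Bad. lift (f Z) \<in> Q" unfolding h_def by (intro prod fB fp)
    then show False using f by auto
  qed
  from generic_point[OF Q(3) hp hQ] obtain z where z: "h z \<noteq> 0" "\<And>q. q \<in> Q \<Longrightarrow> q z = 0"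
    "\<And>v0. \<exists>v. (\<forall>i\<in>Y. v i = v0 i) \<and> (\<forall>q\<in>Q. dderiv q z v = 0)" by blast
  define x where "x = (\<lambda>i. z (Inl i))"
  have lX: "lift f \<in> Q" if "f \<in> zideal X" for f
  proof -
    have "lift f * mon 0 \<in> Sgen" using that unfolding Sgen_def by blast
    then show ?thesis using Q(2) fs.span_base by (auto simp: mon_zero)
  qed
  have sQ: "sigma \<xi> \<in> Q" for \<xi>
  proof -
    have "sigma \<xi> * mon 0 \<in> Sgen" unfolding Sgen_def by blast
    then show ?thesis using Q(2) fs.span_base by (auto simp: mon_zero)
  qed
  obtain F where F: "F \<subseteq> poly_fun" "X = {x. \<forall>f\<in>F. f x = 0}" using X unfolding zclosed_def by blast
  have "x \<in> X" unfolding F(2)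
  proof safe
    fix g assume "g \<in> F"
    then have "g \<in> zideal X" using F by (auto simp: zideal_def)
    from z(2)[OF lX[OF this]] show "g x = 0" by (simp add: lift_def x_def)
  qed
  then obtain Z where Z: "Z \<in> \<L>" "x \<in> Z" using cover by blast
  have ZQ: "lift g \<in> Q" if "g \<in> zideal Z" for g
  proof (rule ccontr)
    assume "lift g \<notin> Q"
    then have ZB: "Z \<in> Bad" using that Z by (auto simp: Bad_def)
    then have "lift (f Z) z = 0" using f[OF ZB] Z(2) by (auto simp: zideal_def lift_def x_def)
    moreover have "h z = (\<Prod>Z\<in>Bad. lift (f Z) z)"
      unfolding h_def using fB by (induction Bad rule: finite_induct) (auto simp: fun_apply)
    ultimately show False using z(1) ZB fB by (metis prod_zero)
  qed
  define T where "T = {v. \<forall>q\<in>Q. dderiv q z v = 0}"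
  have "card Y \<le> card (UNIV :: 'n set)"
  proof (rule conormal_dimension[where L = "tangent_space Z x" and T = T])
    show "fs.subspace (tangent_space Z x)"
      unfolding fs.subspace_def tangent_space_def by (auto simp: dderiv_lin)
    show "fs.subspace T"
      unfolding fs.subspace_def T_def using sub by (auto simp: subset_iff dderiv_lin)
    show "u \<circ> Inl \<in> tangent_space Z x" if "u \<in> T" for u
      unfolding tangent_space_def mem_Collect_eq
    proof (intro ballI impI)
      fix g assume "g \<in> poly_fun" "\<forall>y\<in>Z. g y = 0"
      then have "lift g \<in> Q" using ZQ by (simp add: zideal_def)
      then have "dderiv (lift g) z u = 0" using that by (simp add: T_def)
      then show "dderiv g x (u \<circ> Inl) = 0" by (simp add: dderiv_lift x_def comp_def)
    qed
    show "(\<Sum>i\<in>UNIV. u (Inr i) * l i) = 0"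
      if u: "u \<in> T" "u \<circ> Inl = 0" and l: "l \<in> tangent_space Z x" for u l
    proof -
      \<comment> \<open>Tangent vectors of the leaf are values of vector fields, and the symbol of
        such a field, differentiated in a purely vertical direction \<open>u\<close>, gives the
        pairing of \<open>u\<close> with the vector.\<close>
      from l leaf[OF Z] obtain \<xi> where \<xi>: "l = (\<lambda>i. a \<xi> i x)" by auto
      have u0: "(\<lambda>i. u (Inl i)) = 0" using u(2) by (simp add: comp_def)
      have "0 = dderiv (sigma \<xi>) z u" using u(1) sQ by (simp add: T_def)
      also have "\<dots> = (\<Sum>i\<in>UNIV. u (Inr i) * l i)"
        unfolding dderiv_sigma u0 by (intro sum.cong refl) (simp add: dderiv_lin(3)[OF a] \<xi> x_def)
      finally show ?thesis by simp
    qed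
    show "\<exists>v\<in>T. \<forall>y\<in>Y. v y = v0 y" for v0 using z(3)[of v0] by (auto simp: T_def)
  qed
  then show False using assms by simp
qed

end

subsection \<open>Standard monomials\<close>

lemma prod_sum_type: "(\<Prod>i\<in>(UNIV :: ('a::finite + 'b::finite) set). f i) = (\<Prod>i\<in>UNIV. f (Inl i)) * (\<Prod>i\<in>UNIV. f (Inr i))"
  unfolding UNIV_Plus_UNIV[symmetric] by (subst prod.Plus) auto

lemma sum_sum_type: "(\<Sum>i\<in>(UNIV :: ('a::finite + 'b::finite) set). f i) = (\<Sum>i\<in>UNIV. f (Inl i)) + (\<Sum>i\<in>UNIV. f (Inr i))"
  unfolding UNIV_Plus_UNIV[symmetric] by (subst sum.Plus) auto

definition xideg :: "('n::finite + 'n \<Rightarrow> nat) \<Rightarrow> nat" where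
  "xideg q = (\<Sum>i\<in>UNIV. q (Inr i))"

lemma xideg_add: "xideg (p + q) = xideg p + xideg q"
  by (simp add: xideg_def sum.distrib fun_apply)

lemma xideg_dn_Inl [simp]: "xideg (dn (Inl i) q) = xideg q"
  by (simp add: xideg_def dn_def)

lemma lift_mon: "lift (mon m) = mon (case_sum m (\<lambda>_. 0))"
  by (rule ext) (simp add: lift_def mon_def prod_sum_type)

lemma span_mon_mult:
  assumes "f \<in> fs.span (mon ` A)" "\<And>q. q \<in> A \<Longrightarrow> q + p \<in> B"
  shows "f * mon p \<in> fs.span (mon ` B)"
  using assms(1)
proof (induction rule: fs.span_induct_alt)
  case base
  show ?case by (simp add: fs.span_zero)
next
  case (step c x y)
  then obtain q where q: "x = mon q" "q \<in> A" by blast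
  have eq: "(fscale c x + y) * mon p = fscale c (mon (q + p)) + y * mon p"
    by (simp add: q mon_add fun_eq_iff fun_apply algebra_simps)
  have "mon (q + p) \<in> fs.span (mon ` B)" using q assms(2) by (intro fs.span_base) blast
  then show ?case unfolding eq using step.IH by (intro fs.span_add fs.span_scale)
qed

lemma lift_in_span:
  fixes f :: "('n::finite \<Rightarrow> 'k::field_char_0) \<Rightarrow> 'k" and \<omega> :: "'n + 'n \<Rightarrow> nat"
  assumes "f \<in> poly_fun"
  shows "\<exists>C. lift f \<in> fs.span (mon ` {q. xideg q = 0 \<and> wt \<omega> q \<le> C})"
proof -
  have "f \<in> fs.span (range mon)" using assms by (simp add: poly_fun_span_mon)
  then show ?thesis
  proof (induction rule: fs.span_induct_alt)
    case base
    show ?case by (simp add: lift_0 fs.span_zero)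
  next
    case (step c x y)
    then obtain m C where m: "x = mon m" and C: "lift y \<in> fs.span (mon ` {q. xideg q = 0 \<and> wt \<omega> q \<le> C})" by blast
    define q :: "'n + 'n \<Rightarrow> nat" where "q = case_sum m (\<lambda>_. 0)"
    let ?C = "max C (wt \<omega> q)"
    have "lift y \<in> fs.span (mon ` {q. xideg q = 0 \<and> wt \<omega> q \<le> ?C})"
      using C fs.span_mono[OF image_mono[of "{q. xideg q = 0 \<and> wt \<omega> q \<le> C}" "{q. xideg q = 0 \<and> wt \<omega> q \<le> ?C}" mon]] by fastforce
    moreover have "mon q \<in> fs.span (mon ` {q. xideg q = 0 \<and> wt \<omega> q \<le> ?C})"
      by (intro fs.span_base imageI) (simp add: q_def xideg_def)
    moreover have eq: "lift (fscale c x + y) = fscale c (mon q) + lift y"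
      by (simp add: lift_add lift_fscale m lift_mon q_def)
    ultimately have "lift (fscale c x + y) \<in> fs.span (mon ` {q. xideg q = 0 \<and> wt \<omega> q \<le> ?C})"
      unfolding eq by (intro fs.span_add fs.span_scale)
    then show ?case by blast
  qed
qed

lemma finite_wt_le:
  assumes "\<And>i. 1 \<le> w i"
  shows "finite {q. wt w q \<le> k}"
proof (rule finite_subset)
  show "{q. wt w q \<le> k} \<subseteq> PiE UNIV (\<lambda>_. {..k})"
    using order_trans[OF le_wt[OF assms]] by (auto simp: PiE_UNIV_domain)
  show "finite (PiE UNIV (\<lambda>_::'a. {..k}))" by (intro finite_PiE) auto
qed

text \<open>The monomials that survive division, \<open>u Y\<close> being the leading exponent of a
  relation in the variables of Y.\<close>

definition standard :: "('i set \<Rightarrow> 'i \<Rightarrow> nat) \<Rightarrow> nat \<Rightarrow> ('i::finite \<Rightarrow> nat) set" where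
  "standard u n = {q. \<forall>Y. card Y = Suc n \<longrightarrow> \<not> u Y \<le> q}"

text \<open>If n + 1 exponents of \<open>q\<close> exceeded all entries of the \<open>u Y\<close>,
  the set Y of these positions would give \<open>u Y \<le> q\<close>. So all but at most n exponents
  are below the constant \<open>b\<close>, and the remaining ones are at most k.\<close>

lemma card_standard_le:
  fixes u :: "'i::finite set \<Rightarrow> 'i \<Rightarrow> nat"
  assumes w: "\<And>i. 1 \<le> w i" and u: "\<And>Y i. card Y = Suc n \<Longrightarrow> i \<notin> Y \<Longrightarrow> u Y i = 0"
  shows "\<exists>C. \<forall>k. card {q \<in> standard u n. wt w q \<le> k} \<le> C * (k + 1) ^ n"
proof -
  define b where "b = Suc (\<Sum>Y\<in>UNIV. \<Sum>i\<in>UNIV. u Y i)"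
  have b: "u Y i < b" for Y i
  proof -
    have "u Y i \<le> (\<Sum>i\<in>UNIV. u Y i)" by (rule member_le_sum) auto
    also have "\<dots> \<le> (\<Sum>Y\<in>UNIV. \<Sum>i\<in>UNIV. u Y i)" by (rule member_le_sum) auto
    finally show ?thesis by (simp add: b_def)
  qed
  define F where "F k H = PiE UNIV (\<lambda>i. if i \<in> H then {..k} else {..<b})" for k and H :: "'i set"
  define C where "C = card (UNIV :: 'i set set) * b ^ card (UNIV :: 'i set)"
  have sub: "{q \<in> standard u n. wt w q \<le> k} \<subseteq> (\<Union>H\<in>{H. card H \<le> n}. F k H)" for k
  proof
    fix q assume q: "q \<in> {q \<in> standard u n. wt w q \<le> k}"
    define H where "H = {i. b \<le> q i}"
    have "card H \<le> n"
    proof (rule ccontr)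
      assume "\<not> card H \<le> n"
      then obtain Y where Y: "Y \<subseteq> H" "card Y = Suc n"
        using obtain_subset_with_card_n[of "Suc n" H] by auto
      have "u Y \<le> q"
      proof (rule le_funI)
        fix i show "u Y i \<le> q i"
          using u[OF Y(2), of i] b[of Y i] Y(1) by (cases "i \<in> Y") (auto simp: H_def)
      qed
      then show False using q Y by (auto simp: standard_def)
    qed
    moreover have "q \<in> F k H"
      using q order_trans[OF le_wt[OF w]] by (auto simp: F_def H_def)
    ultimately show "q \<in> (\<Union>H\<in>{H. card H \<le> n}. F k H)" by blast
  qed
  have cF: "card (F k H) \<le> b ^ card (UNIV :: 'i set) * (k + 1) ^ n" if "card H \<le> n" for k H
  proof -
    have "card (F k H) = (\<Prod>i\<in>UNIV. if i \<in> H then k + 1 else b)"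
      unfolding F_def by (subst card_PiE) (auto intro!: prod.cong)
    also have "\<dots> = (k + 1) ^ card H * b ^ card (- H)"
      by (subst prod.If_cases) (auto simp: Compl_eq)
    also have "\<dots> \<le> (k + 1) ^ n * b ^ card (UNIV :: 'i set)"
      using that by (intro mult_mono power_increasing card_mono) (auto simp: b_def)
    finally show ?thesis by (simp add: mult.commute)
  qed
  have "card {q \<in> standard u n. wt w q \<le> k} \<le> C * (k + 1) ^ n" for k
  proof -
    have "card {q \<in> standard u n. wt w q \<le> k} \<le> card (\<Union>H\<in>{H. card H \<le> n}. F k H)"
      by (intro card_mono sub) (auto simp: F_def intro!: finite_PiE)
    also have "\<dots> \<le> (\<Sum>H\<in>{H. card H \<le> n}. card (F k H))" by (rule card_UN_le) simp
    also have "\<dots> \<le> (\<Sum>H\<in>{H :: 'i set. card H \<le> n}. b ^ card (UNIV :: 'i set) * (k + 1) ^ n)"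
      by (intro sum_mono cF) auto
    also have "\<dots> = card {H :: 'i set. card H \<le> n} * (b ^ card (UNIV :: 'i set) * (k + 1) ^ n)" by simp
    also have "\<dots> \<le> card (UNIV :: 'i set set) * (b ^ card (UNIV :: 'i set) * (k + 1) ^ n)"
      by (intro mult_right_mono card_mono) auto
    finally show ?thesis by (simp add: C_def algebra_simps)
  qed
  then show ?thesis by blast
qed

section \<open>Lifting symbols to operators, and division with remainder\<close>

context leafy
begin

text \<open>A polynomial in \<open>2n\<close> variables stands for the differential operator with that normally ordered
  symbol (\<open>Inr i\<close> is \<open>\<partial>\<^sub>i\<close>). \<open>Jgen\<close> spans the right ideal of the Weyl algebra
  generated by the ideal of \<open>X\<close> and the vector fields \<open>\<Sum>i. a \<xi> i \<partial>\<^sub>i\<close>: the second sum in its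
  definition comes from commuting the vector field past the coefficients of \<open>mon q\<close>.\<close>

definition Jgen :: "(('n + 'n \<Rightarrow> 'k) \<Rightarrow> 'k) set" where
  "Jgen = {lift f * mon q | f q. f \<in> zideal X} \<union>
     {sigma \<xi> * mon q + (\<Sum>i\<in>UNIV. fscale (of_nat (q (Inl i))) (lift (a \<xi> i) * mon (dn (Inl i) q))) | \<xi> q. True}"

text \<open>For \<open>s\<close> homogeneous of degree \<open>m\<close> in the momenta:
  \<open>s\<close> is a principal symbol of the right ideal, and so are its monomial multiples. The
  correction has order exactly one less, and its excess weight \<open>C\<close> is uniform in
  \<open>p\<close>, so that one extra weight per momentum can outweigh it for all
  \<open>p\<close>.\<close>

definition liftable :: "('n + 'n \<Rightarrow> nat) \<Rightarrow> nat \<Rightarrow> (('n + 'n \<Rightarrow> 'k) \<Rightarrow> 'k) \<Rightarrow> bool" where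
  "liftable \<omega> m s \<longleftrightarrow> (\<exists>C. \<forall>p. \<exists>e\<in>fs.span (mon ` {q. xideg q + 1 = m + xideg p \<and> wt \<omega> q \<le> wt \<omega> p + C}).
     s * mon p + e \<in> fs.span Jgen)"

lemma liftable_add_scale:
  assumes "liftable \<omega> m s" "liftable \<omega> m t"
  shows "liftable \<omega> m (fscale c s + t)"
proof -
  let ?V = "\<lambda>p C. fs.span (mon ` {q. xideg q + 1 = m + xideg p \<and> wt \<omega> q \<le> wt \<omega> p + C})
    :: (('n + 'n \<Rightarrow> 'k) \<Rightarrow> 'k) set"
  obtain C where C: "\<And>p. \<exists>e\<in>?V p C. s * mon p + e \<in> fs.span Jgen" using assms(1) unfolding liftable_def by blast
  obtain D where D: "\<And>p. \<exists>e\<in>?V p D. t * mon p + e \<in> fs.span Jgen" using assms(2) unfolding liftable_def by blast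
  have mono: "?V p A \<subseteq> ?V p (max C D)" if "A \<le> max C D" for p A
    using that by (intro fs.span_mono image_mono) auto
  have "\<exists>e\<in>?V p (max C D). (fscale c s + t) * mon p + e \<in> fs.span Jgen" for p
  proof -
    obtain e where e: "e \<in> ?V p C" "s * mon p + e \<in> fs.span Jgen" using C by blast
    obtain e' where e': "e' \<in> ?V p D" "t * mon p + e' \<in> fs.span Jgen" using D by blast
    have "e \<in> ?V p (max C D)" using mono[OF max.cobounded1] e(1) by (rule subsetD)
    moreover have "e' \<in> ?V p (max C D)" using mono[OF max.cobounded2] e'(1) by (rule subsetD)
    ultimately have "fscale c e + e' \<in> ?V p (max C D)" by (intro fs.span_add fs.span_scale)
    moreover have "(fscale c s + t) * mon p + (fscale c e + e') = fscale c (s * mon p + e) + (t * mon p + e')"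
      by (simp add: fun_eq_iff fun_apply algebra_simps)
    moreover have "fscale c (s * mon p + e) + (t * mon p + e') \<in> fs.span Jgen"
      by (rule fs.span_add[OF fs.span_scale[OF e(2)] e'(2)])
    ultimately show ?thesis by (intro bexI[of _ "fscale c e + e'"]) (simp_all only:)
  qed
  then show ?thesis unfolding liftable_def by blast
qed

lemma liftable_0: "liftable \<omega> m 0"
  unfolding liftable_def by (intro exI[of _ 0] allI bexI[of _ 0]) (auto intro: fs.span_zero)

lemma liftable_ideal: "f \<in> zideal X \<Longrightarrow> liftable \<omega> m (lift f * mon q)"
proof -
  assume f: "f \<in> zideal X"
  have "lift f * mon q * mon p + 0 \<in> fs.span Jgen" for p
  proof -
    have "lift f * mon q * mon p + 0 = lift f * mon (q + p)" by (simp add: mon_add mult.assoc)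
    also have "\<dots> \<in> fs.span Jgen" using f unfolding Jgen_def by (intro fs.span_base) blast
    finally show ?thesis .
  qed
  then show ?thesis unfolding liftable_def using fs.span_zero by blast
qed

lemma liftable_sigma: "liftable \<omega> (xideg q + 1) (sigma \<xi> * mon q)"
proof -
  have "\<forall>i. \<exists>C. lift (a \<xi> i) \<in> fs.span (mon ` {q. xideg q = 0 \<and> wt \<omega> q \<le> C})"
    by (intro allI lift_in_span a)
  from choice[OF this] obtain Ci
    where Ci: "lift (a \<xi> i) \<in> fs.span (mon ` {q. xideg q = 0 \<and> wt \<omega> q \<le> Ci i})" for i by blast
  define C where "C = (\<Sum>i\<in>UNIV. Ci i)"
  have CiC: "Ci i \<le> C" for i unfolding C_def by (rule member_le_sum) auto
  show ?thesis unfolding liftable_def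
  proof (intro exI[of _ "C + wt \<omega> q"] allI)
    fix p
    let ?B = "{q'. xideg q' + 1 = xideg q + 1 + xideg p \<and> wt \<omega> q' \<le> wt \<omega> p + (C + wt \<omega> q)}"
    define e where "e = (\<Sum>i\<in>UNIV. fscale (of_nat ((q + p) (Inl i))) (lift (a \<xi> i) * mon (dn (Inl i) (q + p))))"
    have "lift (a \<xi> i) * mon (dn (Inl i) (q + p)) \<in> fs.span (mon ` ?B)" for i
    proof (rule span_mon_mult[OF Ci])
      fix q' assume "q' \<in> {q. xideg q = 0 \<and> wt \<omega> q \<le> Ci i}"
      then show "q' + dn (Inl i) (q + p) \<in> ?B"
        using CiC[of i] wt_dn_le[of \<omega> "Inl i" "q + p"] by (simp add: xideg_add wt_add)
    qed
    then have "e \<in> fs.span (mon ` ?B)" unfolding e_def by (intro fs.span_sum fs.span_scale)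
    moreover have "sigma \<xi> * mon q * mon p + e = sigma \<xi> * mon (q + p) + e" by (simp add: mon_add mult.assoc)
    moreover have "sigma \<xi> * mon (q + p) + e \<in> fs.span Jgen"
      unfolding Jgen_def e_def by (intro fs.span_base) blast
    ultimately show "\<exists>e\<in>fs.span (mon ` ?B). sigma \<xi> * mon q * mon p + e \<in> fs.span Jgen"
      by (intro bexI[of _ e]) (simp_all only:)
  qed
qed

definition proj :: "nat \<Rightarrow> (('n + 'n \<Rightarrow> 'k) \<Rightarrow> 'k) \<Rightarrow> ('n + 'n \<Rightarrow> 'k) \<Rightarrow> 'k" where
  "proj m = monlin (\<lambda>q. if xideg q = m then mon q else 0)"

lemma flinear_proj: "flinear (proj m)"
  unfolding proj_def by (rule flinear_monlin)

lemma proj_homogeneous: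
  assumes "f \<in> fs.span (mon ` {q. xideg q = d})"
  shows "proj m f = (if d = m then f else 0)"
  using assms
proof (induction rule: fs.span_induct_alt)
  case base
  show ?case using flinear_0[OF flinear_proj] by simp
next
  case (step c x y)
  then obtain q where q: "x = mon q" "xideg q = d" by blast
  have "proj m x = (if d = m then x else 0)" using q by (simp add: proj_def)
  then show ?case using step.IH
    by (auto simp: flinear_add[OF flinear_proj] flinear_scale[OF flinear_proj])
qed

lemma sigma_mon_homogeneous: "sigma \<xi> * mon q \<in> fs.span (mon ` {q'. xideg q' = xideg q + 1})"
proof -
  have eq: "sigma \<xi> * mon q = (\<Sum>i\<in>UNIV. lift (a \<xi> i) * mon (up (Inr i) q))"
    unfolding sigma_def sum_distrib_right
    by (intro sum.cong) (auto simp: fun_eq_iff fun_apply mon_up)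
  have up: "xideg (up (Inr i) q) = xideg q + 1" for i
  proof -
    have "wt (case_sum (\<lambda>_. 0) (\<lambda>_. 1)) q' = xideg q'" for q' :: "'n + 'n \<Rightarrow> nat"
      by (simp add: wt_def xideg_def sum_sum_type)
    then show ?thesis using wt_up[of "case_sum (\<lambda>_. 0) (\<lambda>_. 1)" "Inr i" q] by simp
  qed
  have "lift (a \<xi> i) * mon (up (Inr i) q) \<in> fs.span (mon ` {q'. xideg q' = xideg q + 1})" for i
  proof -
    obtain C where "lift (a \<xi> i) \<in> fs.span (mon ` {q. xideg q = 0 \<and> wt (\<lambda>_. 0) q \<le> C})" using lift_in_span[OF a] by blast
    then show ?thesis by (rule span_mon_mult) (simp add: xideg_add up)
  qed
  then show ?thesis unfolding eq by (intro fs.span_sum)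
qed

text \<open>The generators are homogeneous in the momenta, so the component of degree
  \<open>m\<close> of an element is a combination of the generators of that degree, each of which
  has its own correction.\<close>

lemma liftable_proj:
  assumes "s \<in> fs.span Sgen"
  shows "liftable \<omega> m (proj m s)"
  using assms
proof (induction rule: fs.span_induct_alt)
  case base
  show ?case using flinear_0[OF flinear_proj] liftable_0 by metis
next
  case (step c x y)
  from step(1) consider f q where "f \<in> zideal X" "x = lift f * mon q" | \<xi> q where "x = sigma \<xi> * mon q"
    unfolding Sgen_def by blast
  then have "liftable \<omega> m (proj m x)"
  proof cases
    case 1
    have "f \<in> poly_fun" using 1 by (simp add: zideal_def)
    then obtain C where "lift f \<in> fs.span (mon ` {q. xideg q = 0 \<and> wt (\<lambda>_. 0) q \<le> C})" using lift_in_span by blast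
    then have "x \<in> fs.span (mon ` {q'. xideg q' = xideg q})"
      unfolding 1 by (rule span_mon_mult) (simp add: xideg_add)
    then show ?thesis using proj_homogeneous[of x "xideg q" m] liftable_ideal[OF 1(1)] liftable_0 1(2) by metis
  next
    case 2
    then have "proj m x = (if xideg q + 1 = m then x else 0)"
      using proj_homogeneous[OF sigma_mon_homogeneous] by metis
    then show ?thesis using liftable_sigma liftable_0 2 by metis
  qed
  moreover have "proj m (fscale c x + y) = fscale c (proj m x) + proj m y"
    unfolding flinear_add[OF flinear_proj] flinear_scale[OF flinear_proj] ..
  ultimately show ?case using liftable_add_scale step.IH by metis
qed

text \<open>A nonzero homogeneous relation in the variables Y. It has to lift for every weight
  \<omega>, because \<omega> is chosen only after all relations are known, so as to separate their
  exponents.\<close>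

definition elim_data :: "('n + 'n) set \<Rightarrow> ('n + 'n \<Rightarrow> nat) set \<Rightarrow> (('n + 'n \<Rightarrow> nat) \<Rightarrow> 'k) \<Rightarrow> nat \<Rightarrow> bool" where
  "elim_data Y D c m \<longleftrightarrow> finite D \<and> D \<noteq> {} \<and>
    (\<forall>q\<in>D. c q \<noteq> 0 \<and> xideg q = m \<and> (\<forall>i. i \<notin> Y \<longrightarrow> q i = 0)) \<and>
    (\<forall>\<omega>. liftable \<omega> m (\<Sum>q\<in>D. fscale (c q) (mon q)))"

lemma liftable_exists:
  assumes "card (UNIV :: 'n set) < card Y"
  shows "\<exists>D c m. elim_data Y D c m"
proof -
  obtain s where s: "s \<in> fs.span Sgen" "s \<in> pfun_on Y" "s \<noteq> 0" using symbol_ideal_meets[OF assms] by blast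
  from pfun_on_span_mon[OF s(2)] obtain t r where t: "finite t" "t \<subseteq> mon ` {m. \<forall>i. i \<notin> Y \<longrightarrow> m i = 0}"
    "s = (\<Sum>a\<in>t. fscale (r a) a)" unfolding fs.span_explicit by blast
  obtain M where M: "M \<subseteq> {m. \<forall>i. i \<notin> Y \<longrightarrow> m i = 0}" "finite M" "t = mon ` M"
    using finite_subset_image[OF t(1,2)] by blast
  have seq: "s = (\<Sum>q\<in>M. fscale (r (mon q)) (mon q))"
    unfolding t(3) M(3) by (subst sum.reindex) (auto intro: inj_on_subset[OF inj_mon])
  then obtain q0 where q0: "q0 \<in> M" "r (mon q0) \<noteq> 0"
    using s(3) by (metis (no_types, lifting) fs.scale_zero_left sum.neutral)
  define m where "m = xideg q0"
  define D where "D = {q \<in> M. xideg q = m \<and> r (mon q) \<noteq> 0}"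
  have "proj m s = (\<Sum>q\<in>M. fscale (r (mon q)) (proj m (mon q)))"
    unfolding seq flinear_sum[OF flinear_proj] flinear_scale[OF flinear_proj] ..
  also have "\<dots> = (\<Sum>q\<in>D. fscale (r (mon q)) (mon q))"
    unfolding D_def using M(2) by (intro sum.mono_neutral_cong_right) (auto simp: proj_def)
  finally have "liftable \<omega> m (\<Sum>q\<in>D. fscale (r (mon q)) (mon q))" for \<omega>
    using liftable_proj[OF s(1), of \<omega> m] by simp
  moreover have "q0 \<in> D" using q0 by (simp add: D_def m_def)
  ultimately show ?thesis using M(1,2)
    by (intro exI[of _ D] exI[of _ "\<lambda>q. r (mon q)"] exI[of _ m]) (auto simp: D_def elim_data_def)
qed

text \<open>Two kinds of terms compete with \<open>u + p\<close>. Those of the same order lose by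
  \<omega>; the corrections have order one less, which costs \<open>N\<close>, and regain at most
  \<open>C < N\<close>.\<close>

lemma reduce_leading:
  assumes D: "finite D" "u \<in> D" "\<And>q. q \<in> D \<Longrightarrow> c q \<noteq> 0 \<and> xideg q = m"
    and max: "\<And>q. q \<in> D \<Longrightarrow> q \<noteq> u \<Longrightarrow> wt \<omega> q < wt \<omega> u"
    and e: "e \<in> fs.span (mon ` {q. xideg q + 1 = m + xideg p \<and> wt \<omega> q \<le> wt \<omega> p + C})"
    and J: "(\<Sum>q\<in>D. fscale (c q) (mon q)) * mon p + e \<in> fs.span Jgen"
    and w: "\<And>q. wt w q = wt \<omega> q + N * xideg q" and N: "C < N"
  shows "\<exists>j\<in>fs.span Jgen. mon (u + p) - j \<in> fs.span (mon ` {q. wt w q < wt w (u + p)})"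
proof -
  let ?V = "fs.span (mon ` {q. wt w q < wt w (u + p)}) :: (('n + 'n \<Rightarrow> 'k) \<Rightarrow> 'k) set"
  define j where "j = (\<Sum>q\<in>D. fscale (c q) (mon q)) * mon p + e"
  have um: "xideg u = m" "c u \<noteq> 0" using D by auto
  have "wt w q < wt w (u + p)" if q: "xideg q + 1 = m + xideg p" "wt \<omega> q \<le> wt \<omega> p + C" for q
  proof -
    have "wt w (u + p) = wt \<omega> u + wt \<omega> p + N * (m + xideg p)" by (simp add: w wt_add xideg_add um algebra_simps)
    also have "\<dots> = wt \<omega> u + wt \<omega> p + N * (xideg q + 1)" by (simp only: q(1))
    finally show ?thesis using q(2) N w[of q] by simp
  qed
  then have eV: "e \<in> ?V" using e fs.span_mono[OF image_mono, of "{q. xideg q + 1 = m + xideg p \<and> wt \<omega> q \<le> wt \<omega> p + C}" "{q. wt w q < wt w (u + p)}" mon] by blast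
  have "wt w (q + p) < wt w (u + p)" if "q \<in> D - {u}" for q
    using max[of q] D(3)[of q] that by (simp add: w wt_add xideg_add um)
  then have rV: "(\<Sum>q\<in>D - {u}. fscale (c q) (mon (q + p))) \<in> ?V"
    by (intro fs.span_sum fs.span_scale fs.span_base imageI) auto
  have "j = (\<Sum>q\<in>D. fscale (c q) (mon (q + p))) + e"
    unfolding j_def sum_distrib_right by (intro arg_cong[where f = "\<lambda>x. x + e"] sum.cong)
      (auto simp: mon_add fun_eq_iff fun_apply)
  also have "\<dots> = fscale (c u) (mon (u + p)) + ((\<Sum>q\<in>D - {u}. fscale (c q) (mon (q + p))) + e)"
    using D by (subst sum.remove[of D u]) (auto simp: add.assoc)
  finally have j: "j = fscale (c u) (mon (u + p)) + ((\<Sum>q\<in>D - {u}. fscale (c q) (mon (q + p))) + e)" .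
  have "mon (u + p) - fscale (1 / c u) j = fscale (- 1 / c u) ((\<Sum>q\<in>D - {u}. fscale (c q) (mon (q + p))) + e)"
    unfolding j using um(2) by (simp add: fun_eq_iff fun_apply field_simps)
  also have "\<dots> \<in> ?V" by (intro fs.span_scale fs.span_add rV eV)
  finally show ?thesis using J fs.span_scale[of j Jgen "1 / c u"] unfolding j_def[symmetric] by blast
qed

text \<open>Division by well-founded induction on the weight. The standard monomials need only span
  modulo the right ideal, not be independent there, so no Groebner basis is required.\<close>

lemma standard_monomials:
  shows "\<exists>w C std. (\<forall>i. 1 \<le> w i) \<and>
    (\<forall>q. \<exists>j\<in>fs.span Jgen. mon q - j \<in> fs.span (mon ` {s \<in> std. wt w s \<le> wt w q})) \<and>
    (\<forall>k. card {s \<in> std. wt w s \<le> k} \<le> C * (k + 1) ^ card (UNIV :: 'n set))"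
proof -
  define n where "n = card (UNIV :: 'n set)"
  have "\<exists>D c m. card Y = Suc n \<longrightarrow> elim_data Y D c m" for Y
    using liftable_exists[of Y] unfolding n_def[symmetric] by (cases "card Y = Suc n") auto
  then obtain D c m where D: "\<And>Y. card Y = Suc n \<Longrightarrow> elim_data Y (D Y) (c Y) (m Y)" by metis
  note D = D[unfolded elim_data_def]
  have "finite (\<Union>Y\<in>{Y. card Y = Suc n}. D Y)" using D by auto
  \<comment> \<open>Injectivity on the exponents of all relations gives each relation a unique
    heaviest exponent, its leading one.\<close>
  from separating_weight[OF this] obtain \<omega> where \<omega>: "\<And>i. 1 \<le> \<omega> i" "inj_on (wt \<omega>) (\<Union>Y\<in>{Y. card Y = Suc n}. D Y)" by blast
  have "\<forall>Y. \<exists>u. card Y = Suc n \<longrightarrow> u \<in> D Y \<and> (\<forall>q\<in>D Y. wt \<omega> q \<le> wt \<omega> u)"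
  proof
    fix Y
    show "\<exists>u. card Y = Suc n \<longrightarrow> u \<in> D Y \<and> (\<forall>q\<in>D Y. wt \<omega> q \<le> wt \<omega> u)"
    proof (cases "card Y = Suc n")
      case True
      have "Max (wt \<omega> ` D Y) \<in> wt \<omega> ` D Y" using D[OF True] by (intro Max_in) auto
      then obtain u where "u \<in> D Y" "wt \<omega> u = Max (wt \<omega> ` D Y)" by auto
      then show ?thesis using D[OF True] by (intro exI[of _ u]) auto
    qed auto
  qed
  then obtain u where u: "\<And>Y. card Y = Suc n \<Longrightarrow> u Y \<in> D Y" "\<And>Y q. card Y = Suc n \<Longrightarrow> q \<in> D Y \<Longrightarrow> wt \<omega> q \<le> wt \<omega> (u Y)"
    by metis
  have umax: "wt \<omega> q < wt \<omega> (u Y)" if "card Y = Suc n" "q \<in> D Y" "q \<noteq> u Y" for Y q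
    using u(2)[OF that(1,2)] inj_onD[OF \<omega>(2), of q "u Y"] that u(1)[OF that(1)] by fastforce
  define reducible where "reducible Y C \<longleftrightarrow> (\<forall>p. \<exists>e\<in>fs.span (mon ` {q. xideg q + 1 = m Y + xideg p \<and> wt \<omega> q \<le> wt \<omega> p + C}).
     (\<Sum>q\<in>D Y. fscale (c Y q) (mon q)) * mon p + e \<in> fs.span Jgen)" for Y C
  have "\<exists>C. card Y = Suc n \<longrightarrow> reducible Y C" for Y
  proof (cases "card Y = Suc n")
    case True
    then have "liftable \<omega> (m Y) (\<Sum>q\<in>D Y. fscale (c Y q) (mon q))" using D by blast
    then show ?thesis unfolding liftable_def reducible_def by blast
  qed auto
  then obtain C where C: "\<And>Y. card Y = Suc n \<Longrightarrow> reducible Y (C Y)" by metis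
  define N where "N = Suc (\<Sum>Y\<in>UNIV. C Y)"
  have CN: "C Y < N" for Y using member_le_sum[of Y UNIV C] by (simp add: N_def)
  define w where "w = case_sum (\<lambda>i. \<omega> (Inl i)) (\<lambda>i. \<omega> (Inr i) + N)"
  have w1: "1 \<le> w i" for i using \<omega>(1) by (cases i) (auto simp: w_def intro: trans_le_add1)
  have w: "wt w q = wt \<omega> q + N * xideg q" for q
    by (simp add: wt_def w_def sum_sum_type xideg_def algebra_simps sum.distrib sum_distrib_left)
  define std where "std = standard u n"
  have red: "\<exists>j\<in>fs.span Jgen. mon (u Y + p) - j \<in> fs.span (mon ` {q. wt w q < wt w (u Y + p)})"
    if Y: "card Y = Suc n" for Y p
  proof -
    from C[OF Y] obtain e where e: "e \<in> fs.span (mon ` {q. xideg q + 1 = m Y + xideg p \<and> wt \<omega> q \<le> wt \<omega> p + C Y})"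
      "(\<Sum>q\<in>D Y. fscale (c Y q) (mon q)) * mon p + e \<in> fs.span Jgen" unfolding reducible_def by blast
    show ?thesis
      by (rule reduce_leading[OF _ _ _ _ e w CN]) (use D[OF Y] u(1)[OF Y] umax[OF Y] in auto)
  qed
  define G where "G k = {f. \<exists>j\<in>fs.span Jgen. f - j \<in> fs.span (mon ` {s \<in> std. wt w s \<le> k})}" for k
  have Gsub: "fs.subspace (G k)" for k
    unfolding fs.subspace_def
  proof (intro conjI ballI allI)
    show "0 \<in> G k" unfolding G_def using fs.span_zero by (auto intro!: bexI[of _ 0] simp: fs.span_zero)
    fix f assume "f \<in> G k"
    then obtain j where j: "j \<in> fs.span Jgen" "f - j \<in> fs.span (mon ` {s \<in> std. wt w s \<le> k})" by (auto simp: G_def)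
    show "fscale r f \<in> G k" for r
    proof -
      have "fscale r f - fscale r j \<in> fs.span (mon ` {s \<in> std. wt w s \<le> k})"
        using fs.span_scale[OF j(2), of r] by (simp only: fs.scale_right_diff_distrib)
      then show ?thesis unfolding G_def using fs.span_scale[OF j(1)] by blast
    qed
    show "f + g \<in> G k" if "g \<in> G k" for g
    proof -
      obtain j' where j': "j' \<in> fs.span Jgen" "g - j' \<in> fs.span (mon ` {s \<in> std. wt w s \<le> k})" using \<open>g \<in> G k\<close> by (auto simp: G_def)
      have "(f + g) - (j + j') = (f - j) + (g - j')" by simp
      then show ?thesis unfolding G_def using fs.span_add[OF j(1) j'(1)] fs.span_add[OF j(2) j'(2)]
        by (intro CollectI bexI[of _ "j + j'"]) (simp_all only:)
    qed
  qed
  have Gmono: "G k \<subseteq> G k'" if "k \<le> k'" for k k'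
  proof -
    have "fs.span (mon ` {s \<in> std. wt w s \<le> k}) \<subseteq> fs.span (mon ` {s \<in> std. wt w s \<le> k'})"
      using that by (intro fs.span_mono image_mono) auto
    then show ?thesis unfolding G_def by blast
  qed
  have JG: "j \<in> G k" if "j \<in> fs.span Jgen" for j k
    unfolding G_def using that fs.span_zero by (auto intro!: bexI[of _ j] simp: fs.span_zero)
  have "mon q \<in> G (wt w q)" for q
  proof (induction "wt w q" arbitrary: q rule: less_induct)
    case less
    show ?case
    proof (cases "q \<in> std")
      case True
      then have "mon q - 0 \<in> fs.span (mon ` {s \<in> std. wt w s \<le> wt w q})" by (auto intro!: fs.span_base)
      then show ?thesis unfolding G_def using fs.span_zero by blast
    next
      case False
      then obtain Y where Y: "card Y = Suc n" "u Y \<le> q" by (auto simp: std_def standard_def)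
      define p where "p = q - u Y"
      have qp: "q = u Y + p" using Y(2) by (auto simp: p_def fun_eq_iff le_fun_def fun_apply)
      from red[OF Y(1), of p, folded qp] obtain j where j: "j \<in> fs.span Jgen"
        "mon q - j \<in> fs.span (mon ` {q'. wt w q' < wt w q})" by blast
      have "mon ` {q'. wt w q' < wt w q} \<subseteq> G (wt w q)"
        using less Gmono[OF less_imp_le] by blast
      then have "fs.span (mon ` {q'. wt w q' < wt w q}) \<subseteq> G (wt w q)"
        by (intro fs.span_minimal Gsub)
      then have "(mon q - j) + j \<in> G (wt w q)"
        using j(2) by (intro fs.subspace_add[OF Gsub] JG[OF j(1)]) (rule subsetD)
      then show ?thesis by simp
    qed
  qed
  then have "\<exists>j\<in>fs.span Jgen. mon q - j \<in> fs.span (mon ` {s \<in> std. wt w s \<le> wt w q})" for q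
    by (auto simp: G_def)
  moreover have "\<exists>C. \<forall>k. card {s \<in> std. wt w s \<le> k} \<le> C * (k + 1) ^ n"
    unfolding std_def by (rule card_standard_le[OF w1]) (use D u in blast)
  ultimately show ?thesis using w1 unfolding n_def by blast
qed

end

subsection \<open>The Weyl algebra action\<close>

text \<open>The falling factorial n (n-1) ... (n-b+1), the factor produced by the b-th derivative of
  x^n.\<close>

definition fall :: "nat \<Rightarrow> nat \<Rightarrow> nat" where
  "fall n b = (n choose b) * fact b"

lemma fall_0 [simp]: "fall n 0 = 1" by (simp add: fall_def)

lemma fall_Suc_left: "fall (Suc n) b = fall n b + b * fall n (b - 1)"
  by (cases b) (auto simp: fall_def algebra_simps)

lemma fall_Suc: "fall n (Suc b) = n * fall (n - 1) b"
proof (cases n)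
  case (Suc m)
  have "Suc m * (m choose b) = Suc b * (Suc m choose Suc b)" using Suc_times_binomial_eq[of m b] by (simp only: mult.commute)
  then have "(Suc m choose Suc b) * (Suc b * fact b) = Suc m * (m choose b) * fact b"
    by (metis mult.assoc mult.commute)
  moreover have "fall n (Suc b) = (Suc m choose Suc b) * (Suc b * fact b)"
    by (simp only: fall_def Suc fact_Suc of_nat_id)
  ultimately show ?thesis by (simp only: fall_def Suc diff_Suc_1 mult.assoc)
qed (simp add: fall_def)

lemma fall_eq_0: "n < b \<Longrightarrow> fall n b = 0"
  by (simp add: fall_def binomial_eq_0)

lemma fall_Suc_right: "fall n (Suc b) = (n - b) * fall n b"
proof (induction b arbitrary: n)
  case 0
  show ?case by (simp add: fall_Suc)
next
  case (Suc b)
  show ?case using Suc[of "n - 1"] unfolding fall_Suc[of n "Suc b"] fall_Suc[of n b]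
    by (simp add: algebra_simps)
qed

definition size_exp :: "('i::finite \<Rightarrow> nat) \<Rightarrow> nat" where
  "size_exp q = (\<Sum>i\<in>UNIV. q i)"

lemma size_exp_wt: "size_exp q = wt (\<lambda>_. 1) q"
  by (simp add: size_exp_def wt_def)

lemma size_exp_up: "size_exp (up i q) = Suc (size_exp q)"
  by (simp add: size_exp_wt wt_up)

lemma size_exp_eq_0: "size_exp q = 0 \<longleftrightarrow> q = 0"
  by (auto simp: size_exp_def fun_eq_iff fun_apply)

definition falls :: "('n::finite \<Rightarrow> nat) \<Rightarrow> ('n + 'n \<Rightarrow> nat) \<Rightarrow> nat" where
  "falls e q = (\<Prod>i\<in>UNIV. fall (e i) (q (Inr i)))"

definition shift :: "('n \<Rightarrow> nat) \<Rightarrow> ('n + 'n \<Rightarrow> nat) \<Rightarrow> 'n \<Rightarrow> nat" where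
  "shift e q = (\<lambda>i. e i - q (Inr i) + q (Inl i))"

text \<open>\<open>act q \<psi>\<close> is the right action of the normally ordered monomial \<open>q\<close> on a family \<open>\<psi> (d, \<cdot>)\<close> of linear
  functionals on polynomials, where \<open>\<psi> (d, e)\<close> is the value of the \<open>d\<close>-th functional on \<open>mon e\<close>; the
  operator \<open>mon q\<close> maps \<open>mon e\<close> to \<open>falls e q\<close> times \<open>mon (shift e q)\<close> (and \<open>falls e q = 0\<close> whenever the
  subtraction in \<open>shift\<close> truncates).\<close>

definition act :: "('n::finite + 'n \<Rightarrow> nat) \<Rightarrow> (nat \<times> ('n \<Rightarrow> nat) \<Rightarrow> 'k::field) \<Rightarrow> nat \<times> ('n \<Rightarrow> nat) \<Rightarrow> 'k" where
  "act q \<psi> = (\<lambda>(d, e). of_nat (falls e q) * \<psi> (d, shift e q))"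

text \<open>\<open>Xop i\<close> and \<open>Dop i\<close> precompose each functional with
  multiplication by x_i and with \<partial>_i; \<open>Top\<close> is the additional central
  variable, acting on the d-th functional as d.\<close>

definition Xop :: "'n \<Rightarrow> (nat \<times> ('n \<Rightarrow> nat) \<Rightarrow> 'k::field) \<Rightarrow> nat \<times> ('n \<Rightarrow> nat) \<Rightarrow> 'k" where
  "Xop i \<psi> = (\<lambda>(d, e). \<psi> (d, up i e))"

definition Dop :: "'n \<Rightarrow> (nat \<times> ('n \<Rightarrow> nat) \<Rightarrow> 'k::field) \<Rightarrow> nat \<times> ('n \<Rightarrow> nat) \<Rightarrow> 'k" where
  "Dop i \<psi> = (\<lambda>(d, e). of_nat (e i) * \<psi> (d, dn i e))"

definition Top :: "(nat \<times> ('n \<Rightarrow> nat) \<Rightarrow> 'k::field) \<Rightarrow> nat \<times> ('n \<Rightarrow> nat) \<Rightarrow> 'k" where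
  "Top \<psi> = (\<lambda>(d, e). of_nat d * \<psi> (d, e))"

lemma flinear_ops: "flinear (act q)" "flinear (Xop i)" "flinear (Dop i)" "flinear Top"
  unfolding Vector_Spaces.linear_iff
  by (auto simp: fs.vector_space_axioms act_def Xop_def Dop_def Top_def fun_eq_iff fun_apply algebra_simps)

lemma falls_split: "falls e q = fall (e i) (q (Inr i)) * (\<Prod>j\<in>UNIV - {i}. fall (e j) (q (Inr j)))"
  unfolding falls_def by (rule prod.remove) auto

lemma falls_upd:
  assumes "\<And>j. j \<noteq> i \<Longrightarrow> e' j = e j" "\<And>j. j \<noteq> i \<Longrightarrow> q' (Inr j) = q (Inr j)"
  shows "falls e' q' = fall (e' i) (q' (Inr i)) * (\<Prod>j\<in>UNIV - {i}. fall (e j) (q (Inr j)))"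
  unfolding falls_split[of e' q' i] using assms by (intro arg_cong2[where f = "(*)"] prod.cong) auto

text \<open>In a right action the leftmost factor meets \<psi> first. In a normally ordered product
  this is x_i, whereas \<partial>_i can be put at the right end and acts last, as in
  \<open>act_up_Inr\<close>.\<close>

lemma act_up_Inl: "act (up (Inl i) q) \<psi> = act q (Xop i \<psi>)"
proof -
  have "falls e (up (Inl i) q) = falls e q" for e by (simp add: falls_def up_def)
  moreover have "shift e (up (Inl i) q) = up i (shift e q)" for e
    by (auto simp: shift_def up_def fun_eq_iff)
  ultimately show ?thesis by (simp add: act_def Xop_def)
qed

lemma act_up_Inr: "act (up (Inr i) q) \<psi> = Dop i (act q \<psi>)"
proof -
  have "falls e (up (Inr i) q) = e i * falls (dn i e) q" for e
  proof -
    define P where "P = (\<Prod>j\<in>UNIV - {i}. fall (e j) (q (Inr j)))"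
    have "falls e (up (Inr i) q) = fall (e i) (Suc (q (Inr i))) * P"
      unfolding P_def by (subst falls_upd[of i _ e _ q]) (auto simp: up_def)
    moreover have "falls (dn i e) q = fall (e i - 1) (q (Inr i)) * P"
      unfolding P_def by (subst falls_upd[of i _ e _ q]) (auto simp: dn_def)
    ultimately show ?thesis by (simp add: fall_Suc)
  qed
  moreover have "shift e (up (Inr i) q) = shift (dn i e) q" for e
    by (auto simp: shift_def up_def dn_def fun_eq_iff)
  ultimately show ?thesis by (simp add: act_def Dop_def mult.assoc)
qed

lemma act_0 [simp]: "act 0 \<psi> = \<psi>"
  by (auto simp: act_def falls_def shift_def fun_eq_iff fun_apply)

text \<open>The relation \<partial>^b x = x \<partial>^b + b \<partial>^(b-1). The subtraction in
  \<open>shift\<close> is faithful only for b at most \<open>e i\<close>; at b = \<open>e i\<close>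
  + 1 the operator kills x^e but not its product with x_i, so this case is separate.\<close>

lemma Xop_act: "Xop i (act q \<psi>) = act q (Xop i \<psi>) + fscale (of_nat (q (Inr i))) (act (dn (Inr i) q) \<psi>)"
proof (rule ext, clarify)
  fix d e
  define P where "P = (\<Prod>j\<in>UNIV - {i}. fall (e j) (q (Inr j)))"
  define b where "b = q (Inr i)"
  have f1: "falls (up i e) q = fall (Suc (e i)) b * P"
    unfolding P_def b_def by (subst falls_upd[of i _ e _ q]) (auto simp: up_def)
  have f2: "falls e q = fall (e i) b * P"
    unfolding P_def b_def by (rule falls_split)
  have f3: "falls e (dn (Inr i) q) = fall (e i) (b - 1) * P"
    unfolding P_def b_def by (subst falls_upd[of i _ e _ q]) (auto simp: dn_def)
  show "Xop i (act q \<psi>) (d, e) = (act q (Xop i \<psi>) + fscale (of_nat (q (Inr i))) (act (dn (Inr i) q) \<psi>)) (d, e)"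
  proof (cases "b \<le> e i")
    case True
    have s: "shift (up i e) q = up i (shift e q)"
      using True by (auto simp: shift_def up_def fun_eq_iff b_def)
    have s': "shift e (dn (Inr i) q) = up i (shift e q)" if "0 < b"
      using True that by (auto simp: shift_def up_def dn_def fun_eq_iff b_def)
    show ?thesis
    proof (cases "b = 0")
      case True
      then show ?thesis by (simp add: act_def Xop_def fun_apply f1 f2 s b_def[symmetric])
    next
      case False
      then show ?thesis using s'
        by (simp add: act_def Xop_def fun_apply f1 f2 f3 s b_def[symmetric] fall_Suc_left algebra_simps)
    qed
  next
    case False
    show ?thesis
    proof (cases "b = Suc (e i)")
      case True
      have s: "shift e (dn (Inr i) q) = shift (up i e) q"
        using True by (auto simp: shift_def up_def dn_def fun_eq_iff b_def)
      show ?thesis using True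
        by (simp add: act_def Xop_def fun_apply f1 f2 f3 s b_def[symmetric] fall_Suc_left fall_eq_0 algebra_simps)
    next
      case False
      then have "Suc (e i) < b" "e i < b - 1" using \<open>\<not> b \<le> e i\<close> by auto
      then show ?thesis
        by (simp add: act_def Xop_def fun_apply f1 f2 f3 fall_eq_0)
    qed
  qed
qed

text \<open>The relation \<partial> x^a = x^a \<partial> + a x^(a-1), read in the right
  action.\<close>

lemma act_Dop: "act q (Dop i \<psi>) = Dop i (act q \<psi>) + fscale (of_nat (q (Inl i))) (act (dn (Inl i) q) \<psi>)"
proof (rule ext, clarify)
  fix d e
  define P where "P = (\<Prod>j\<in>UNIV - {i}. fall (e j) (q (Inr j)))"
  define b where "b = q (Inr i)"
  define a where "a = q (Inl i)"
  have f1: "e i * falls (dn i e) q = fall (e i) (Suc b) * P"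
    unfolding P_def b_def by (subst falls_upd[of i _ e _ q]) (auto simp: dn_def fall_Suc)
  have f2: "falls e q = fall (e i) b * P"
    unfolding P_def b_def by (rule falls_split)
  have f3: "falls e (dn (Inl i) q) = fall (e i) b * P"
    unfolding P_def b_def by (subst falls_upd[of i _ e _ q]) (auto simp: dn_def)
  have Dact: "Dop i (act q \<psi>) (d, e) = of_nat (fall (e i) (Suc b) * P) * \<psi> (d, shift (dn i e) q)"
    unfolding f1[symmetric] by (simp add: Dop_def act_def)
  define r where "r = e i - b"
  have sh: "shift e q i = r + a" by (simp add: shift_def a_def b_def r_def)
  show "act q (Dop i \<psi>) (d, e) = (Dop i (act q \<psi>) + fscale (of_nat (q (Inl i))) (act (dn (Inl i) q) \<psi>)) (d, e)"
  proof (cases "b \<le> e i")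
    case True
    have s1: "shift (dn i e) q = dn i (shift e q)" if "b < e i"
      using that by (auto simp: shift_def dn_def fun_eq_iff b_def)
    have s2: "shift e (dn (Inl i) q) = dn i (shift e q)" if "0 < a"
      using that by (auto simp: shift_def dn_def fun_eq_iff a_def)
    have 1: "of_nat (fall (e i) (Suc b) * P) * \<psi> (d, shift (dn i e) q) =
      of_nat (r * fall (e i) b * P) * \<psi> (d, dn i (shift e q))"
      using s1 True by (cases "b < e i") (auto simp: fall_Suc_right r_def)
    have 2: "of_nat a * (of_nat (falls e (dn (Inl i) q)) * \<psi> (d, shift e (dn (Inl i) q))) =
      of_nat (a * fall (e i) b * P) * \<psi> (d, dn i (shift e q))"
      using s2 by (cases "0 < a") (auto simp: f3)
    have "act q (Dop i \<psi>) (d, e) = of_nat ((r + a) * fall (e i) b * P) * \<psi> (d, dn i (shift e q))"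
      by (simp add: act_def Dop_def f2 sh algebra_simps)
    also have "\<dots> = of_nat (fall (e i) (Suc b) * P) * \<psi> (d, shift (dn i e) q) +
       of_nat a * (of_nat (falls e (dn (Inl i) q)) * \<psi> (d, shift e (dn (Inl i) q)))"
      unfolding 1 2 by (simp add: algebra_simps)
    finally show ?thesis unfolding plus_fun_apply Dact by (simp add: fun_apply act_def a_def)
  next
    case False
    then show ?thesis unfolding plus_fun_apply Dact by (simp add: fun_apply act_def f2 f3 fall_eq_0)
  qed
qed

lemma size_shift:
  assumes "falls e q \<noteq> 0"
  shows "int (size_exp (shift e q)) = int (size_exp e) + (int (\<Sum>i\<in>UNIV. q (Inl i)) - int (\<Sum>i\<in>UNIV. q (Inr i)))"
proof -
  have "q (Inr i) \<le> e i" for i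
  proof (rule ccontr)
    assume "\<not> q (Inr i) \<le> e i"
    then have "falls e q = 0" unfolding falls_split[of e q i] by (simp add: fall_eq_0)
    then show False using assms by simp
  qed
  then have "int (shift e q i) = int (e i) + (int (q (Inl i)) - int (q (Inr i)))" for i
    unfolding shift_def by (simp only: of_nat_add of_nat_diff)
  then show ?thesis by (simp add: size_exp_def sum.distrib sum_subtractf)
qed

lemma independent_family:
  assumes "finite A" "inj_on g A" "fs.independent (g ` A)" "(\<Sum>a\<in>A. fscale (c a) (g a)) = 0" "a \<in> A"
  shows "c a = 0"
proof -
  have "(\<Sum>v\<in>g ` A. fscale (c (the_inv_into A g v)) v) = (\<Sum>a\<in>A. fscale (c a) (g a))"
    using assms(2) by (subst sum.reindex) (auto simp: the_inv_into_f_f intro!: sum.cong)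
  then have "c (the_inv_into A g (g a)) = 0"
    using assms by (intro fs.independentD[OF assms(3), of "g ` A"]) auto
  then show ?thesis using assms by (simp add: the_inv_into_f_f)
qed

text \<open>Functions on \<open>unit\<close> stand for scalars, so that functionals are linear maps
  between function spaces like all others here.\<close>

lemma separating_functional:
  fixes v :: "'a \<Rightarrow> 'k::field"
  assumes "v \<notin> fs.span S"
  shows "\<exists>\<Lambda> :: ('a \<Rightarrow> 'k) \<Rightarrow> unit \<Rightarrow> 'k. flinear \<Lambda> \<and> (\<forall>s\<in>fs.span S. \<Lambda> s = 0) \<and> \<Lambda> v = 1"
proof -
  obtain B where B: "B \<subseteq> S" "fs.independent B" "S \<subseteq> fs.span B"
    using fs.maximal_independent_subset by blast
  have sp: "fs.span S \<subseteq> fs.span B" using B(3) by (intro fs.span_minimal) auto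
  have vB: "v \<notin> fs.span B" using assms fs.span_mono[OF B(1)] by blast
  then have ind: "fs.independent (insert v B)" by (rule fs.independent_insertI[OF _ B(2)])
  define \<Lambda> where "\<Lambda> = (fp.construct (insert v B) (\<lambda>u. if u = v then 1 else 0) :: _ \<Rightarrow> unit \<Rightarrow> 'k)"
  have lin: "flinear \<Lambda>" unfolding \<Lambda>_def by (rule fp.linear_construct[OF ind])
  have "\<Lambda> s = 0" if "s \<in> fs.span S" for s
  proof -
    have "s \<in> fs.span B" using sp that by blast
    then show ?thesis
    proof (induction rule: fs.span_induct_alt)
      case base
      show ?case by (rule flinear_0[OF lin])
    next
      case (step c x y)
      then have "x \<noteq> v" using vB fs.span_base by blast
      then have "\<Lambda> x = 0" unfolding \<Lambda>_def using step(1) by (subst fp.construct_basis[OF ind]) auto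
      then show ?case using step.IH by (simp add: flinear_add[OF lin] flinear_scale[OF lin])
    qed
  qed
  moreover have "\<Lambda> v = 1" unfolding \<Lambda>_def by (subst fp.construct_basis[OF ind]) auto
  ultimately show ?thesis using lin by blast
qed

text \<open>Both factors are at most C (\<gamma> (k+1))^n, so their product is at most a constant
  times (k+1)^(2n); \<open>k\<close> is taken to be that constant.\<close>

lemma growth_contradiction: "\<exists>k::nat. (C * (\<alpha> * k + 1) ^ n) * (C * (\<beta> * k + 1) ^ n) < (k + 1) ^ (2 * n + 1)"
proof -
  define \<gamma> where "\<gamma> = \<alpha> + \<beta> + 1"
  define k where "k = C * C * \<gamma> ^ (2 * n)"
  have "(\<alpha> * k + 1) ^ n \<le> (\<gamma> * (k + 1)) ^ n" "(\<beta> * k + 1) ^ n \<le> (\<gamma> * (k + 1)) ^ n"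
    by (auto intro!: power_mono simp: \<gamma>_def algebra_simps)
  then have "(C * (\<alpha> * k + 1) ^ n) * (C * (\<beta> * k + 1) ^ n) \<le> (C * (\<gamma> * (k + 1)) ^ n) * (C * (\<gamma> * (k + 1)) ^ n)"
    by (intro mult_mono) auto
  also have "(C * (\<gamma> * K) ^ n) * (C * (\<gamma> * K) ^ n) = (C * C * \<gamma> ^ (2 * n)) * K ^ (2 * n)" for K
    unfolding mult_2 power_add by (simp only: power_mult_distrib mult_ac)
  also have "(C * C * \<gamma> ^ (2 * n)) * (k + 1) ^ (2 * n) = k * (k + 1) ^ (2 * n)" by (simp only: k_def)
  also have "\<dots> < (k + 1) ^ (2 * n + 1)" by simp
  finally show ?thesis by blast
qed

subsection \<open>Holonomicity forces finitely many critical degrees\<close>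

text \<open>The result of applying the operator with normally ordered symbol P to the monomial
  x^e.\<close>

definition pairing :: "('n::finite \<Rightarrow> nat) \<Rightarrow> (('n + 'n \<Rightarrow> 'k) \<Rightarrow> 'k) \<Rightarrow> ('n \<Rightarrow> 'k::field_char_0) \<Rightarrow> 'k" where
  "pairing e = monlin (\<lambda>q. fscale (of_nat (falls e q)) (mon (shift e q)))"

lemma flinear_pairing: "flinear (pairing e)"
  unfolding pairing_def by (rule flinear_monlin)

lemma pairing_mon: "pairing e (mon q) = fscale (of_nat (falls e q)) (mon (shift e q))"
  by (simp add: pairing_def)

definition deg_less :: "nat \<Rightarrow> (('n::finite \<Rightarrow> 'k::field) \<Rightarrow> 'k) set" where
  "deg_less d = fs.span (mon ` {e. size_exp e < d})"

lemma pairing_lift: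
  fixes f :: "('n::finite \<Rightarrow> 'k::field_char_0) \<Rightarrow> 'k"
  assumes "f \<in> poly_fun"
  shows "pairing e (lift f * mon q) = f * pairing e (mon q)"
proof -
  have "f \<in> fs.span (range mon)" using assms by (simp add: poly_fun_span_mon)
  then show ?thesis
  proof (induction rule: fs.span_induct_alt)
    case base
    show ?case using flinear_0[OF flinear_pairing] by (simp add: lift_0)
  next
    case (step c x y)
    then obtain m where m: "x = mon m" by blast
    define m' where "m' = case_sum m (\<lambda>_. 0 :: nat) + q"
    have "lift x * mon q = mon m'" by (simp add: m lift_mon mon_add m'_def)
    moreover have "falls e m' = falls e q" by (simp add: falls_def m'_def fun_apply)
    moreover have "shift e m' = m + shift e q" by (auto simp: shift_def m'_def fun_eq_iff fun_apply)
    ultimately have "pairing e (lift x * mon q) = fscale (of_nat (falls e q)) (mon m * mon (shift e q))"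
      by (simp add: pairing_mon mon_add)
    then have x: "pairing e (lift x * mon q) = x * pairing e (mon q)"
      unfolding pairing_mon m by (auto simp: fun_eq_iff fun_apply)
    have "lift (fscale c x + y) * mon q = fscale c (lift x * mon q) + lift y * mon q"
      by (simp add: lift_add lift_fscale fun_eq_iff fun_apply algebra_simps)
    then have "pairing e (lift (fscale c x + y) * mon q) = fscale c (x * pairing e (mon q)) + y * pairing e (mon q)"
      by (simp only: flinear_add[OF flinear_pairing] flinear_scale[OF flinear_pairing] x step.IH)
    also have "\<dots> = (fscale c x + y) * pairing e (mon q)" by (simp add: fun_eq_iff fun_apply algebra_simps)
    finally show ?case .
  qed
qed

text \<open>The left side is the normally ordered form of \<partial>_i times \<open>mon q\<close>,
  applied to x^e; the right side is \<partial>_i of the image of x^e under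
  \<open>mon q\<close>.\<close>

lemma pairing_leibniz:
  "pairing e (mon (up (Inr i) q)) + fscale (of_nat (q (Inl i))) (pairing e (mon (dn (Inl i) q))) =
   fscale (of_nat (falls e q) * of_nat (shift e q i)) (mon (dn i (shift e q)) :: ('n::finite \<Rightarrow> 'k::field_char_0) \<Rightarrow> 'k)"
proof -
  define P where "P = (\<Prod>j\<in>UNIV - {i}. fall (e j) (q (Inr j)))"
  define b where "b = q (Inr i)"
  define a where "a = q (Inl i)"
  define r where "r = e i - b"
  have f1: "falls e (up (Inr i) q) = r * fall (e i) b * P"
    unfolding P_def b_def r_def fall_Suc_right[symmetric] by (subst falls_upd[of i _ e _ q]) (auto simp: up_def)
  have f2: "falls e q = fall (e i) b * P"
    unfolding P_def b_def by (rule falls_split)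
  have f3: "falls e (dn (Inl i) q) = fall (e i) b * P"
    unfolding P_def b_def by (subst falls_upd[of i _ e _ q]) (auto simp: dn_def)
  have sh: "shift e q i = r + a" by (simp add: shift_def a_def b_def r_def)
  have s1: "shift e (up (Inr i) q) = dn i (shift e q)" if "0 < r"
    using that by (auto simp: shift_def dn_def up_def fun_eq_iff b_def r_def)
  have s2: "shift e (dn (Inl i) q) = dn i (shift e q)" if "0 < a"
    using that by (auto simp: shift_def dn_def fun_eq_iff a_def)
  let ?m = "mon (dn i (shift e q)) :: ('n \<Rightarrow> 'k) \<Rightarrow> 'k"
  have 1: "pairing e (mon (up (Inr i) q)) = fscale (of_nat r * of_nat (falls e q)) ?m"
    unfolding pairing_mon f1 f2 by (cases "0 < r") (simp_all add: s1 mult.assoc)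
  have 2: "fscale (of_nat a) (pairing e (mon (dn (Inl i) q))) = fscale (of_nat a * of_nat (falls e q)) ?m"
    unfolding pairing_mon f2 f3 by (cases "0 < a") (simp_all add: s2)
  show ?thesis unfolding a_def[symmetric] 1 2 sh by (simp add: fun_eq_iff fun_apply algebra_simps)
qed

text \<open>\<open>K\<close> will be the space of polynomials whose classes vanish in the
  coinvariants; \<open>field_K\<close> puts the image of x^m under each vector field into
  it.\<close>

locale leafy_coinvariants = leafy X a \<L>
  for X :: "('n::finite \<Rightarrow> 'k::{alg_closed_field, field_char_0}) set"
    and a :: "'g \<Rightarrow> 'n \<Rightarrow> ('n \<Rightarrow> 'k) \<Rightarrow> 'k" and \<L> +
  fixes K :: "(('n \<Rightarrow> 'k) \<Rightarrow> 'k) set"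
  assumes K: "fs.subspace K" and zideal_K: "zideal X \<subseteq> K"
    and field_K: "(\<Sum>i\<in>UNIV. fscale (of_nat (m i)) (a \<xi> i * mon (dn i m))) \<in> K"
begin

text \<open>The operators in \<open>Jgen\<close> have a function of the ideal of X or a vector field
  as leftmost factor, so their values lie in that ideal or are values of a vector field.\<close>

lemma pairing_J:
  assumes "P \<in> fs.span Jgen"
  shows "pairing e P \<in> K"
  using assms
proof (induction rule: fs.span_induct_alt)
  case base
  show ?case using flinear_0[OF flinear_pairing] fs.subspace_0[OF K] by metis
next
  case (step c x y)
  from step(1) consider f q where "f \<in> zideal X" "x = lift f * mon q"
    | \<xi> q where "x = sigma \<xi> * mon q + (\<Sum>i\<in>UNIV. fscale (of_nat (q (Inl i))) (lift (a \<xi> i) * mon (dn (Inl i) q)))"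
    unfolding Jgen_def by blast
  then have "pairing e x \<in> K"
  proof cases
    case 1
    then have f: "f \<in> poly_fun" by (simp add: zideal_def)
    have "pairing e x = f * fscale (of_nat (falls e q)) (mon (shift e q))"
      unfolding 1(2) pairing_lift[OF f] pairing_mon ..
    also have "\<dots> \<in> zideal X" using 1(1) unfolding zideal_def
      by (auto simp: fun_apply intro!: poly_fun_intros fscale_poly_fun mon_poly_fun)
    finally show ?thesis using zideal_K by blast
  next
    case 2
    have "sigma \<xi> * mon q = (\<Sum>i\<in>UNIV. lift (a \<xi> i) * mon (up (Inr i) q))"
      unfolding sigma_def sum_distrib_right
      by (intro sum.cong) (auto simp: fun_eq_iff fun_apply mon_up)
    then have "pairing e x = (\<Sum>i\<in>UNIV. a \<xi> i * (pairing e (mon (up (Inr i) q)) + fscale (of_nat (q (Inl i))) (pairing e (mon (dn (Inl i) q)))))"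
      unfolding 2 by (simp add: flinear_add[OF flinear_pairing] flinear_sum[OF flinear_pairing]
        flinear_scale[OF flinear_pairing] pairing_lift[OF a] sum.distrib[symmetric])
        (auto simp: fun_eq_iff fun_apply sum_fun_apply algebra_simps intro!: sum.cong)
    also have "\<dots> = fscale (of_nat (falls e q)) (\<Sum>i\<in>UNIV. fscale (of_nat (shift e q i)) (a \<xi> i * mon (dn i (shift e q))))"
      unfolding pairing_leibniz fs.scale_sum_right
      by (intro sum.cong) (auto simp: fun_eq_iff fun_apply)
    also have "\<dots> \<in> K" by (intro fs.subspace_scale[OF K] field_K)
    finally show ?thesis .
  qed
  then show ?case using step.IH
    by (simp add: flinear_add[OF flinear_pairing] flinear_scale[OF flinear_pairing] fs.subspace_add[OF K] fs.subspace_scale[OF K])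
qed

text \<open>The degrees d in which the quotient by \<open>K\<close>, filtered by degree, has a
  nonzero graded piece.\<close>

definition crit :: "nat set" where
  "crit = {d. \<exists>e. size_exp e = d \<and> (\<forall>f\<in>K. mon e - f \<notin> deg_less d)}"

text \<open>A functional on the graded piece of degree d, extended by zero to the other degrees. It
  kills only the elements of \<open>K\<close> of degree at most d, not all of
  \<open>K\<close>.\<close>

lemma crit_functional:
  assumes "d \<in> crit"
  shows "\<exists>\<Lambda> :: (('n \<Rightarrow> 'k) \<Rightarrow> 'k) \<Rightarrow> unit \<Rightarrow> 'k. flinear \<Lambda> \<and> (\<forall>e. size_exp e \<noteq> d \<longrightarrow> \<Lambda> (mon e) = 0) \<and>
    (\<forall>f\<in>K \<inter> deg_less (Suc d). \<Lambda> f = 0) \<and> (\<exists>e. \<Lambda> (mon e) \<noteq> 0)"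
proof -
  obtain e0 where e0: "size_exp e0 = d" "\<And>f. f \<in> K \<Longrightarrow> mon e0 - f \<notin> deg_less d"
    using assms unfolding crit_def by blast
  let ?S = "(K \<inter> deg_less (Suc d)) \<union> mon ` {e. size_exp e \<noteq> d}"
  have "mon e0 \<notin> fs.span ?S"
  proof
    assume "mon e0 \<in> fs.span ?S"
    then obtain \<kappa> y where ky: "mon e0 = \<kappa> + y" "\<kappa> \<in> fs.span (K \<inter> deg_less (Suc d))" "y \<in> fs.span (mon ` {e. size_exp e \<noteq> d})"
      unfolding fs.span_Un by blast
    have "fs.subspace (K \<inter> deg_less (Suc d))"
      unfolding deg_less_def by (intro fs.subspace_inter K fs.subspace_span)
    then have "fs.span (K \<inter> deg_less (Suc d)) = K \<inter> deg_less (Suc d)" by (simp only: fs.span_eq_iff)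
    then have \<kappa>: "\<kappa> \<in> K" "\<kappa> \<in> deg_less (Suc d)" using ky(2) by blast+
    \<comment> \<open>Cutting off degrees above d fixes \<kappa> and sends \<open>y\<close> to
      degree below d, so x^e0 would be congruent modulo \<open>K\<close> to something of lower
      degree.\<close>
    define \<pi> where "\<pi> = (monlin (\<lambda>e. if size_exp e \<le> d then mon e else 0) :: (('n \<Rightarrow> 'k) \<Rightarrow> 'k) \<Rightarrow> ('n \<Rightarrow> 'k) \<Rightarrow> 'k)"
    have lin: "flinear \<pi>" unfolding \<pi>_def by (rule flinear_monlin)
    have \<pi>m: "\<pi> (mon e) = (if size_exp e \<le> d then mon e else 0)" for e by (simp add: \<pi>_def)
    have "\<pi> \<kappa> = \<kappa>"
      using \<kappa>(2) unfolding deg_less_def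
    proof (induction rule: fs.span_induct_alt)
      case base
      show ?case by (rule flinear_0[OF lin])
    next
      case (step c x y)
      then have "\<pi> x = x" by (auto simp: \<pi>m)
      then show ?case using step.IH by (simp add: flinear_add[OF lin] flinear_scale[OF lin])
    qed
    moreover have "\<pi> y \<in> deg_less d" unfolding deg_less_def
    proof (rule flinear_span_image[OF lin _ ky(3)])
      fix f :: "('n \<Rightarrow> 'k) \<Rightarrow> 'k" assume "f \<in> mon ` {e. size_exp e \<noteq> d}"
      then obtain e where e: "f = mon e" "size_exp e \<noteq> d" by blast
      show "\<pi> f \<in> fs.span (mon ` {e. size_exp e < d})"
      proof (cases "size_exp e < d")
        case True
        then show ?thesis unfolding e(1) \<pi>m by (simp add: fs.span_base)
      next
        case False
        then show ?thesis unfolding e(1) \<pi>m using e(2) fs.span_zero by simp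
      qed
    qed
    moreover have "mon e0 = \<pi> \<kappa> + \<pi> y"
      using \<pi>m[of e0] e0(1) unfolding flinear_add[OF lin, symmetric] ky(1)[symmetric] by simp
    ultimately have "mon e0 - \<kappa> \<in> deg_less d" by simp
    then show False using e0(2) \<kappa>(1) by blast
  qed
  from separating_functional[OF this] obtain \<Lambda> :: "(('n \<Rightarrow> 'k) \<Rightarrow> 'k) \<Rightarrow> unit \<Rightarrow> 'k" where
    \<Lambda>: "flinear \<Lambda>" "\<forall>s\<in>fs.span ?S. \<Lambda> s = 0" "\<Lambda> (mon e0) = 1" by blast
  have "\<Lambda> s = 0" if "s \<in> ?S" for s using \<Lambda>(2) fs.span_base[OF that] by blast
  moreover have "\<Lambda> (mon e0) \<noteq> 0" unfolding \<Lambda>(3) by (rule one_neq_zero)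
  ultimately show ?thesis using \<Lambda>(1) by (intro exI[of _ \<Lambda>]) auto
qed

definition Lam :: "nat \<Rightarrow> (('n \<Rightarrow> 'k) \<Rightarrow> 'k) \<Rightarrow> unit \<Rightarrow> 'k" where
  "Lam d = (SOME \<Lambda>. flinear \<Lambda> \<and> (\<forall>e. size_exp e \<noteq> d \<longrightarrow> \<Lambda> (mon e) = 0) \<and>
    (\<forall>f\<in>K \<inter> deg_less (Suc d). \<Lambda> f = 0) \<and> (\<exists>e. \<Lambda> (mon e) \<noteq> 0))"

lemma Lam:
  assumes "d \<in> crit"
  shows "flinear (Lam d)" "size_exp e \<noteq> d \<Longrightarrow> Lam d (mon e) = 0"
    "f \<in> K \<Longrightarrow> f \<in> deg_less (Suc d) \<Longrightarrow> Lam d f = 0" "\<exists>e. Lam d (mon e) \<noteq> 0"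
  using someI_ex[OF crit_functional[OF assms]] unfolding Lam_def[symmetric] by blast+

definition Psi :: "nat \<times> ('n \<Rightarrow> nat) \<Rightarrow> 'k" where
  "Psi = (\<lambda>(d, e). if d \<in> crit then Lam d (mon e) () else 0)"

lemma Psi_eq_0: "size_exp e \<noteq> d \<Longrightarrow> Psi (d, e) = 0"
  using Lam(2) by (auto simp: Psi_def fun_apply)

text \<open>The Euler degree: by how much an operator raises the degree of polynomials.\<close>

definition vdeg :: "('n + 'n \<Rightarrow> nat) \<Rightarrow> int" where
  "vdeg q = int (\<Sum>i\<in>UNIV. q (Inl i)) - int (\<Sum>i\<in>UNIV. q (Inr i))"

text \<open>Applied to x^e, the operator gives an element of \<open>K\<close> of degree at most d =
  |e| + \<delta>, which \<open>Lam d\<close> kills. As \<open>Lam d\<close> sees only degree d, only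
  the terms of Euler degree \<delta> contribute.\<close>

lemma act_Psi_top:
  assumes "finite M" "(\<Sum>q\<in>M. fscale (c q) (mon q)) \<in> fs.span Jgen"
    and top: "\<And>q. q \<in> M \<Longrightarrow> c q \<noteq> 0 \<Longrightarrow> vdeg q \<le> \<delta>"
  shows "(\<Sum>q\<in>{q \<in> M. vdeg q = \<delta>}. fscale (c q) (act q Psi)) = 0"
proof (rule ext, clarify)
  fix d e
  have z: "act q Psi (d, e) = 0" if "int d \<noteq> int (size_exp e) + vdeg q" for q
  proof (cases "falls e q = 0")
    case False
    then have "size_exp (shift e q) \<noteq> d" using size_shift[OF False] that by (auto simp: vdeg_def)
    then show ?thesis by (simp add: act_def Psi_eq_0)
  qed (simp add: act_def)
  show "(\<Sum>q\<in>{q \<in> M. vdeg q = \<delta>}. fscale (c q) (act q Psi)) (d, e) = 0 (d, e)"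
  proof (cases "d \<in> crit \<and> int d = int (size_exp e) + \<delta>")
    case True
    then have d: "d \<in> crit" "int d = int (size_exp e) + \<delta>" by auto
    define P where "P = (\<Sum>q\<in>M. fscale (c q) (mon q))"
    have eq: "pairing e P = (\<Sum>q\<in>M. fscale (c q) (fscale (of_nat (falls e q)) (mon (shift e q))))"
      unfolding P_def flinear_sum[OF flinear_pairing] flinear_scale[OF flinear_pairing] pairing_mon ..
    have "fscale (c q) (fscale (of_nat (falls e q)) (mon (shift e q))) \<in> deg_less (Suc d)" if "q \<in> M" for q
    proof (cases "c q = 0 \<or> falls e q = 0")
      case True
      then have "fscale (c q) (fscale (of_nat (falls e q)) (mon (shift e q))) = (0 :: ('n \<Rightarrow> 'k) \<Rightarrow> 'k)"
        by (auto simp: fun_eq_iff fun_apply)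
      then show ?thesis unfolding deg_less_def using fs.span_zero by metis
    next
      case False
      then have "int (size_exp (shift e q)) \<le> int d"
        using size_shift[of e q] top[OF that] d(2) by (auto simp: vdeg_def)
      then show ?thesis unfolding deg_less_def by (intro fs.span_scale fs.span_base imageI) auto
    qed
    then have "pairing e P \<in> deg_less (Suc d)" unfolding eq deg_less_def by (intro fs.span_sum) auto
    moreover have "pairing e P \<in> K" using pairing_J assms(2) by (simp add: P_def)
    ultimately have "Lam d (pairing e P) () = 0" using Lam(3)[OF d(1)] by (simp add: fun_apply)
    also have "Lam d (pairing e P) () = (\<Sum>q\<in>M. c q * act q Psi (d, e))"
      unfolding eq flinear_sum[OF Lam(1)[OF d(1)]] flinear_scale[OF Lam(1)[OF d(1)]]
      using d(1) by (simp add: sum_fun_apply fun_apply act_def Psi_def mult.assoc)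
    also have "\<dots> = (\<Sum>q\<in>{q \<in> M. vdeg q = \<delta>}. c q * act q Psi (d, e))"
    proof -
      have "act q Psi (d, e) = 0" if "vdeg q \<noteq> \<delta>" for q using z[of q] d(2) that by simp
      then show ?thesis using assms(1) by (intro sum.mono_neutral_right) auto
    qed
    finally show ?thesis by (simp add: sum_fun_apply fun_apply)
  next
    case False
    then have "act q Psi (d, e) = 0" if "vdeg q = \<delta>" for q
      using z[of q] that by (auto simp: act_def Psi_def)
    then show ?thesis by (auto simp: sum_fun_apply fun_apply intro!: sum.neutral)
  qed
qed

section \<open>Growth of the module generated by the critical functionals\<close>

definition H :: "('n + 'n \<Rightarrow> nat) \<Rightarrow> nat \<Rightarrow> (nat \<times> ('n \<Rightarrow> nat) \<Rightarrow> 'k) set" where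
  "H w k = fs.span ((\<lambda>q. act q Psi) ` {q. wt w q \<le> k})"

lemma H_mono: "k \<le> k' \<Longrightarrow> H w k \<subseteq> H w k'"
  unfolding H_def by (intro fs.span_mono image_mono) auto

lemma act_in_H: "wt w q \<le> k \<Longrightarrow> act q Psi \<in> H w k"
  unfolding H_def by (intro fs.span_base) auto

text \<open>Standard monomials need not span here, since \<open>Psi\<close> is killed only by top
  parts of the right ideal. Instead, more independent vectors \<open>act q Psi\<close> than standard
  monomials would give a combination of the \<open>mon q\<close> in the right ideal, and its top
  part would be a dependence among these vectors.\<close>

lemma H_basis:
  assumes w: "\<And>i. 1 \<le> w i"
    and std: "\<And>q. \<exists>j\<in>fs.span Jgen. mon q - j \<in> fs.span (mon ` {s \<in> std. wt w s \<le> wt w q})"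
  shows "\<exists>T. finite T \<and> H w k = fs.span T \<and> card T \<le> card {s \<in> std. wt w s \<le> k}"
proof -
  let ?g = "\<lambda>q. act q Psi"
  let ?S = "{s \<in> std. wt w s \<le> k}"
  obtain T where T: "T \<subseteq> ?g ` {q. wt w q \<le> k}" "fs.independent T" "?g ` {q. wt w q \<le> k} \<subseteq> fs.span T"
    using fs.maximal_independent_subset by blast
  obtain M where M: "M \<subseteq> {q. wt w q \<le> k}" "inj_on ?g M" "T = ?g ` M"
    using subset_image_inj[THEN iffD1, OF T(1)] by blast
  have finM: "finite M" using finite_subset[OF M(1) finite_wt_le[OF w]] .
  have finS: "finite ?S" by (rule finite_subset[OF _ finite_wt_le[OF w, where k = k]]) auto
  have "card M \<le> card ?S"
  proof (rule ccontr)
    assume "\<not> card M \<le> card ?S"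
    moreover have "card (mon ` ?S :: (('n + 'n \<Rightarrow> 'k) \<Rightarrow> 'k) set) \<le> card ?S"
      by (rule card_image_le[OF finS])
    ultimately have lt: "card (mon ` ?S :: (('n + 'n \<Rightarrow> 'k) \<Rightarrow> 'k) set) < card M" by linarith
    have "\<forall>q. \<exists>j. j \<in> fs.span Jgen \<and> mon q - j \<in> fs.span (mon ` {s \<in> std. wt w s \<le> wt w q})" using std by blast
    from choice[OF this] obtain j
      where j': "\<forall>q. j q \<in> fs.span Jgen \<and> mon q - j q \<in> fs.span (mon ` {s \<in> std. wt w s \<le> wt w q})" ..
    note j = j'[rule_format, THEN conjunct1] j'[rule_format, THEN conjunct2]
    have red: "mon q - j q \<in> fs.span (mon ` ?S)" if "q \<in> M" for q
    proof -
      have "fs.span (mon ` {s \<in> std. wt w s \<le> wt w q}) \<subseteq> (fs.span (mon ` ?S) :: (('n + 'n \<Rightarrow> 'k) \<Rightarrow> 'k) set)"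
        using that M(1) by (intro fs.span_mono image_mono) auto
      then show ?thesis using j(2) by (rule subsetD)
    qed
    have "\<exists>c. (\<exists>q\<in>M. c q \<noteq> 0) \<and> (\<Sum>q\<in>M. fscale (c q) (mon q - j q)) = 0"
      by (rule dependent_family[OF finM finite_imageI[OF finS] lt red])
    then obtain c where c: "\<exists>q\<in>M. c q \<noteq> 0" "(\<Sum>q\<in>M. fscale (c q) (mon q - j q)) = 0" by (elim exE conjE)
    have "(\<Sum>q\<in>M. fscale (c q) (mon q)) = (\<Sum>q\<in>M. fscale (c q) (j q))"
      using c(2) by (simp add: fs.scale_right_diff_distrib sum_subtractf)
    also have "\<dots> \<in> fs.span Jgen" by (intro fs.span_sum fs.span_scale j)
    finally have PJ: "(\<Sum>q\<in>M. fscale (c q) (mon q)) \<in> fs.span Jgen" .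
    \<comment> \<open>The maximum runs over nonzero coefficients only, so that the top part is
      nonzero.\<close>
    define \<delta> where "\<delta> = Max (vdeg ` {q \<in> M. c q \<noteq> 0})"
    have "\<delta> \<in> vdeg ` {q \<in> M. c q \<noteq> 0}" unfolding \<delta>_def using c(1) finM by (intro Max_in) auto
    then obtain q0 where q0: "q0 \<in> M" "c q0 \<noteq> 0" "vdeg q0 = \<delta>" by auto
    have max: "vdeg q \<le> \<delta>" if "q \<in> M" "c q \<noteq> 0" for q
      unfolding \<delta>_def using that finM by (intro Max_ge) auto
    let ?M = "{q \<in> M. vdeg q = \<delta>}"
    have "c q0 = 0"
    proof (rule independent_family[where A = ?M and g = ?g])
      show "finite ?M" using finM by simp
      show "inj_on ?g ?M" using M(2) by (rule inj_on_subset) auto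
      show "fs.independent (?g ` ?M)" using T(2) unfolding M(3) by (rule fs.independent_mono) auto
      show "(\<Sum>q\<in>?M. fscale (c q) (act q Psi)) = 0" by (rule act_Psi_top[OF finM PJ max])
      show "q0 \<in> ?M" using q0 by simp
    qed
    then show False using q0 by simp
  qed
  moreover have "H w k = fs.span T"
    unfolding H_def using T(1,3) by (intro antisym fs.span_mono fs.span_minimal) (auto intro: fs.subspace_span)
  moreover have "card T \<le> card M" unfolding M(3) by (rule card_image_le[OF finM])
  ultimately show ?thesis using finM M(3) by (intro exI[of _ T]) auto
qed

context
  fixes w :: "'n + 'n \<Rightarrow> nat" and W :: nat
  assumes W: "\<And>i. w i \<le> W"
begin

lemma H_Xop: "u \<in> H w k \<Longrightarrow> Xop i u \<in> H w (k + W)"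
  unfolding H_def
proof (rule flinear_span_image[OF flinear_ops(2)])
  fix f assume "f \<in> (\<lambda>q. act q Psi) ` {q. wt w q \<le> k}"
  then obtain q where q: "f = act q Psi" "wt w q \<le> k" by blast
  have "wt w (up (Inl i) q) \<le> k + W" using q(2) W[of "Inl i"] by (simp add: wt_up)
  moreover have "wt w (dn (Inr i) q) \<le> k + W" using q(2) wt_dn_le[of w "Inr i" q] by simp
  ultimately have "act (up (Inl i) q) Psi + fscale (of_nat (q (Inr i))) (act (dn (Inr i) q) Psi) \<in> H w (k + W)"
    unfolding H_def by (intro fs.span_add fs.span_scale fs.span_base) auto
  then show "Xop i f \<in> fs.span ((\<lambda>q. act q Psi) ` {q. wt w q \<le> k + W})"
    unfolding q(1) Xop_act act_up_Inl[symmetric] H_def .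
qed

lemma H_Dop: "u \<in> H w k \<Longrightarrow> Dop i u \<in> H w (k + W)"
  unfolding H_def
proof (rule flinear_span_image[OF flinear_ops(3)])
  fix f assume "f \<in> (\<lambda>q. act q Psi) ` {q. wt w q \<le> k}"
  then obtain q where q: "f = act q Psi" "wt w q \<le> k" by blast
  have "wt w (up (Inr i) q) \<le> k + W" using q(2) W[of "Inr i"] by (simp add: wt_up)
  then have "act (up (Inr i) q) Psi \<in> H w (k + W)" by (rule act_in_H)
  then show "Dop i f \<in> fs.span ((\<lambda>q. act q Psi) ` {q. wt w q \<le> k + W})"
    unfolding q(1) act_up_Inr H_def .
qed

text \<open>Since \<open>Psi\<close> vanishes unless |e| = d, multiplication by d coincides with the
  Euler operator.\<close>

lemma Top_Psi: "Top Psi = (\<Sum>i\<in>UNIV. Dop i (Xop i Psi))"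
proof (rule ext, clarify)
  fix d e
  have "Dop i (Xop i Psi) (d, e) = of_nat (e i) * Psi (d, e)" for i
    by (cases "e i = 0") (auto simp: Dop_def Xop_def up_dn)
  then have "(\<Sum>i\<in>UNIV. Dop i (Xop i Psi)) (d, e) = of_nat (size_exp e) * Psi (d, e)"
    by (simp add: sum_fun_apply size_exp_def sum_distrib_right)
  also have "\<dots> = Top Psi (d, e)" using Psi_eq_0[of e d] by (cases "size_exp e = d") (auto simp: Top_def)
  finally show "Top Psi (d, e) = (\<Sum>i\<in>UNIV. Dop i (Xop i Psi)) (d, e)" by simp
qed

lemma H_Top: "u \<in> H w k \<Longrightarrow> Top u \<in> H w (k + 2 * W)"
  unfolding H_def
proof (rule flinear_span_image[OF flinear_ops(4)])
  fix f assume "f \<in> (\<lambda>q. act q Psi) ` {q. wt w q \<le> k}"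
  then obtain q where q: "f = act q Psi" "wt w q \<le> k" by blast
  \<comment> \<open>The central variable passes to the generator, where it becomes the Euler
    operator; its two factors account for \<open>2 * W\<close>.\<close>
  have "Top (act q Psi) = act q (Top Psi)" by (simp add: act_def Top_def fun_eq_iff)
  also have "\<dots> = (\<Sum>i\<in>UNIV. act q (Dop i (Xop i Psi)))"
    unfolding Top_Psi flinear_sum[OF flinear_ops(1)] ..
  also have "\<dots> = (\<Sum>i\<in>UNIV. act (up (Inr i) (up (Inl i) q)) Psi +
      fscale (of_nat (q (Inl i))) (act (up (Inl i) (dn (Inl i) q)) Psi))"
    unfolding act_Dop act_up_Inl[symmetric] act_up_Inr[symmetric] ..
  also have "\<dots> \<in> H w (k + 2 * W)"
  proof -
    have "wt w (up (Inr i) (up (Inl i) q)) \<le> k + 2 * W" for i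
      using q(2) W[of "Inl i"] W[of "Inr i"] by (simp add: wt_up)
    moreover have "wt w (up (Inl i) (dn (Inl i) q)) \<le> k + 2 * W" for i
      using q(2) W[of "Inl i"] wt_dn_le[of w "Inl i" q] by (simp add: wt_up)
    ultimately show ?thesis unfolding H_def by (intro fs.span_sum fs.span_add fs.span_scale fs.span_base) auto
  qed
  finally show "Top f \<in> fs.span ((\<lambda>q. act q Psi) ` {q. wt w q \<le> k + 2 * W})"
    unfolding q(1) H_def .
qed

lemma H_act: "u \<in> H w k \<Longrightarrow> act q u \<in> H w (k + W * size_exp q)"
proof (induction "size_exp q" arbitrary: q u k)
  case 0
  then have s: "size_exp q = 0" by simp
  then have "act q u = u" by (simp add: size_exp_eq_0)
  then show ?case unfolding s using 0(2) by simp
next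
  case (Suc n)
  then have "q \<noteq> 0" using size_exp_eq_0[of q] by simp
  then obtain i where "q i \<noteq> 0" by (auto simp: fun_eq_iff fun_apply)
  then have q: "q = up i (dn i q)" by (simp add: up_dn)
  then have n: "n = size_exp (dn i q)" using Suc(2) size_exp_up[of i "dn i q"] by simp
  have "size_exp q = Suc (size_exp (dn i q))" using size_exp_up[of i "dn i q"] q by simp
  then have k: "k + W * size_exp q = k + W + W * size_exp (dn i q)" by simp
  show ?case
  proof (cases i)
    case (Inl j)
    have "act q u = act (dn i q) (Xop j u)" by (subst q) (simp add: Inl act_up_Inl)
    then show ?thesis using Suc(1)[OF n H_Xop[OF Suc(3)]] unfolding k by simp
  next
    case (Inr j)
    have "act q u = Dop j (act (dn i q) u)" by (subst q) (simp add: Inr act_up_Inr)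
    then show ?thesis using H_Dop[OF Suc(1)[OF n Suc(3)]] unfolding k by (simp add: ac_simps)
  qed
qed

lemma H_Top_power: "u \<in> H w k \<Longrightarrow> (Top ^^ j) u \<in> H w (k + 2 * W * j)"
proof (induction j)
  case (Suc j)
  then have "Top ((Top ^^ j) u) \<in> H w (k + 2 * W * j + 2 * W)" by (intro H_Top)
  then show ?case by (simp add: algebra_simps)
qed simp

text \<open>An operator \<open>\<Sum>q. c q (t) q\<close>, with \<open>t\<close> acting by \<open>Top\<close>, that annihilates a large enough \<open>H w k\<close>:
  commutators with \<open>Xop\<close> and \<open>Dop\<close> lower its order, until a nonzero polynomial \<open>b (t)\<close> kills \<open>Psi\<close>.\<close>

lemma annihilator_trivial:
  assumes "infinite crit" "finite M" "\<exists>q\<in>M. c q \<noteq> 0" "\<And>q. q \<in> M \<Longrightarrow> size_exp q \<le> N"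
    and "\<And>u d e. u \<in> H w (N * W) \<Longrightarrow> (\<Sum>q\<in>M. poly (c q) (of_nat d) * act q u (d, e)) = 0"
  shows False
  using assms(2-)
proof (induction N arbitrary: M c)
  case (0 M c)
  then have "q = 0" if "q \<in> M" for q using that size_exp_eq_0 by (metis le_zero_eq)
  then have M: "M = {0}" and c0: "c 0 \<noteq> 0" using 0(2) by blast+
  have "act 0 Psi \<in> H w (0 * W)" by (rule act_in_H) simp
  then have z: "poly (c 0) (of_nat d) * Psi (d, e) = 0" for d e using 0(4)[of Psi d e] by (simp add: M)
  have "poly (c 0) (of_nat d) = 0" if d: "d \<in> crit" for d
  proof -
    obtain e where "Lam d (mon e) \<noteq> 0" using Lam(4)[OF d] by blast
    then have "Psi (d, e) \<noteq> 0" using d by (auto simp: Psi_def fun_eq_iff fun_apply)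
    then show ?thesis using z[of d e] by simp
  qed
  \<comment> \<open>Every critical degree is a root of \<open>c 0\<close>, since its functional is
    nonzero on some monomial.\<close>
  then have "of_nat ` crit \<subseteq> {x. poly (c 0) x = 0}" by auto
  then have "finite ((of_nat :: nat \<Rightarrow> 'k) ` crit)" using poly_roots_finite[OF c0] finite_subset by blast
  then show False using assms(1) by (simp add: finite_image_iff)
next
  case (Suc N M c)
  show False
  proof (cases "\<exists>q\<in>M. c q \<noteq> 0 \<and> q \<noteq> 0")
    case False
    \<comment> \<open>Only the constant operator has a nonzero coefficient, so the order bound drops
      without a commutator.\<close>
    define M' where "M' = {q \<in> M. q = 0}"
    show False
    proof (rule Suc.IH[of M' c])
      show "finite M'" using Suc.prems(1) by (simp add: M'_def)
      show "\<exists>q\<in>M'. c q \<noteq> 0" using Suc.prems(2) False by (auto simp: M'_def)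
      show "size_exp q \<le> N" if "q \<in> M'" for q using that by (simp add: M'_def size_exp_def fun_apply)
      fix u d e assume "u \<in> H w (N * W)"
      then have "u \<in> H w (Suc N * W)" using H_mono[of "N * W" "Suc N * W" w] by auto
      then have "0 = (\<Sum>q\<in>M. poly (c q) (of_nat d) * act q u (d, e))" using Suc.prems(4) by simp
      also have "\<dots> = (\<Sum>q\<in>M'. poly (c q) (of_nat d) * act q u (d, e))"
        unfolding M'_def using Suc.prems(1) False by (intro sum.mono_neutral_right) auto
      finally show "(\<Sum>q\<in>M'. poly (c q) (of_nat d) * act q u (d, e)) = 0" by simp
    qed
  next
    case True
    then obtain q1 where q1: "q1 \<in> M" "c q1 \<noteq> 0" "q1 \<noteq> 0" by blast
    then obtain i where i: "0 < q1 i" by (auto simp: fun_eq_iff fun_apply)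
    \<comment> \<open>\<open>M'\<close> and \<open>c'\<close> describe the formal derivative of the
      operator in the variable \<open>i\<close>, which is its commutator with the dual variable up
      to sign. It is nonzero in characteristic zero because \<open>i\<close> occurs in
      \<open>q1\<close>.\<close>
    define M' where "M' = {q. up i q \<in> M}"
    have up_i: "up i q i = Suc (q i)" for q by (simp add: up_def)
    define c' where "c' q = smult (of_nat (Suc (q i))) (c (up i q))" for q
    \<comment> \<open>The operator kills both \<open>u\<close> and its image under the dual
      variable; the latter may leave \<open>H w (N * W)\<close> but stays in
      \<open>H w (Suc N * W)\<close>.\<close>
    have comm: "(\<Sum>q\<in>M. poly (c q) (of_nat d) * (of_nat (q i) * act (dn i q) u (d, e))) = 0"
      if u: "u \<in> H w (N * W)" for u d e
    proof -
      have G0: "(\<Sum>q\<in>M. poly (c q) (of_nat d) * act q v (d, e)) = 0" if "v \<in> H w (N * W + W)" for v d e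
        using Suc.prems(4)[of v] that by (simp add: add.commute)
      have uu: "u \<in> H w (N * W + W)" using H_mono[of "N * W" "N * W + W" w] u by auto
      show ?thesis
      proof (cases i)
        case (Inl j)
        have "(\<Sum>q\<in>M. poly (c q) (of_nat d) * act q (Dop j u) (d, e)) =
          of_nat (e j) * (\<Sum>q\<in>M. poly (c q) (of_nat d) * act q u (d, dn j e)) +
          (\<Sum>q\<in>M. poly (c q) (of_nat d) * (of_nat (q i) * act (dn i q) u (d, e)))"
          unfolding act_Dop sum_distrib_left sum.distrib[symmetric]
          by (intro sum.cong) (auto simp: fun_apply Dop_def Inl algebra_simps)
        then show ?thesis using G0[OF H_Dop[OF u]] G0[OF uu] by simp
      next
        case (Inr j)
        have "(\<Sum>q\<in>M. poly (c q) (of_nat d) * act q u (d, up j e)) =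
          (\<Sum>q\<in>M. poly (c q) (of_nat d) * Xop j (act q u) (d, e))" by (simp add: Xop_def)
        also have "\<dots> = (\<Sum>q\<in>M. poly (c q) (of_nat d) * act q (Xop j u) (d, e)) +
          (\<Sum>q\<in>M. poly (c q) (of_nat d) * (of_nat (q i) * act (dn i q) u (d, e)))"
          unfolding Xop_act sum.distrib[symmetric]
          by (intro sum.cong) (auto simp: fun_apply Inr algebra_simps)
        finally show ?thesis using G0[OF H_Xop[OF u]] G0[OF uu] by simp
      qed
    qed
    show False
    proof (rule Suc.IH[of M' c'])
      have "M' \<subseteq> dn i ` M" unfolding M'_def by (metis (no_types, lifting) dn_up image_eqI mem_Collect_eq subsetI)
      then show "finite M'" using Suc.prems(1) finite_surj by blast
      show "\<exists>q\<in>M'. c' q \<noteq> 0"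
        using q1 i by (intro bexI[of _ "dn i q1"]) (auto simp: M'_def c'_def up_dn simp del: of_nat_Suc)
      show "size_exp q \<le> N" if "q \<in> M'" for q
        using that Suc.prems(3)[of "up i q"] by (simp add: M'_def size_exp_up)
      fix u d e assume u: "u \<in> H w (N * W)"
      have "(\<Sum>q\<in>M'. poly (c' q) (of_nat d) * act q u (d, e)) =
        (\<Sum>q\<in>{q \<in> M. 0 < q i}. poly (c q) (of_nat d) * (of_nat (q i) * act (dn i q) u (d, e)))"
        by (rule sum.reindex_bij_witness[where i = "dn i" and j = "up i"])
           (auto simp: M'_def c'_def up_dn up_i simp del: of_nat_Suc)
      also have "\<dots> = (\<Sum>q\<in>M. poly (c q) (of_nat d) * (of_nat (q i) * act (dn i q) u (d, e)))"
        using Suc.prems(1) by (intro sum.mono_neutral_left) auto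
      finally show "(\<Sum>q\<in>M'. poly (c' q) (of_nat d) * act q u (d, e)) = 0" using comm[OF u] by simp
    qed
  qed
qed

end

end

section \<open>The dimension count and its consequence for the quotient\<close>

context leafy_coinvariants
begin

lemma Top_power_apply: "(Top ^^ j) u (d, e) = of_nat d ^ j * u (d, e)"
  by (induction j) (auto simp: Top_def)

text \<open>Bernstein's argument: operators whose exponents are at most \<open>k\<close> in all 2n +
  1 variables outnumber the dimension of the maps from \<open>H w k1\<close> to
  \<open>H w k2\<close>, so a nontrivial combination vanishes on \<open>H w k1\<close>, against
  \<open>annihilator_trivial\<close>.\<close>

lemma finite_crit: "finite crit"
proof (rule ccontr)
  assume inf: "infinite crit"
  define n where "n = card (UNIV :: 'n set)"
  have M: "card (UNIV :: ('n + 'n) set) = 2 * n"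
    unfolding UNIV_Plus_UNIV[symmetric] by (subst card_Plus) (auto simp: n_def)
  from standard_monomials obtain w C std where w: "\<And>i. 1 \<le> w i"
    and std: "\<And>q. \<exists>j\<in>fs.span Jgen. mon q - j \<in> fs.span (mon ` {s \<in> std. wt w s \<le> wt w q})"
    and C: "\<And>k. card {s \<in> std. wt w s \<le> k} \<le> C * (k + 1) ^ n" unfolding n_def by blast
  define W where "W = (\<Sum>i\<in>UNIV. w i)"
  have W: "w i \<le> W" for i unfolding W_def by (rule member_le_sum) auto
  obtain k where k: "(C * (2 * n * W * k + 1) ^ n) * (C * ((4 * n * W + 2 * W) * k + 1) ^ n) < (k + 1) ^ (2 * n + 1)"
    using growth_contradiction by blast
  \<comment> \<open>\<open>N\<close> bounds the total exponent of a monomial in 2n variables with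
    exponents at most \<open>k\<close>; \<open>k1\<close> is the level on which an annihilator of
    that size must be trivial, and \<open>k2\<close> is where the operators send it.\<close>
  define N where "N = 2 * n * k"
  define k1 where "k1 = N * W"
  define k2 where "k2 = k1 + W * N + 2 * W * k"
  have k12: "k1 = 2 * n * W * k" "k2 = (4 * n * W + 2 * W) * k"
    by (simp_all add: k1_def k2_def N_def algebra_simps)
  obtain T1 where T1: "finite T1" "H w k1 = fs.span T1" "card T1 \<le> card {s \<in> std. wt w s \<le> k1}"
    using H_basis[OF w std] by blast
  obtain T2 where T2: "finite T2" "H w k2 = fs.span T2" "card T2 \<le> card {s \<in> std. wt w s \<le> k2}"
    using H_basis[OF w std] by blast
  define Bx where "Bx = PiE (UNIV :: ('n + 'n) set) (\<lambda>_. {..k})"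
  have finBx: "finite Bx" unfolding Bx_def by (intro finite_PiE) auto
  have cBx: "card Bx = (k + 1) ^ (2 * n)" unfolding Bx_def by (subst card_PiE) (auto simp: M)
  have size: "size_exp q \<le> N" if "q \<in> Bx" for q
  proof -
    have "size_exp q \<le> (\<Sum>i\<in>(UNIV :: ('n + 'n) set). k)"
      unfolding size_exp_def using that by (intro sum_mono) (auto simp: Bx_def)
    then show ?thesis by (simp add: M N_def)
  qed
  \<comment> \<open>A linear map on \<open>H w k1\<close> is encoded by its values on the spanning
    set \<open>T1\<close>. \<open>B\<close> consists of the maps taking one element of
    \<open>T1\<close> to one of \<open>T2\<close> and the others to 0, and \<open>g (j, q)\<close>
    encodes the operator \<open>q\<close> followed by \<open>Top ^^ j\<close>.\<close>
  define E :: "(nat \<times> ('n \<Rightarrow> nat) \<Rightarrow> 'k) \<Rightarrow> (nat \<times> ('n \<Rightarrow> nat) \<Rightarrow> 'k) \<Rightarrow>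
      (nat \<times> ('n \<Rightarrow> nat) \<Rightarrow> 'k) \<times> (nat \<times> ('n \<Rightarrow> nat)) \<Rightarrow> 'k"
    where "E u0 h = (\<lambda>(u, z). if u = u0 then h z else 0)" for u0 h
  define B where "B = (\<lambda>(u0, h). E u0 h) ` (T1 \<times> T2)"
  define g where "g = (\<lambda>(j, q) (u, z). if u \<in> T1 then (Top ^^ j) (act q u) z else (0::'k))"
  have linE: "flinear (E u0)" for u0
    unfolding Vector_Spaces.linear_iff by (auto simp: fs.vector_space_axioms E_def fun_eq_iff fun_apply)
  have "card B \<le> card (T1 \<times> T2)" unfolding B_def using T1 T2 by (intro card_image_le) auto
  also have "\<dots> = card T1 * card T2" by (rule card_cartesian_product)
  also have "\<dots> \<le> (C * (k1 + 1) ^ n) * (C * (k2 + 1) ^ n)"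
    by (intro mult_mono order_trans[OF T1(3) C] order_trans[OF T2(3) C]) auto
  also have "\<dots> < (k + 1) ^ (2 * n + 1)" using k by (simp only: k12)
  also have "\<dots> = card ({..k} \<times> Bx)" by (simp add: card_cartesian_product cBx)
  finally have lt: "card B < card ({..k} \<times> Bx)" .
  have gB: "g jq \<in> fs.span B" if mem: "jq \<in> {..k} \<times> Bx" for jq
  proof -
    obtain j q where jq: "jq = (j, q)" "j \<le> k" "q \<in> Bx" using mem by auto
    have "g jq = (\<Sum>u0\<in>T1. E u0 ((Top ^^ j) (act q u0)))"
    proof (rule ext, unfold split_paired_all)
      fix u :: "nat \<times> ('n \<Rightarrow> nat) \<Rightarrow> 'k" and d e
      have "(\<Sum>u0\<in>T1. E u0 ((Top ^^ j) (act q u0))) (u, (d, e)) =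
        (\<Sum>u0\<in>T1. if u0 = u then (Top ^^ j) (act q u) (d, e) else 0)"
        unfolding sum_fun_apply by (intro sum.cong) (auto simp: E_def)
      then show "g jq (u, (d, e)) = (\<Sum>u0\<in>T1. E u0 ((Top ^^ j) (act q u0))) (u, (d, e))"
        using T1(1) by (simp add: g_def jq)
    qed
    also have "\<dots> \<in> fs.span B"
    proof (rule fs.span_sum)
      fix u0 assume u0: "u0 \<in> T1"
      then have "u0 \<in> H w k1" unfolding T1(2) by (rule fs.span_base)
      then have "(Top ^^ j) (act q u0) \<in> H w (k1 + W * size_exp q + 2 * W * j)"
        by (intro H_Top_power[OF W] H_act[OF W])
      moreover have "H w (k1 + W * size_exp q + 2 * W * j) \<subseteq> H w k2"
        unfolding k2_def using size[OF jq(3)] jq(2) by (intro H_mono add_mono mult_left_mono) auto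
      ultimately have "(Top ^^ j) (act q u0) \<in> fs.span T2" unfolding T2(2) by (rule rev_subsetD)
      then show "E u0 ((Top ^^ j) (act q u0)) \<in> fs.span B"
      proof (rule flinear_span_image[OF linE, rotated])
        fix h assume "h \<in> T2"
        then show "E u0 h \<in> fs.span B" using u0 unfolding B_def by (intro fs.span_base) force
      qed
    qed
    finally show ?thesis .
  qed
  have "\<exists>c. (\<exists>jq\<in>{..k} \<times> Bx. c jq \<noteq> 0) \<and> (\<Sum>jq\<in>{..k} \<times> Bx. fscale (c jq) (g jq)) = 0"
    using finBx T1(1) T2(1) by (intro dependent_family[OF _ _ lt gB]) (auto simp: B_def)
  then obtain c where c: "\<exists>jq\<in>{..k} \<times> Bx. c jq \<noteq> 0" "(\<Sum>jq\<in>{..k} \<times> Bx. fscale (c jq) (g jq)) = 0" by (elim exE conjE)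
  \<comment> \<open>Collects the powers of the central variable at each \<open>q\<close> into one
    polynomial coefficient.\<close>
  define cp where "cp q = (\<Sum>j\<le>k. monom (c (j, q)) j)" for q
  have nonzero: "\<exists>q\<in>Bx. cp q \<noteq> 0"
  proof -
    obtain j q where jq: "j \<le> k" "q \<in> Bx" "c (j, q) \<noteq> 0" using c(1) by auto
    have "coeff (cp q) j = (\<Sum>j'\<le>k. if j' = j then c (j', q) else 0)"
      unfolding cp_def coeff_sum by (intro sum.cong) auto
    then have "coeff (cp q) j \<noteq> 0" using jq by simp
    then show ?thesis using jq by (metis coeff_0)
  qed
  have kill: "(\<Sum>q\<in>Bx. poly (cp q) (of_nat d) * act q u (d, e)) = 0" if u: "u \<in> H w (N * W)" for u d e
  proof -
    have "u \<in> fs.span T1" using u unfolding T1(2)[symmetric] k1_def .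
    then show ?thesis
    proof (induction rule: fs.span_induct_alt)
      case base
      show ?case unfolding flinear_0[OF flinear_ops(1)] by (simp add: fun_apply)
    next
      case (step r x y)
      have "0 = (\<Sum>jq\<in>{..k} \<times> Bx. fscale (c jq) (g jq)) (x, (d, e))" unfolding c(2) by (simp add: fun_apply)
      also have "\<dots> = (\<Sum>(j, q)\<in>{..k} \<times> Bx. c (j, q) * (of_nat d ^ j * act q x (d, e)))"
        using step(1) by (auto simp: sum_fun_apply fun_apply g_def Top_power_apply intro!: sum.cong)
      also have "\<dots> = (\<Sum>q\<in>Bx. \<Sum>j\<le>k. c (j, q) * (of_nat d ^ j * act q x (d, e)))"
        unfolding sum.cartesian_product[symmetric] by (rule sum.swap)
      also have "\<dots> = (\<Sum>q\<in>Bx. poly (cp q) (of_nat d) * act q x (d, e))"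
        by (simp add: cp_def poly_sum poly_monom sum_distrib_right mult.assoc)
      finally have "(\<Sum>q\<in>Bx. poly (cp q) (of_nat d) * act q x (d, e)) = 0" by simp
      moreover have "(\<Sum>q\<in>Bx. poly (cp q) (of_nat d) * act q (fscale r x + y) (d, e)) =
        r * (\<Sum>q\<in>Bx. poly (cp q) (of_nat d) * act q x (d, e)) + (\<Sum>q\<in>Bx. poly (cp q) (of_nat d) * act q y (d, e))"
        unfolding flinear_add[OF flinear_ops(1)] flinear_scale[OF flinear_ops(1)]
        by (simp add: fun_apply sum.distrib sum_distrib_left algebra_simps)
      ultimately show ?case using step.IH by simp
    qed
  qed
  show False
  proof (rule annihilator_trivial[where w = w and W = W and c = cp and M = Bx and N = N])
    show "w i \<le> W" for i by (rule W)
    show "infinite crit" "finite Bx" "\<exists>q\<in>Bx. cp q \<noteq> 0" by (fact inf finBx nonzero)+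
    show "size_exp q \<le> N" if "q \<in> Bx" for q using that by (rule size)
    show "(\<Sum>q\<in>Bx. poly (cp q) (of_nat d) * act q u (d, e)) = 0" if "u \<in> H w (N * W)" for u d e
      using that by (rule kill)
  qed
qed

text \<open>Beyond the last critical degree, every monomial is congruent modulo \<open>K\<close> to
  a polynomial of lower degree.\<close>

lemma finite_codimension: "\<exists>d0. \<forall>p\<in>poly_fun. \<exists>f\<in>K. p - f \<in> deg_less d0"
proof -
  obtain d0 where d0: "\<And>d. d \<in> crit \<Longrightarrow> d < d0"
    using finite_crit unfolding finite_nat_set_iff_bounded by blast
  define G where "G = {p. \<exists>f\<in>K. p - f \<in> deg_less d0}"
  have sub: "fs.subspace G"
    unfolding fs.subspace_def
  proof (intro conjI ballI allI)
    show "0 \<in> G" unfolding G_def deg_less_def using fs.subspace_0[OF K] fs.span_zero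
      by (intro CollectI bexI[of _ 0]) simp_all
    fix p assume "p \<in> G"
    then obtain f where f: "f \<in> K" "p - f \<in> deg_less d0" by (auto simp: G_def)
    show "fscale r p \<in> G" for r
    proof -
      have "fscale r p - fscale r f \<in> deg_less d0"
        using fs.span_scale[OF f(2)[unfolded deg_less_def], of r] by (simp only: fs.scale_right_diff_distrib deg_less_def)
      then show ?thesis unfolding G_def using fs.subspace_scale[OF K f(1)] by blast
    qed
    show "p + p' \<in> G" if p': "p' \<in> G" for p'
    proof -
      obtain f' where f': "f' \<in> K" "p' - f' \<in> deg_less d0" using p' by (auto simp: G_def)
      have "(p + p') - (f + f') = (p - f) + (p' - f')" by simp
      also have "\<dots> \<in> deg_less d0" using f f' unfolding deg_less_def by (intro fs.span_add)
      finally show ?thesis unfolding G_def using fs.subspace_add[OF K f(1) f'(1)] by blast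
    qed
  qed
  have KG: "f \<in> G" if "f \<in> K" for f
    unfolding G_def deg_less_def using that fs.span_zero by (intro CollectI bexI[of _ f]) simp_all
  have "mon e \<in> G" for e
  proof (induction "size_exp e" arbitrary: e rule: less_induct)
    case less
    show ?case
    proof (cases "size_exp e < d0")
      case True
      then have "mon e - 0 \<in> deg_less d0" unfolding deg_less_def by (simp add: fs.span_base)
      then show ?thesis unfolding G_def using fs.subspace_0[OF K] by blast
    next
      case False
      then have "size_exp e \<notin> crit" using d0 by blast
      then obtain f where f: "f \<in> K" "mon e - f \<in> deg_less (size_exp e)" unfolding crit_def by blast
      have "deg_less (size_exp e) \<subseteq> G" unfolding deg_less_def
        using less by (intro fs.span_minimal sub) auto
      then have "(mon e - f) + f \<in> G"
        using fs.subspace_add[OF sub subsetD[OF _ f(2)] KG[OF f(1)]] by blast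
      then show ?thesis by simp
    qed
  qed
  then have "poly_fun \<subseteq> G" unfolding poly_fun_span_mon by (intro fs.span_minimal sub) auto
  then show ?thesis unfolding G_def by blast
qed

end

subsection \<open>Vector fields on the coordinate ring\<close>

lemma fspan_eq_span: "fspan S = fs.span S"
  unfolding fspan_def fs.span_explicit by (auto simp: fscale_def sum_fun_apply fun_eq_iff intro!: exI)

lemma restr_add: "restr X (f + g) = restr X f + restr X (g :: _ \<Rightarrow> 'k::field)"
  and restr_mult: "restr X (f * g) = restr X f * restr X g"
  and restr_fscale: "restr X (fscale c f) = fscale c (restr X f)"
  and restr_0: "restr X 0 = (0 :: _ \<Rightarrow> 'k)"
  by (auto simp: restr_def fun_eq_iff fun_apply)

lemma restr_in_coord_ring: "f \<in> poly_fun \<Longrightarrow> restr X f \<in> coord_ring X"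
  by (auto simp: coord_ring_def)

text \<open>The value of the vector field \<Sum> b_i \<partial>_i on the monomial x^m;
  \<open>along_up\<close> is its Leibniz rule.\<close>

definition along :: "('n::finite \<Rightarrow> ('n \<Rightarrow> 'k::field) \<Rightarrow> 'k) \<Rightarrow> ('n \<Rightarrow> nat) \<Rightarrow> ('n \<Rightarrow> 'k) \<Rightarrow> 'k" where
  "along b m = (\<Sum>i\<in>UNIV. fscale (of_nat (m i)) (b i * mon (dn i m)))"

lemma along_up: "along b (up j m) = (\<lambda>y. y j) * along b m + mon m * b j"
proof -
  have "fscale (of_nat (up j m i)) (b i * mon (dn i (up j m))) =
    (\<lambda>y. y j) * fscale (of_nat (m i)) (b i * mon (dn i m)) + (if i = j then mon m * b j else 0)" for i
  proof (cases "m i = 0")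
    case True
    then show ?thesis by (auto simp: up_def[of j m] dn_up[unfolded up_def] fun_eq_iff fun_apply dn_def)
  next
    case False
    show ?thesis
    proof (cases "i = j")
      case True
      have "mon m y = y j * mon (dn j m) y" for y :: "'a \<Rightarrow> 'b"
        using mon_up[of j "dn j m" y] False True by (simp add: up_dn)
      moreover have "up j m j = Suc (m j)" by (simp add: up_def)
      ultimately show ?thesis using True by (simp add: fun_eq_iff fun_apply algebra_simps)
    next
      case False
      then have 1: "dn i (up j m) = up j (dn i m)" by (auto simp: up_def dn_def fun_eq_iff)
      have 2: "up j m i = m i" using False by (simp add: up_def)
      have 3: "mon (up j (dn i m)) = (\<lambda>y. y j) * (mon (dn i m) :: ('a \<Rightarrow> 'b) \<Rightarrow> 'b)"
        by (simp add: fun_eq_iff fun_apply mon_up)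
      show ?thesis unfolding 1 2 3 using False by (simp add: fun_eq_iff fun_apply)
    qed
  qed
  then show ?thesis
    unfolding along_def by (simp add: sum.distrib sum_distrib_left)
qed

text \<open>A derivation of O(X) is determined by its values on the coordinates, so extending these
  to polynomials extends it to a vector field on affine space, compatibly with restriction.\<close>

lemma derivation_mon:
  fixes D :: "(('n::finite \<Rightarrow> 'k::field_char_0) \<Rightarrow> 'k) \<Rightarrow> ('n \<Rightarrow> 'k) \<Rightarrow> 'k"
  assumes D: "is_derivation X D"
    and b: "\<And>i. restr X (b i) = D (restr X (\<lambda>y. y i))"
  shows "D (restr X (mon m)) = restr X (along b m)"
proof (induction "size_exp m" arbitrary: m)
  case 0
  then have m: "m = 0" using size_exp_eq_0[of m] by simp
  let ?o = "restr X 1 :: ('n \<Rightarrow> 'k) \<Rightarrow> 'k"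
  have o: "?o \<in> coord_ring X" by (intro restr_in_coord_ring poly_fun_intros)
  \<comment> \<open>The unit of O(X) is idempotent, and the Leibniz rule for its square shows that
    \<open>D\<close> kills it.\<close>
  have sq: "(\<lambda>x. ?o x * ?o x) = ?o" by (auto simp: restr_def fun_eq_iff fun_apply)
  have "D (\<lambda>x. ?o x * ?o x) = (\<lambda>x. ?o x * D ?o x + ?o x * D ?o x)"
    using D o unfolding is_derivation_def by blast
  then have eq: "D ?o x = ?o x * D ?o x + ?o x * D ?o x" for x unfolding sq by metis
  have "D ?o x = 0" for x
  proof (cases "x \<in> X")
    case True
    then show ?thesis using eq[of x] by (simp add: restr_def fun_apply)
  next
    case False
    then show ?thesis using eq[of x] by (simp add: restr_def)
  qed
  then have "D ?o = 0" by (auto simp: fun_eq_iff fun_apply)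
  moreover have "along b 0 = 0" by (simp add: along_def fun_apply)
  ultimately show ?case by (simp add: m mon_zero restr_0)
next
  case (Suc n)
  then have "m \<noteq> 0" using size_exp_eq_0[of m] by auto
  then obtain j where j: "0 < m j" by (auto simp: fun_eq_iff fun_apply)
  define m' where "m' = dn j m"
  have m: "m = up j m'" using j by (simp add: m'_def up_dn)
  have n: "n = size_exp m'" using Suc(2) m size_exp_up[of j m'] by simp
  let ?x = "restr X (\<lambda>y. y j)" and ?p = "restr X (mon m')"
  have xp: "?x \<in> coord_ring X" "?p \<in> coord_ring X"
    by (intro restr_in_coord_ring pf_coord mon_poly_fun)+
  have "restr X (mon m) = (\<lambda>x. ?x x * ?p x)"
    by (auto simp: restr_def fun_eq_iff m mon_up)
  moreover have "D (\<lambda>x. ?x x * ?p x) = (\<lambda>x. ?x x * D ?p x + ?p x * D ?x x)"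
    using D xp unfolding is_derivation_def by blast
  ultimately have "D (restr X (mon m)) = ?x * D ?p + ?p * D ?x"
    by (simp add: plus_fun_def times_fun_def)
  also have "\<dots> = restr X (along b m)"
    unfolding m along_up restr_add restr_mult b Suc(1)[OF n] ..
  finally show ?case .
qed

theorem mainTheorem1:
  fixes X :: "('n::finite \<Rightarrow> 'k::{alg_closed_field, field_char_0}) set"
    and sc :: "'k \<Rightarrow> 'g::ab_group_add \<Rightarrow> 'g"
    and br :: "'g \<Rightarrow> 'g \<Rightarrow> 'g"
    and \<alpha> :: "'g \<Rightarrow> (('n \<Rightarrow> 'k) \<Rightarrow> 'k) \<Rightarrow> (('n \<Rightarrow> 'k) \<Rightarrow> 'k)"
  assumes "zclosed X"
    and "lie_algebra sc br"
    and "lie_hom_vect X sc br \<alpha>"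
    and "\<exists>L. finite L \<and> (\<forall>Z\<in>L. is_leaf X \<alpha> Z) \<and> X = \<Union>L"
  shows "coinv_fin_dim X \<alpha>"
proof -
  obtain L where L: "finite L" "\<And>Z. Z \<in> L \<Longrightarrow> is_leaf X \<alpha> Z" "X = \<Union>L" using assms(4) by blast
  have der: "is_derivation X (\<alpha> \<xi>)" for \<xi> using assms(3) unfolding lie_hom_vect_def by blast
  have "\<exists>p. p \<in> poly_fun \<and> restr X p = \<alpha> \<xi> (restr X (\<lambda>y. y i))" for \<xi> i
  proof -
    have "restr X (\<lambda>y. y i) \<in> coord_ring X" by (intro restr_in_coord_ring pf_coord)
    then have "\<alpha> \<xi> (restr X (\<lambda>y. y i)) \<in> coord_ring X" using der[of \<xi>] unfolding is_derivation_def by blast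
    then show ?thesis unfolding coord_ring_def by auto
  qed
  then obtain a where a: "\<And>\<xi> i. a \<xi> i \<in> poly_fun" "\<And>\<xi> i. restr X (a \<xi> i) = \<alpha> \<xi> (restr X (\<lambda>y. y i))" by metis
  define A where "A = {\<alpha> \<xi> h | \<xi> h. h \<in> coord_ring X}"
  \<comment> \<open>The preimage of the span of all \<alpha>(\<xi>)(h) in the polynomial ring, so
    that the quotient by \<open>K\<close> is the coinvariant space.\<close>
  define K where "K = {p \<in> poly_fun. restr X p \<in> fs.span A}"
  interpret leafy_coinvariants X a L K
  proof
    show "zclosed X" "finite L" "X = \<Union>L" by (fact assms(1) L)+
    show "a \<xi> i \<in> poly_fun" for \<xi> i by (fact a(1))
    show "range (\<lambda>\<xi> i. a \<xi> i z) = tangent_space Z z" if Z: "Z \<in> L" "z \<in> Z" for Z z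
    proof -
      have "z \<in> X" using Z L(3) by blast
      then have "a \<xi> i z = alpha_at X \<alpha> z \<xi> i" for \<xi> i
        using fun_cong[OF a(2), of \<xi> i z] by (simp add: alpha_at_def restr_def)
      then have eq: "(\<lambda>\<xi> i. a \<xi> i z) = alpha_at X \<alpha> z" by (intro ext)
      show ?thesis unfolding eq using L(2)[OF Z(1)] Z(2) unfolding is_leaf_def leaf_cond_def by blast
    qed
    show "fs.subspace K"
      unfolding fs.subspace_def K_def
      by (auto simp: restr_add restr_fscale restr_0 fs.span_zero fs.span_add fs.span_scale
          intro: poly_fun_intros(1,3) fscale_poly_fun)
    show "zideal X \<subseteq> K"
    proof
      fix f assume f: "f \<in> zideal X"
      then have "restr X f = 0" by (auto simp: zideal_def restr_def fun_eq_iff fun_apply)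
      then show "f \<in> K" using f by (simp add: K_def zideal_def fs.span_zero)
    qed
    show "(\<Sum>i\<in>UNIV. fscale (of_nat (m i)) (a \<xi> i * mon (dn i m))) \<in> K" for m \<xi>
    proof -
      have "along (a \<xi>) m \<in> poly_fun" unfolding along_def
        by (intro poly_fun_intros(7) fscale_poly_fun poly_fun_intros(4) a(1) mon_poly_fun)
      moreover have "restr X (along (a \<xi>) m) = \<alpha> \<xi> (restr X (mon m))"
        using derivation_mon[OF der a(2)] by simp
      moreover have "\<alpha> \<xi> (restr X (mon m)) \<in> A" unfolding A_def
        using restr_in_coord_ring[OF mon_poly_fun] by blast
      ultimately show ?thesis unfolding K_def along_def by (simp add: fs.span_base)
    qed
  qed
  obtain d0 where d0: "\<And>p. p \<in> poly_fun \<Longrightarrow> \<exists>f\<in>K. p - f \<in> deg_less d0" using finite_codimension by blast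
  define B where "B = (\<lambda>e. restr X (mon e)) ` {e. size_exp e < d0}"
  have fin: "finite B" unfolding B_def
  proof (intro finite_imageI finite_subset[OF _ finite_wt_le])
    show "{e :: 'n \<Rightarrow> nat. size_exp e < d0} \<subseteq> {e. wt (\<lambda>_. 1) e \<le> d0}" by (auto simp: size_exp_wt)
  qed simp
  have Bc: "B \<subseteq> coord_ring X" unfolding B_def by (auto intro: restr_in_coord_ring mon_poly_fun)
  have deg: "restr X g \<in> fs.span B" if "g \<in> deg_less d0" for g
    using that unfolding deg_less_def
  proof (induction rule: fs.span_induct_alt)
    case base
    show ?case by (simp add: restr_0 fs.span_zero)
  next
    case (step c x y)
    then have "restr X x \<in> fs.span B" unfolding B_def by (intro fs.span_base) auto
    then show ?case unfolding restr_add restr_fscale using step.IH by (intro fs.span_add fs.span_scale)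
  qed
  have "h \<in> fs.span (B \<union> A)" if h: "h \<in> coord_ring X" for h
  proof -
    obtain p where p: "h = restr X p" "p \<in> poly_fun" using h by (auto simp: coord_ring_def)
    from d0[OF p(2)] obtain f where f: "f \<in> K" "p - f \<in> deg_less d0" by blast
    have "restr X ((p - f) + f) \<in> fs.span (B \<union> A)" unfolding restr_add
    proof (intro fs.span_add)
      show "restr X (p - f) \<in> fs.span (B \<union> A)"
        using deg[OF f(2)] fs.span_mono[of B "B \<union> A"] by blast
      show "restr X f \<in> fs.span (B \<union> A)"
        using f(1) fs.span_mono[of A "B \<union> A"] unfolding K_def by blast
    qed
    then show ?thesis by (simp add: p(1))
  qed
  then show ?thesis unfolding coinv_fin_dim_def fspan_eq_span A_def[symmetric]
    using fin Bc by (intro exI[of _ B]) blast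
qed

end
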